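(* Let $c\in C^4(N)$ be a weakly regular cost, and use it to define the pseudo-metric $h$ on the domain $N\subset M\times\bar M$. Let $t\in\,]0,1[\,\mapsto(x,\bar x(t))\in N$ be a geodesic in $(N,h)$. Let $0\le t_0<t_1\le1$ and $y\in M$ be such that $]t_0,t_1[\times\{y\}$ lies in the interior of $$\Lambda:=\{(t,z)\in\,]0,1[\,\times M\mid z\in V(x,\bar x(t))\}.$$ Then the function $f(t)=-c(y,\bar x(t))+c(x,\bar x(t))$ satisfies $$f(t)\le\max\{f(t_0^+),f(t_1^-)\}\qquad\text{for all }t_0<t<t_1,$$ where $f(t_0^+)=\lim_{\epsilon\searrow0}f(t_0+\epsilon)$ and $f(t_1^-)=\lim_{\epsilon\searrow0}f(t_1-\epsilon)$.
   Context: **Setting.** $M,\bar M$ are smooth $n$-dimensional manifolds which, if not compact, are continuously embedded in separable metrizable spaces in which their closures are compact. The cost $c:\mathrm{cl}(M\times\bar M)\to\mathbf{R}\cup\{+\infty\}$ is lower semicontinuous and $N\subset M\times\bar M$ is a (open) subdomain on which $c$ is $C^4$. Put $N(\bar x)=\{x\in M\mid(x,\bar x)\in N\}$. **Pseudo-metric.** In local coordinates $x^i$ on $M$ and $x^{\bar j}$ on $\bar M$, subscripts on $c$ denote partial derivatives. The cost is non-degenerate if the matrix $(c_{i\bar j}(x,\bar x))$ is invertible at every $(x,\bar x)\in N$. Then $h=\frac12\begin{pmatrix}0&-\bar DDc\\-D\bar Dc&0\end{pmatrix}$ on $T_{(x,\bar x)}N=T_xM\oplus T_{\bar x}\bar M$,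 i.e. $h(p\oplus\bar p,p\oplus\bar p)=-c_{i\bar j}p^ip^{\bar j}$, is a pseudo-Riemannian metric on $N$. A vector $p\oplus\bar p$ is null if $h(p\oplus\bar p,p\oplus\bar p)=0$. **Curvature and weak regularity.** The (unnormalized) sectional curvature is $\sec_{(x,\bar x)}P\wedge Q=\sum R_{i'j'k'l'}P^{i'}Q^{j'}P^{k'}Q^{l'}$ (indices over all $2n$ coordinates of $N$), where $R$ is the Riemann tensor of $h$ with the sign convention $R_{i'j'k'}{}^{m'}=-\partial_{i'}\Gamma^{m'}_{j'k'}+\partial_{j'}\Gamma^{m'}_{i'k'}+\Gamma^{f'}_{k'i'}\Gamma^{m'}_{j'f'}-\Gamma^{f'}_{k'j'}\Gamma^{m'}_{i'f'}$, last index lowered with $h$. The cost $c\in C^4(N)$ is weakly regular on $N$ if it is non-degenerate and $\sec_{(x,\bar x)}(p\oplus0)\wedge(0\oplus\bar p)\ge0$ for every $(x,\bar x)\in N$ and all null vectors $p\oplus\bar p\in T_{(x,\bar x)}N$. **Illuminated set.** For $(x,\bar x)\in N$, $V(x,\bar x)\subset M$ is the set of points $y\in N(\bar x)$ for which there exists a curve from $(x,\bar x)$ to $(y,\bar x)$ in $N(\bar x)\times\{\bar x\}$ satisfying the geodesic equation on $(N,h)$. *)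

theory Defs
  imports "HOL-Analysis.Analysis"
begin

section \<open>Differentiability in coordinates\<close>

definition pd :: "'k::finite \<Rightarrow> (real^'k \<Rightarrow> real) \<Rightarrow> real^'k \<Rightarrow> real" where
  "pd m f z = deriv (\<lambda>t. f (z + t *\<^sub>R axis m 1)) 0"

text \<open>Only meant for open \<open>S\<close>: all iterated partial derivatives up to the given order exist and
  are continuous on \<open>S\<close>.\<close>

primrec Ck_on :: "nat \<Rightarrow> (real^'k::finite) set \<Rightarrow> (real^'k \<Rightarrow> real) \<Rightarrow> bool" where
  "Ck_on 0 S f \<longleftrightarrow> continuous_on S f"
| "Ck_on (Suc r) S f \<longleftrightarrow> continuous_on S f \<and>
     (\<forall>m. (\<forall>z\<in>S. (\<lambda>t. f (z + t *\<^sub>R axis m 1)) differentiable at 0) \<and> Ck_on r S (pd m f))"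

section \<open>Manifolds given by an atlas\<close>

type_synonym ('a, 'k) chart = "'a set \<times> ('a \<Rightarrow> real^'k)"

definition smooth_manifold :: "'a topology \<Rightarrow> ('a, 'n::finite) chart set \<Rightarrow> bool" where
  "smooth_manifold X A \<longleftrightarrow>
     Hausdorff_space X \<and>
     (\<exists>B. countable B \<and> (\<forall>V\<in>B. openin X V) \<and>
        (\<forall>U x. openin X U \<and> x \<in> U \<longrightarrow> (\<exists>V\<in>B. x \<in> V \<and> V \<subseteq> U))) \<and>
     topspace X = (\<Union>(U, \<phi>)\<in>A. U) \<and>
     (\<forall>(U, \<phi>)\<in>A. openin X U \<and> open (\<phi> ` U) \<and>
        homeomorphic_map (subtopology X U) (top_of_set (\<phi> ` U)) \<phi>) \<and>
     (\<forall>(U, \<phi>)\<in>A. \<forall>(W, \<psi>)\<in>A. \<forall>i r.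
        Ck_on r (\<phi> ` (U \<inter> W)) (\<lambda>u. \<psi> (inv_into U \<phi> u) $ i))"

text \<open>The standing assumption on the manifolds: the underlying set of \<open>X\<close> lies in a separable
  metrizable ambient space (the type \<open>'a\<close>), the inclusion is continuous and the closure is compact.
  The manifold topology \<open>X\<close> may be finer than the subspace topology. A compact manifold is covered
  by taking it as its own ambient space.\<close>

definition embedded_manifold ::
    "'a::{metric_space, second_countable_topology} topology \<Rightarrow> ('a, 'n::finite) chart set \<Rightarrow> bool" where
  "embedded_manifold X A \<longleftrightarrow>
     smooth_manifold X A \<and> continuous_map X euclidean id \<and> compact (closure (topspace X))"

text \<open>The \<open>2n\<close> coordinates on the product are indexed by \<open>'n + 'n\<close>: \<open>Inl i\<close> is the index \<open>i\<close> on the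
  first factor, \<open>Inr j\<close> is the barred index \<open>j\<close> on the second one.\<close>

definition osum :: "real^'n \<Rightarrow> real^'n \<Rightarrow> real^('n::finite + 'n)" (infixl \<open>\<oplus>\<^sub>v\<close> 65) where
  "p \<oplus>\<^sub>v q = (\<chi> m. case m of Inl i \<Rightarrow> p $ i | Inr j \<Rightarrow> q $ j)"

definition product_charts :: "('a, 'n::finite) chart set \<Rightarrow> ('b, 'n) chart set \<Rightarrow> ('a \<times> 'b) set
    \<Rightarrow> ('a \<times> 'b, 'n + 'n) chart set" where
  "product_charts A B N =
     {(N \<inter> (U \<times> W), \<lambda>(x, y). \<phi> x \<oplus>\<^sub>v \<psi> y) | U \<phi> W \<psi>. (U, \<phi>) \<in> A \<and> (W, \<psi>) \<in> B}"

section \<open>The cost and its pseudo-metric\<close>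

definition lsc_on :: "'a::topological_space set \<Rightarrow> ('a \<Rightarrow> ereal) \<Rightarrow> bool" where
  "lsc_on S f \<longleftrightarrow> (\<forall>z\<in>S. f z \<le> Liminf (at z within S) f)"

definition local_cost :: "('p \<Rightarrow> ereal) \<Rightarrow> ('p, 'k::finite) chart \<Rightarrow> real^'k \<Rightarrow> real" where
  "local_cost c K z = real_of_ereal (c (inv_into (fst K) (snd K) z))"

definition cost_C4_on :: "('a, 'n::finite) chart set \<Rightarrow> ('b, 'n) chart set \<Rightarrow> ('a \<times> 'b) set
    \<Rightarrow> ('a \<times> 'b \<Rightarrow> ereal) \<Rightarrow> bool" where
  "cost_C4_on A B N c \<longleftrightarrow> (\<forall>z\<in>N. \<bar>c z\<bar> \<noteq> \<infinity>) \<and>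
     (\<forall>K\<in>product_charts A B N. Ck_on 4 (snd K ` fst K) (local_cost c K))"

text \<open>In the following \<open>C\<close> is a cost written in coordinates, and \<open>g\<close> is a pseudo-metric
  written in coordinates.\<close>

definition mixed_hessian :: "(real^('n + 'n) \<Rightarrow> real) \<Rightarrow> real^('n::finite + 'n) \<Rightarrow> real^'n^'n" where
  "mixed_hessian C z = (\<chi> i j. pd (Inl i) (pd (Inr j) C) z)"

definition cost_metric ::
    "(real^('n + 'n) \<Rightarrow> real) \<Rightarrow> real^('n::finite + 'n) \<Rightarrow> real^('n + 'n)^('n + 'n)" where
  "cost_metric C z = (\<chi> a b. case (a, b) of
       (Inl i, Inr j) \<Rightarrow> - (1/2) * mixed_hessian C z $ i $ j
     | (Inr j, Inl i) \<Rightarrow> - (1/2) * mixed_hessian C z $ i $ j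
     | _ \<Rightarrow> 0)"

definition christoffel :: "(real^'k \<Rightarrow> real^'k^'k) \<Rightarrow> 'k \<Rightarrow> 'k \<Rightarrow> 'k \<Rightarrow> real^'k::finite \<Rightarrow> real" where
  "christoffel g m j k z = (1/2) * (\<Sum>l\<in>UNIV. matrix_inv (g z) $ m $ l *
     (pd j (\<lambda>w. g w $ k $ l) z + pd k (\<lambda>w. g w $ j $ l) z - pd l (\<lambda>w. g w $ j $ k) z))"

text \<open>\<open>riemann_up g i j k m\<close> is \<open>R\<^sub>i\<^sub>j\<^sub>k\<^sup>m\<close>. With this sign convention the sectional curvature of a
  round sphere is positive.\<close>

definition riemann_up ::
    "(real^'k \<Rightarrow> real^'k^'k) \<Rightarrow> 'k \<Rightarrow> 'k \<Rightarrow> 'k \<Rightarrow> 'k \<Rightarrow> real^'k::finite \<Rightarrow> real" where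
  "riemann_up g i j k m z =
     - pd i (christoffel g m j k) z + pd j (christoffel g m i k) z
     + (\<Sum>f\<in>UNIV. christoffel g f k i z * christoffel g m j f z
                 - christoffel g f k j z * christoffel g m i f z)"

definition riemann_down ::
    "(real^'k \<Rightarrow> real^'k^'k) \<Rightarrow> 'k \<Rightarrow> 'k \<Rightarrow> 'k \<Rightarrow> 'k \<Rightarrow> real^'k::finite \<Rightarrow> real" where
  "riemann_down g i j k l z = (\<Sum>m\<in>UNIV. riemann_up g i j k m z * g z $ m $ l)"

text \<open>Unnormalized.\<close>

definition sec :: "(real^'k \<Rightarrow> real^'k^'k) \<Rightarrow> real^'k \<Rightarrow> real^'k \<Rightarrow> real^'k::finite \<Rightarrow> real" where
  "sec g z P Q = (\<Sum>i\<in>UNIV. \<Sum>j\<in>UNIV. \<Sum>k\<in>UNIV. \<Sum>l\<in>UNIV.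
     riemann_down g i j k l z * P $ i * Q $ j * P $ k * Q $ l)"

definition null_vector :: "(real^'k \<Rightarrow> real^'k^'k) \<Rightarrow> real^'k \<Rightarrow> real^'k::finite \<Rightarrow> bool" where
  "null_vector g z P \<longleftrightarrow> (\<Sum>a\<in>UNIV. \<Sum>b\<in>UNIV. g z $ a $ b * P $ a * P $ b) = 0"

definition nondegenerate :: "('a, 'n::finite) chart set \<Rightarrow> ('b, 'n) chart set \<Rightarrow> ('a \<times> 'b) set
    \<Rightarrow> ('a \<times> 'b \<Rightarrow> ereal) \<Rightarrow> bool" where
  "nondegenerate A B N c \<longleftrightarrow> (\<forall>K\<in>product_charts A B N. \<forall>z\<in>snd K ` fst K.
     invertible (mixed_hessian (local_cost c K) z))"

definition weakly_regular :: "('a, 'n::finite) chart set \<Rightarrow> ('b, 'n) chart set \<Rightarrow> ('a \<times> 'b) set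
    \<Rightarrow> ('a \<times> 'b \<Rightarrow> ereal) \<Rightarrow> bool" where
  "weakly_regular A B N c \<longleftrightarrow>
     cost_C4_on A B N c \<and> nondegenerate A B N c \<and>
     (\<forall>K\<in>product_charts A B N. \<forall>z\<in>snd K ` fst K. \<forall>p q.
        null_vector (cost_metric (local_cost c K)) z (p \<oplus>\<^sub>v q) \<longrightarrow>
        sec (cost_metric (local_cost c K)) z (p \<oplus>\<^sub>v 0) (0 \<oplus>\<^sub>v q) \<ge> 0)"

section \<open>Geodesics and the illuminated set\<close>

text \<open>\<open>T\<close> is an interval; at an endpoint belonging to \<open>T\<close> derivatives are one-sided. The velocity \<open>v\<close>
  and acceleration \<open>a\<close> are only relevant at times when the curve is in the chart \<open>K\<close>.\<close>

definition geodesic_on :: "'a topology \<Rightarrow> ('a, 'n::finite) chart set \<Rightarrow> 'b topology \<Rightarrow> ('b, 'n) chart set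
    \<Rightarrow> ('a \<times> 'b) set \<Rightarrow> ('a \<times> 'b \<Rightarrow> ereal) \<Rightarrow> real set \<Rightarrow> (real \<Rightarrow> 'a \<times> 'b) \<Rightarrow> bool" where
  "geodesic_on X A Y B N c T \<gamma> \<longleftrightarrow>
     continuous_map (top_of_set T) (subtopology (prod_topology X Y) N) \<gamma> \<and>
     (\<forall>K\<in>product_charts A B N. \<exists>v a. \<forall>t\<in>T. \<gamma> t \<in> fst K \<longrightarrow>
        ((\<lambda>s. snd K (\<gamma> s)) has_vector_derivative v t) (at t within T) \<and>
        (v has_vector_derivative a t) (at t within T) \<and>
        (\<forall>m. a t $ m + (\<Sum>j\<in>UNIV. \<Sum>k\<in>UNIV.
           christoffel (cost_metric (local_cost c K)) m j k (snd K (\<gamma> t)) * v t $ j * v t $ k) = 0))"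

definition slice :: "('a \<times> 'b) set \<Rightarrow> 'b \<Rightarrow> 'a set" where
  "slice N xb = {x. (x, xb) \<in> N}"

definition illuminated :: "'a topology \<Rightarrow> ('a, 'n::finite) chart set \<Rightarrow> 'b topology \<Rightarrow> ('b, 'n) chart set
    \<Rightarrow> ('a \<times> 'b) set \<Rightarrow> ('a \<times> 'b \<Rightarrow> ereal) \<Rightarrow> 'a \<Rightarrow> 'b \<Rightarrow> 'a set" where
  "illuminated X A Y B N c x xb = {y \<in> slice N xb. \<exists>\<gamma>.
     \<gamma> 0 = (x, xb) \<and> \<gamma> 1 = (y, xb) \<and> \<gamma> ` {0..1} \<subseteq> slice N xb \<times> {xb} \<and>
     geodesic_on X A Y B N c {0..1} \<gamma>}"

end

theory Submission
  imports Defs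
begin

text \<open>Write \<open>\<kappa> z t = c (z, xb t)\<close>. The geodesic equation of a curve in a slice \<open>X \<times> {xb t}\<close> says that
  the barred first derivatives of the cost are affine along it, and symmetrically for \<open>{x} \<times> Y\<close>.
  Along a geodesic from \<open>(x, xb t)\<close> to \<open>(z, xb t)\<close> the function \<open>\<partial>\<^sub>t \<kappa>\<close> is therefore affine, and the second
  derivative of \<open>\<partial>\<^sub>t\<^sup>2 \<kappa>\<close> is minus twice the sectional curvature of the two velocities. If
  \<open>\<partial>\<^sub>t \<kappa>\<close> agrees at both ends, the velocities form a null vector, weak regularity applies, and
  \<open>\<partial>\<^sub>t (\<kappa> x - \<kappa> z) = 0\<close> implies \<open>\<partial>\<^sub>t\<^sup>2 (\<kappa> x - \<kappa> z) \<ge> 0\<close>. Since this holds for all \<open>z\<close> near \<open>y\<close>, and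
  the differential of \<open>\<partial>\<^sub>t \<kappa>\<close> in \<open>z\<close> does not vanish unless \<open>xb\<close> is constant, the implicit function
  argument improves it to \<open>f'' \<ge> - k \<bar>f'\<bar>\<close> near every critical time. Hence \<open>f'\<close> stays positive once it is
  positive.\<close>

section \<open>Calculus with partial derivatives\<close>

text \<open>Knowing only that \<open>f' = 0\<close> forces \<open>f'' >= 0\<close> would not
  suffice: \<open>-t^4\<close> has this property and a strict interior maximum. Hence the role of
  the interior of the illuminated region: the implication holds for all points \<open>z\<close> near
  \<open>y\<close>, and \<open>y\<close> can be compared with a nearby \<open>z\<close> whose first
  derivative vanishes. That such a \<open>z\<close> lies within a distance proportional to
  \<open>|f'|\<close> rests on nondegeneracy, because the differential in \<open>z\<close> of the
  first time derivative of the cost is the mixed Hessian applied to the velocity of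
  \<open>xb\<close>. The cost is only C^4, so the metric is only C^2 and the curvature uses every
  derivative there is. Lowering an index removes the inverse metric and leaves partial derivatives
  of the cost. A slice geodesic may cross several charts of \<open>X\<close> while
  \<open>xb t\<close> stays in one chart of \<open>Y\<close>; the quantities followed along it are
  therefore time derivatives of \<kappa>, which do not depend on the chart of
  \<open>X\<close>.\<close>

lemma pd_has_derivative:
  assumes "(\<lambda>t. f (z + t *\<^sub>R axis m 1)) differentiable at 0"
  shows "((\<lambda>t. f (z + t *\<^sub>R axis m 1)) has_real_derivative pd m f z) (at 0)"
  using assms unfolding pd_def
  by (simp add: DERIV_deriv_iff_real_differentiable)

lemma pd_eqI:
  assumes "((\<lambda>t. f (z + t *\<^sub>R axis m 1)) has_real_derivative D) (at 0)"
  shows "pd m f z = D"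
  using assms unfolding pd_def by (rule DERIV_imp_deriv)

lemma pd_zero [simp]: "pd m (\<lambda>w. 0) z = 0"
  by (simp add: pd_def)

lemma line_has_derivative:
  assumes "(\<lambda>t. f ((z + s *\<^sub>R axis m 1) + t *\<^sub>R axis m 1)) differentiable at 0"
  shows "((\<lambda>t. f (z + t *\<^sub>R axis m 1)) has_real_derivative pd m f (z + s *\<^sub>R axis m 1)) (at s)"
proof -
  have "((\<lambda>t. f ((z + s *\<^sub>R axis m 1) + t *\<^sub>R axis m 1)) has_real_derivative
      pd m f (z + s *\<^sub>R axis m 1)) (at 0)"
    by (rule pd_has_derivative[OF assms])
  then have "((\<lambda>t. f (z + (t + s) *\<^sub>R axis m 1)) has_real_derivative
      pd m f (z + s *\<^sub>R axis m 1)) (at 0)"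
    by (simp add: algebra_simps)
  then show ?thesis
    using DERIV_at_within_shift[of "\<lambda>t. f (z + t *\<^sub>R axis m 1)" "pd m f (z + s *\<^sub>R axis m 1)" s 0 UNIV]
    by (simp add: add.commute)
qed

lemma Ck_on_imp_continuous: "Ck_on r S f \<Longrightarrow> continuous_on S f"
  by (cases r) auto

lemma Ck_on_Suc_imp: "Ck_on (Suc r) S f \<Longrightarrow> Ck_on r S f"
proof (induction r arbitrary: f)
  case 0
  then show ?case by simp
next
  case (Suc r)
  have "continuous_on S f" using Suc.prems by simp
  moreover have "(\<lambda>t. f (z + t *\<^sub>R axis m 1)) differentiable at 0" if "z \<in> S" for z m
    using Suc.prems that by simp
  moreover have "Ck_on r S (pd m f)" for m
    by (rule Suc.IH) (use Suc.prems in simp)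
  ultimately show ?case by simp
qed

lemma Ck_on_pd: "Ck_on (Suc r) S f \<Longrightarrow> Ck_on r S (pd m f)"
  by simp

lemma Ck_on_differentiable:
  "Ck_on (Suc r) S f \<Longrightarrow> z \<in> S \<Longrightarrow> (\<lambda>t. f (z + t *\<^sub>R axis m 1)) differentiable at 0"
  by simp

lemma eventually_line_in_open:
  fixes z e :: "'v::real_normed_vector"
  assumes "open S" "z \<in> S"
  shows "\<forall>\<^sub>F t in nhds (0::real). z + t *\<^sub>R e \<in> S"
proof -
  have "((\<lambda>t. z + t *\<^sub>R e) \<longlongrightarrow> z + 0 *\<^sub>R e) (nhds 0)"
    by (intro tendsto_intros tendsto_ident_at filterlim_ident)
  then show ?thesis
    using topological_tendstoD[of "\<lambda>t. z + t *\<^sub>R e" "z + 0 *\<^sub>R e" "nhds 0" S] assms by simp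
qed

lemma pd_cong_open:
  assumes "open S" "z \<in> S" "\<And>w. w \<in> S \<Longrightarrow> f w = g w"
  shows "pd m f z = pd m g z"
proof -
  have "\<forall>\<^sub>F t in nhds 0. f (z + t *\<^sub>R axis m 1) = g (z + t *\<^sub>R axis m 1)"
    using eventually_line_in_open[OF assms(1,2)] by eventually_elim (use assms in auto)
  then show ?thesis
    unfolding pd_def by (intro deriv_cong_ev) auto
qed

lemma component_sum_axis:
  "(\<Sum>m\<in>I. (h::real^'k::finite) $ m *\<^sub>R axis m (1::real)) $ j = (if j \<in> I then h $ j else 0)"
proof -
  have "(\<Sum>m\<in>I. h $ m *\<^sub>R axis m (1::real)) $ j = (\<Sum>m\<in>I. if m = j then h $ m else 0)"
    unfolding sum_component by (rule sum.cong) (auto simp: axis_def)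
  then show ?thesis by (simp add: sum.delta')
qed

lemma norm_le_componentwise:
  fixes u v :: "real^'k::finite"
  assumes "\<And>j. \<bar>u $ j\<bar> \<le> \<bar>v $ j\<bar>"
  shows "norm u \<le> norm v"
  unfolding norm_vec_def by (rule L2_set_mono) (use assms in auto)

text \<open>The increment along \<open>h\<close> is telescoped over the coordinates, each step being controlled by the
  mean value inequality.\<close>

lemma Ck_on_has_derivative:
  fixes f :: "real^'k::finite \<Rightarrow> real"
  assumes S: "open S" "z \<in> S" and f: "Ck_on (Suc r) S f"
  shows "(f has_derivative (\<lambda>h. \<Sum>m\<in>UNIV. h $ m * pd m f z)) (at z)"
proof -
  have lin: "bounded_linear (\<lambda>h. \<Sum>m\<in>UNIV. h $ m * pd m f z)"
    by (intro bounded_linear_sum bounded_linear_compose[OF bounded_linear_mult_left bounded_linear_vec_nth])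
  have cont: "isCont (pd m f) z" for m
    using Ck_on_imp_continuous[OF Ck_on_pd[OF f]] S continuous_on_eq_continuous_at by blast
  have key: "\<exists>d>0. \<forall>h. norm h < d \<longrightarrow>
      \<bar>f (z + h) - f z - (\<Sum>m\<in>UNIV. h $ m * pd m f z)\<bar> \<le> e * norm h" if e: "e > 0" for e
  proof -
    \<comment> \<open>One share of the error for each of the \<open>CARD('k)\<close> coordinate
      steps.\<close>
    define e' where "e' = e / CARD('k)"
    have e': "e' > 0" using e by (simp add: e'_def)
    have "\<forall>\<^sub>F w in nhds z. \<forall>m. \<bar>pd m f w - pd m f z\<bar> < e'"
      using cont[unfolded isCont_def tendsto_at_iff_tendsto_nhds, THEN tendstoD, OF e']
      by (intro eventually_all_finite) (simp add: dist_real_def)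
    then have "\<forall>\<^sub>F w in nhds z. w \<in> S \<and> (\<forall>m. \<bar>pd m f w - pd m f z\<bar> < e')"
      using S by (intro eventually_conj eventually_nhds_in_open)
    then obtain d where d: "d > 0"
      "\<And>w. dist w z < d \<Longrightarrow> w \<in> S \<and> (\<forall>m. \<bar>pd m f w - pd m f z\<bar> < e')"
      unfolding eventually_nhds_metric by auto
    have "\<bar>f (z + h) - f z - (\<Sum>m\<in>UNIV. h $ m * pd m f z)\<bar> \<le> e * norm h" if h: "norm h < d" for h
    proof -
      define H where "H I = (\<Sum>m\<in>I. h $ m *\<^sub>R axis m (1::real))" for I
      have claim: "\<bar>f (z + H I) - f z - (\<Sum>m\<in>I. h $ m * pd m f z)\<bar> \<le> card I * (e' * norm h)"
        if "finite I" for I :: "'k set"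
        using that
      proof (induction I rule: finite_induct)
        case empty
        then show ?case by (simp add: H_def)
      next
        case (insert m I)
        define T where "T = closed_segment 0 (h $ m)"
        have T: "\<bar>t\<bar> \<le> \<bar>h $ m\<bar>" if "t \<in> T" for t
          using that unfolding T_def by (auto simp: closed_segment_eq_real_ivl split: if_splits)
        \<comment> \<open>Every intermediate point differs from \<open>z\<close> by a vector that is
          dominated by \<open>h\<close> in each component, so the whole path stays in the
          ball.\<close>
        have near: "dist (z + H I + t *\<^sub>R axis m 1) z < d" if "t \<in> T" for t
        proof -
          have "norm (H I + t *\<^sub>R axis m 1) \<le> norm h"
          proof (rule norm_le_componentwise)
            fix j
            show "\<bar>(H I + t *\<^sub>R axis m 1) $ j\<bar> \<le> \<bar>h $ j\<bar>"
              using insert.hyps T[OF that] unfolding H_def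
              by (simp add: component_sum_axis del: sum_component) (auto simp: axis_def)
          qed
          then show ?thesis using h by (simp add: dist_norm add.assoc)
        qed
        \<comment> \<open>With the linear term subtracted, the derivative of \<open>?g\<close> is
          the oscillation of \<open>pd m f\<close>, which is at most \<open>e'\<close>.\<close>
        let ?g = "\<lambda>t. f (z + H I + t *\<^sub>R axis m 1) - t * pd m f z"
        have "norm (?g (h $ m) - ?g 0) \<le> e' * norm (h $ m - 0)"
        proof (rule field_differentiable_bound[where S = T and
              f' = "\<lambda>t. pd m f (z + H I + t *\<^sub>R axis m 1) - pd m f z"])
          show "convex T" by (simp add: T_def)
          show "h $ m \<in> T" "0 \<in> T" by (auto simp: T_def)
          fix t assume t: "t \<in> T"
          have "((\<lambda>t. f (z + H I + t *\<^sub>R axis m 1)) has_real_derivative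
              pd m f (z + H I + t *\<^sub>R axis m 1)) (at t)"
            by (rule line_has_derivative, rule Ck_on_differentiable[OF f])
               (use d(2)[OF near[OF t]] in auto)
          then have "(?g has_field_derivative
              pd m f (z + H I + t *\<^sub>R axis m 1) - 1 * pd m f z) (at t)"
            by (intro DERIV_diff DERIV_cmult_right DERIV_ident)
          then show "(?g has_field_derivative
              pd m f (z + H I + t *\<^sub>R axis m 1) - pd m f z) (at t within T)"
            by (simp add: has_field_derivative_at_within)
          show "norm (pd m f (z + H I + t *\<^sub>R axis m 1) - pd m f z) \<le> e'"
            using d(2)[OF near[OF t]] by (simp add: less_imp_le)
        qed
        also have "\<dots> \<le> e' * norm h"
          using e' by (intro mult_left_mono) (simp_all add: component_le_norm_cart)
        finally have "\<bar>f (z + H I + h $ m *\<^sub>R axis m 1) - f (z + H I) - h $ m * pd m f z\<bar>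
            \<le> e' * norm h"
          by simp
        moreover have "H (insert m I) = H I + h $ m *\<^sub>R axis m 1"
          using insert.hyps by (simp add: H_def)
        ultimately show ?case
          using insert by (simp add: algebra_simps)
      qed
      have "H UNIV = h"
        by (simp add: vec_eq_iff H_def component_sum_axis del: sum_component)
      then show ?thesis using claim[of UNIV] by (simp add: e'_def)
    qed
    then show ?thesis using d(1) by blast
  qed
  show ?thesis
    unfolding has_derivative_at_alt
  proof (intro conjI lin allI impI)
    fix e :: real assume "e > 0"
    then obtain d where d: "d > 0" "\<And>h. norm h < d \<Longrightarrow>
      \<bar>f (z + h) - f z - (\<Sum>m\<in>UNIV. h $ m * pd m f z)\<bar> \<le> e * norm h"
      using key by blast
    show "\<exists>d>0. \<forall>y. norm (y - z) < d \<longrightarrow>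
        norm (f y - f z - (\<Sum>m\<in>UNIV. (y - z) $ m * pd m f z)) \<le> e * norm (y - z)"
    proof (intro exI[of _ d] conjI allI impI d(1))
      fix y assume "norm (y - z) < d"
      then show "norm (f y - f z - (\<Sum>m\<in>UNIV. (y - z) $ m * pd m f z)) \<le> e * norm (y - z)"
        using d(2)[of "y - z"] by simp
    qed
  qed
qed

text \<open>Two mean value theorems: one in direction \<open>i\<close> for the difference of
  \<open>f\<close> on two parallel segments, one in direction \<open>j\<close> for
  \<open>pd i f\<close>. The second difference is symmetric in \<open>i\<close> and
  \<open>j\<close>, whereas the derivative obtained is not visibly so.\<close>

lemma second_difference_mean_value:
  fixes f :: "real^'k::finite \<Rightarrow> real"
  assumes f: "Ck_on (Suc (Suc r)) S f" and t: "t > 0" and S: "cball z (2 * t) \<subseteq> S"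
  shows "\<exists>w\<in>cball z (2 * t). f (z + t *\<^sub>R axis i 1 + t *\<^sub>R axis j 1) - f (z + t *\<^sub>R axis i 1)
     - f (z + t *\<^sub>R axis j 1) + f z = t * t * pd j (pd i f) w"
proof -
  have in_ball: "z + a *\<^sub>R axis i 1 + b *\<^sub>R axis j 1 \<in> cball z (2 * t)"
    if "0 \<le> a" "a \<le> t" "0 \<le> b" "b \<le> t" for a b
  proof -
    have "norm (a *\<^sub>R axis i (1::real) + b *\<^sub>R axis j 1) \<le> a + b"
      using that by (intro order_trans[OF norm_triangle_ineq]) simp
    moreover have "dist z (z + a *\<^sub>R axis i 1 + b *\<^sub>R axis j 1) = norm (a *\<^sub>R axis i (1::real) + b *\<^sub>R axis j 1)"
      by (metis add.assoc add_diff_cancel_left' dist_commute dist_norm)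
    ultimately show ?thesis
      using that by simp
  qed
  have in0: "z + a *\<^sub>R axis i 1 \<in> cball z (2 * t)" if "0 \<le> a" "a \<le> t" for a
    using in_ball[of a 0] that t by simp
  let ?p = "\<lambda>s. f (z + t *\<^sub>R axis j 1 + s *\<^sub>R axis i 1) - f (z + s *\<^sub>R axis i 1)"
  let ?p' = "\<lambda>s. pd i f (z + t *\<^sub>R axis j 1 + s *\<^sub>R axis i 1) - pd i f (z + s *\<^sub>R axis i 1)"
  have "\<exists>s>0. s < t \<and> ?p t - ?p 0 = (t - 0) * ?p' s"
  proof (rule MVT2[OF t])
    fix s assume s: "0 \<le> s" "s \<le> t"
    show "(?p has_real_derivative ?p' s) (at s)"
      by (intro derivative_intros line_has_derivative Ck_on_differentiable[OF f])
        (use in_ball[of s t] in0[of s] s t S in \<open>auto simp: algebra_simps\<close>)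
  qed
  then obtain s where s: "0 < s" "s < t" "?p t - ?p 0 = t * ?p' s" by auto
  let ?q = "\<lambda>u. pd i f (z + s *\<^sub>R axis i 1 + u *\<^sub>R axis j 1)"
  have "\<exists>u>0. u < t \<and> ?q t - ?q 0 = (t - 0) * pd j (pd i f) (z + s *\<^sub>R axis i 1 + u *\<^sub>R axis j 1)"
  proof (rule MVT2[OF t])
    fix u assume u: "0 \<le> u" "u \<le> t"
    show "(?q has_real_derivative pd j (pd i f) (z + s *\<^sub>R axis i 1 + u *\<^sub>R axis j 1)) (at u)"
      by (rule line_has_derivative, rule Ck_on_differentiable[OF Ck_on_pd[OF f]])
        (use in_ball[of s u] u s S in auto)
  qed
  then obtain u where u: "0 < u" "u < t"
    "?q t - ?q 0 = t * pd j (pd i f) (z + s *\<^sub>R axis i 1 + u *\<^sub>R axis j 1)" by auto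
  show ?thesis
  proof (rule bexI[of _ "z + s *\<^sub>R axis i 1 + u *\<^sub>R axis j 1"])
    show "z + s *\<^sub>R axis i 1 + u *\<^sub>R axis j 1 \<in> cball z (2 * t)"
      using in_ball[of s u] s u by auto
    have "z + t *\<^sub>R axis j 1 + s *\<^sub>R axis i 1 = z + s *\<^sub>R axis i 1 + t *\<^sub>R axis j 1" for s
      by (simp add: algebra_simps)
    then show "f (z + t *\<^sub>R axis i 1 + t *\<^sub>R axis j 1) - f (z + t *\<^sub>R axis i 1)
       - f (z + t *\<^sub>R axis j 1) + f z = t * t * pd j (pd i f) (z + s *\<^sub>R axis i 1 + u *\<^sub>R axis j 1)"
      using s(3) u(3) by (simp add: algebra_simps)
  qed
qed

text \<open>Schwarz's theorem. One second difference is expressed by either mixed derivative, each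
  at some point near \<open>z\<close>; continuity of both does the rest.\<close>

lemma pd_commute:
  fixes f :: "real^'k::finite \<Rightarrow> real"
  assumes S: "open S" "z \<in> S" and f: "Ck_on (Suc (Suc r)) S f"
  shows "pd i (pd j f) z = pd j (pd i f) z"
proof -
  let ?A = "pd i (pd j f)" and ?B = "pd j (pd i f)"
  have cont: "isCont (pd a (pd b f)) z" for a b
    using Ck_on_imp_continuous[OF Ck_on_pd[OF Ck_on_pd[OF f]]] S
      continuous_on_eq_continuous_at by blast
  have "\<bar>?A z - ?B z\<bar> \<le> e" if "e > 0" for e
  proof -
    have near: "\<forall>\<^sub>F w in nhds z. \<bar>pd a (pd b f) w - pd a (pd b f) z\<bar> < e / 2" for a b
      using cont[of a b, unfolded isCont_def tendsto_at_iff_tendsto_nhds, THEN tendstoD, of "e / 2"]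
        \<open>e > 0\<close> by (simp add: dist_real_def)
    have "\<forall>\<^sub>F w in nhds z. w \<in> S \<and> \<bar>?A w - ?A z\<bar> < e / 2 \<and> \<bar>?B w - ?B z\<bar> < e / 2"
      using S by (intro eventually_conj near eventually_nhds_in_open)
    then obtain d where d: "d > 0"
      "\<And>w. dist w z < d \<Longrightarrow> w \<in> S \<and> \<bar>?A w - ?A z\<bar> < e / 2 \<and> \<bar>?B w - ?B z\<bar> < e / 2"
      unfolding eventually_nhds_metric by auto
    \<comment> \<open>The mean value points lie within \<open>2 * t = d / 2\<close> of
      \<open>z\<close>, hence strictly inside the ball of radius \<open>d\<close>.\<close>
    define t where "t = d / 4"
    have t: "t > 0" "cball z (2 * t) \<subseteq> S"
      using d by (auto simp: t_def dist_commute)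
    obtain w where w: "w \<in> cball z (2 * t)" "f (z + t *\<^sub>R axis i 1 + t *\<^sub>R axis j 1)
       - f (z + t *\<^sub>R axis i 1) - f (z + t *\<^sub>R axis j 1) + f z = t * t * ?B w"
      using second_difference_mean_value[OF f t] by blast
    obtain w' where w': "w' \<in> cball z (2 * t)" "f (z + t *\<^sub>R axis j 1 + t *\<^sub>R axis i 1)
       - f (z + t *\<^sub>R axis j 1) - f (z + t *\<^sub>R axis i 1) + f z = t * t * ?A w'"
      using second_difference_mean_value[OF f t] by blast
    have "z + t *\<^sub>R axis j 1 + t *\<^sub>R axis i 1 = z + t *\<^sub>R axis i 1 + t *\<^sub>R axis j 1"
      by (simp add: algebra_simps)
    then have "t * t * ?B w = t * t * ?A w'" using w(2) w'(2) by (simp only:)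
    then have "?B w = ?A w'" using t by simp
    moreover have "dist w z < d" "dist w' z < d"
      using w(1) w'(1) d(1) by (auto simp: t_def dist_commute)
    ultimately show ?thesis using d(2)[of w] d(2)[of w'] by linarith
  qed
  then have "\<bar>?A z - ?B z\<bar> \<le> 0"
    by (rule field_le_epsilon[of _ 0, simplified])
  then show ?thesis by simp
qed

section \<open>Chain rules along curves\<close>

lemma has_vector_derivative_vec_nth:
  "(u has_vector_derivative v) F \<Longrightarrow> ((\<lambda>s. u s $ m) has_real_derivative v $ m) F"
  using bounded_linear.has_vector_derivative[OF bounded_linear_vec_nth]
  unfolding has_real_derivative_iff_has_vector_derivative by blast

lemma has_derivative_along_curve:
  fixes f :: "real^'k::finite \<Rightarrow> real"
  assumes "open S" "u t \<in> S" "Ck_on (Suc r) S f" "(u has_vector_derivative v) (at t within T)"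
  shows "((\<lambda>s. f (u s)) has_real_derivative (\<Sum>m\<in>UNIV. v $ m * pd m f (u t))) (at t within T)"
proof -
  have "((\<lambda>s. f (u s)) has_vector_derivative (\<Sum>m\<in>UNIV. v $ m * pd m f (u t))) (at t within T)"
    using vector_derivative_diff_chain_within[OF assms(4)
        has_derivative_at_withinI[OF Ck_on_has_derivative[OF assms(1-3)]]]
    by (simp add: o_def)
  then show ?thesis by (simp add: has_real_derivative_iff_has_vector_derivative)
qed

lemma has_second_derivative_along_curve:
  fixes f :: "real^'k::finite \<Rightarrow> real"
  assumes "open S" "u t \<in> S" "Ck_on (Suc (Suc r)) S f"
    "(u has_vector_derivative v t) (at t within T)"
    "(v has_vector_derivative a) (at t within T)"
  shows "((\<lambda>s. \<Sum>m\<in>UNIV. v s $ m * pd m f (u s)) has_real_derivative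
     (\<Sum>m\<in>UNIV. a $ m * pd m f (u t))
       + (\<Sum>m\<in>UNIV. \<Sum>l\<in>UNIV. v t $ m * v t $ l * pd m (pd l f) (u t))) (at t within T)"
proof -
  have *: "((\<lambda>s. v s $ m * pd m f (u s)) has_real_derivative
     a $ m * pd m f (u t) + (\<Sum>l\<in>UNIV. v t $ l * pd l (pd m f) (u t)) * v t $ m) (at t within T)"
    for m
    by (rule DERIV_mult[OF has_vector_derivative_vec_nth[OF assms(5)]
          has_derivative_along_curve[OF assms(1,2) Ck_on_pd[OF assms(3)] assms(4)]])
  have "(\<Sum>m\<in>UNIV. \<Sum>l\<in>UNIV. v t $ m * v t $ l * pd m (pd l f) (u t))
      = (\<Sum>l\<in>UNIV. \<Sum>m\<in>UNIV. v t $ m * v t $ l * pd m (pd l f) (u t))"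
    by (rule sum.swap)
  then show ?thesis
    by (intro DERIV_cong[OF DERIV_sum[OF *]])
      (simp add: sum.distrib sum_distrib_left sum_distrib_right mult_ac)
qed

section \<open>The pseudo-metric in coordinates\<close>

lemma differentiable_prod_real:
  fixes f :: "'i \<Rightarrow> real \<Rightarrow> real"
  assumes "\<And>i. i \<in> I \<Longrightarrow> f i differentiable (at t0 within T)"
  shows "(\<lambda>t. \<Prod>i\<in>I. f i t) differentiable (at t0 within T)"
  using assms by (induction I rule: infinite_finite_induct) (auto intro: differentiable_mult)

lemma differentiable_det:
  fixes A :: "real \<Rightarrow> real^'n^'n::finite"
  assumes "\<And>i j. (\<lambda>t. A t $ i $ j) differentiable (at t0 within T)"
  shows "(\<lambda>t. det (A t)) differentiable (at t0 within T)"
  unfolding det_def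
  by (intro differentiable_sum ballI differentiable_mult differentiable_const
      differentiable_prod_real assms finite_permutations finite)

lemma continuous_on_det:
  fixes A :: "'t::topological_space \<Rightarrow> real^'n^'n::finite"
  assumes "\<And>i j. continuous_on T (\<lambda>t. A t $ i $ j)"
  shows "continuous_on T (\<lambda>t. det (A t))"
  unfolding det_def by (intro continuous_intros assms)

lemma matrix_inv_right: "invertible A \<Longrightarrow> A ** matrix_inv A = mat 1"
  unfolding invertible_def matrix_inv_def by (rule conjunct1[OF someI_ex])

text \<open>Cramer's rule: a quotient of polynomials in the coefficients inherits their
  differentiability and continuity, so neither has to be studied for
  \<open>matrix_inv\<close>.\<close>

lemma linear_solution:
  fixes M :: "real^'n^'n::finite"
  assumes "invertible M" "M *v u = b"
  shows "u $ m = det (\<chi> i j. if j = m then b $ i else M $ i $ j) / det M"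
  using cramer[of M u b] assms by (simp add: invertible_det_nz)

lemma differentiable_eventually_eq:
  fixes u w :: "real \<Rightarrow> real"
  assumes "u differentiable at t0" "\<forall>\<^sub>F t in nhds t0. u t = w t"
  shows "w differentiable at t0"
proof -
  obtain D where "(u has_real_derivative D) (at t0)"
    using assms(1) unfolding real_differentiable_def by blast
  then have "(w has_real_derivative D) (at t0)"
    by (rule iffD1[OF DERIV_cong_ev[OF refl assms(2) refl]])
  then show ?thesis
    unfolding real_differentiable_def by blast
qed

lemma differentiable_linear_solution:
  fixes M :: "real \<Rightarrow> real^'n^'n::finite"
  assumes inv: "\<forall>\<^sub>F t in nhds t0. invertible (M t) \<and> M t *v u t = b t"
    and M: "\<And>i j. (\<lambda>t. M t $ i $ j) differentiable at t0"
    and b: "\<And>i. (\<lambda>t. b t $ i) differentiable at t0"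
  shows "(\<lambda>t. u t $ m) differentiable at t0"
proof -
  let ?D = "\<lambda>t. det (\<chi> i j. if j = m then b t $ i else M t $ i $ j) / det (M t)"
  have "(\<lambda>t. (\<chi> i j. if j = m then b t $ i else M t $ i $ j) $ i $ j) differentiable at t0" for i j
    using M b by (cases "j = m") auto
  then have "?D differentiable at t0"
    using eventually_nhds_x_imp_x[OF inv]
    by (intro differentiable_divide differentiable_det M) (auto simp: invertible_det_nz)
  moreover have "\<forall>\<^sub>F t in nhds t0. ?D t = u t $ m"
    by (rule eventually_mono[OF inv]) (use linear_solution[symmetric, where m = m] in blast)
  ultimately show ?thesis
    by (rule differentiable_eventually_eq)
qed

lemma continuous_on_linear_solution:
  fixes M :: "'t::topological_space \<Rightarrow> real^'n^'n::finite"
  assumes "\<And>t. t \<in> T \<Longrightarrow> invertible (M t)" "\<And>t. t \<in> T \<Longrightarrow> M t *v u t = b t"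
    and "\<And>i j. continuous_on T (\<lambda>t. M t $ i $ j)" "\<And>i. continuous_on T (\<lambda>t. b t $ i)"
  shows "continuous_on T (\<lambda>t. u t $ m)"
proof -
  have "continuous_on T (\<lambda>t. (\<chi> i j. if j = m then b t $ i else M t $ i $ j) $ i $ j)" for i j
    using assms(3,4) by (cases "j = m") auto
  then have "continuous_on T (\<lambda>t. det (\<chi> i j. if j = m then b t $ i else M t $ i $ j) / det (M t))"
    using assms(1) by (intro continuous_on_divide continuous_on_det assms(3)) (auto simp: invertible_det_nz)
  then show ?thesis
    by (rule continuous_on_eq) (simp add: linear_solution[OF assms(1,2)])
qed

lemma sum_UNIV_Plus:
  "(\<Sum>m\<in>(UNIV :: ('a::finite + 'b::finite) set). f m) = (\<Sum>i\<in>UNIV. f (Inl i)) + (\<Sum>j\<in>UNIV. f (Inr j))"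
  unfolding UNIV_Plus_UNIV[symmetric] by (subst sum.Plus) auto

lemma osum_nth [simp]: "(p \<oplus>\<^sub>v q) $ Inl i = p $ i" "(p \<oplus>\<^sub>v q) $ Inr j = q $ j"
  by (simp_all add: osum_def)

lemma sum4_swap: "(\<Sum>i\<in>A. \<Sum>j\<in>B. \<Sum>k\<in>D. \<Sum>l\<in>E. F i j k l) = (\<Sum>j\<in>B. \<Sum>l\<in>E. \<Sum>i\<in>A. \<Sum>k\<in>D. F i j k l)"
  for F :: "'p \<Rightarrow> 'q \<Rightarrow> 'r \<Rightarrow> 's \<Rightarrow> real"
proof -
  have "(\<Sum>i\<in>A. \<Sum>j\<in>B. \<Sum>k\<in>D. \<Sum>l\<in>E. F i j k l) = (\<Sum>i\<in>A. \<Sum>j\<in>B. \<Sum>l\<in>E. \<Sum>k\<in>D. F i j k l)"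
    by (intro sum.cong refl sum.swap)
  also have "\<dots> = (\<Sum>j\<in>B. \<Sum>i\<in>A. \<Sum>l\<in>E. \<Sum>k\<in>D. F i j k l)"
    by (rule sum.swap)
  also have "\<dots> = (\<Sum>j\<in>B. \<Sum>l\<in>E. \<Sum>i\<in>A. \<Sum>k\<in>D. F i j k l)"
    by (intro sum.cong refl sum.swap)
  finally show ?thesis .
qed

text \<open>Christoffel symbols of the first kind. They are free of the inverse metric; for the cost
  metric they are plain third derivatives of the cost.\<close>

definition christoffel_first :: "(real^'k \<Rightarrow> real^'k^'k) \<Rightarrow> 'k \<Rightarrow> 'k \<Rightarrow> 'k \<Rightarrow> real^'k::finite \<Rightarrow> real" where
  "christoffel_first g j k l z = (1/2) *
     (pd j (\<lambda>w. g w $ k $ l) z + pd k (\<lambda>w. g w $ j $ l) z - pd l (\<lambda>w. g w $ j $ k) z)"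

lemma christoffel_lower:
  assumes "invertible (g z)"
  shows "(\<Sum>m\<in>UNIV. g z $ l $ m * christoffel g m j k z) = christoffel_first g j k l z"
proof -
  let ?c = "\<chi> l. christoffel_first g j k l z"
  have "(\<chi> m. christoffel g m j k z) = matrix_inv (g z) *v ?c"
    by (simp add: vec_eq_iff christoffel_def christoffel_first_def matrix_vector_mult_def
        sum_distrib_left mult_ac)
  then have "g z *v (\<chi> m. christoffel g m j k z) = ?c"
    by (simp add: matrix_vector_mul_assoc matrix_inv_right[OF assms])
  then show ?thesis
    by (simp add: vec_eq_iff matrix_vector_mult_def)
qed

lemma geodesic_lower:
  assumes "invertible (g z)"
    and "\<And>m. a $ m + (\<Sum>j\<in>UNIV. \<Sum>k\<in>UNIV. christoffel g m j k z * v $ j * v $ k) = 0"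
  shows "(\<Sum>m\<in>UNIV. g z $ l $ m * a $ m)
     = - (\<Sum>j\<in>UNIV. \<Sum>k\<in>UNIV. christoffel_first g j k l z * v $ j * v $ k)"
proof -
  have "a $ m = - (\<Sum>j\<in>UNIV. \<Sum>k\<in>UNIV. christoffel g m j k z * v $ j * v $ k)" for m
    using assms(2)[of m] by linarith
  then have "(\<Sum>m\<in>UNIV. g z $ l $ m * a $ m)
     = - (\<Sum>m\<in>UNIV. \<Sum>j\<in>UNIV. \<Sum>k\<in>UNIV. g z $ l $ m * christoffel g m j k z * v $ j * v $ k)"
    by (simp add: sum_distrib_left sum_negf mult_ac)
  also have "(\<Sum>m\<in>UNIV. \<Sum>j\<in>UNIV. \<Sum>k\<in>UNIV. g z $ l $ m * christoffel g m j k z * v $ j * v $ k)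
     = (\<Sum>j\<in>UNIV. \<Sum>m\<in>UNIV. \<Sum>k\<in>UNIV. g z $ l $ m * christoffel g m j k z * v $ j * v $ k)"
    by (rule sum.swap)
  also have "\<dots> = (\<Sum>j\<in>UNIV. \<Sum>k\<in>UNIV. \<Sum>m\<in>UNIV. g z $ l $ m * christoffel g m j k z * v $ j * v $ k)"
    by (intro sum.cong refl sum.swap)
  also have "\<dots> = (\<Sum>j\<in>UNIV. \<Sum>k\<in>UNIV. christoffel_first g j k l z * v $ j * v $ k)"
    by (simp add: christoffel_lower[of g z, OF assms(1), symmetric] sum_distrib_right)
  finally show ?thesis .
qed

section \<open>Christoffel symbols and curvature of the cost metric\<close>

locale cost_in_coordinates =
  fixes C :: "real^('n::finite + 'n) \<Rightarrow> real" and S :: "(real^('n + 'n)) set"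
  assumes open_S: "open S" and C4: "Ck_on 4 S C"
    and invertible_hessian: "\<And>z. z \<in> S \<Longrightarrow> invertible (mixed_hessian C z)"
begin

abbreviation "g \<equiv> cost_metric C"

definition M :: "'n \<Rightarrow> 'n \<Rightarrow> real^('n + 'n) \<Rightarrow> real" where
  "M i j = pd (Inl i) (pd (Inr j) C)"

lemma mixed_hessian_nth: "mixed_hessian C z $ i $ j = M i j z"
  by (simp add: mixed_hessian_def M_def)

lemma metric_nth:
  "g z $ Inl i $ Inl k = 0" "g z $ Inr i $ Inr k = 0"
  "g z $ Inl i $ Inr j = - (1/2) * M i j z" "g z $ Inr j $ Inl i = - (1/2) * M i j z"
  by (simp_all add: cost_metric_def mixed_hessian_nth)

lemma C4': "Ck_on (Suc (Suc (Suc (Suc 0)))) S C"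
proof -
  have "4 = Suc (Suc (Suc (Suc 0)))" by simp
  then show ?thesis using C4 by metis
qed

lemma Ck_pd_C: "Ck_on (Suc (Suc (Suc 0))) S (pd m C)"
  using C4' by (rule Ck_on_pd)

lemma Ck_pd2_C: "Ck_on (Suc (Suc 0)) S (pd l (pd m C))"
  using Ck_pd_C by (rule Ck_on_pd)

lemma Ck_M: "Ck_on (Suc (Suc 0)) S (M i j)"
  unfolding M_def by (rule Ck_pd2_C)

lemma pd_metric:
  assumes "z \<in> S"
  shows "pd m (\<lambda>w. g w $ Inl i $ Inl k) z = 0" "pd m (\<lambda>w. g w $ Inr i $ Inr k) z = 0"
    "pd m (\<lambda>w. g w $ Inl i $ Inr j) z = - (1/2) * pd m (M i j) z"
    "pd m (\<lambda>w. g w $ Inr j $ Inl i) z = - (1/2) * pd m (M i j) z"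
proof -
  have "pd m (\<lambda>w. - (1/2) * M i j w) z = - (1/2) * pd m (M i j) z"
    by (intro pd_eqI DERIV_cmult pd_has_derivative Ck_on_differentiable[OF Ck_M assms])
  then show "pd m (\<lambda>w. g w $ Inl i $ Inl k) z = 0" "pd m (\<lambda>w. g w $ Inr i $ Inr k) z = 0"
    "pd m (\<lambda>w. g w $ Inl i $ Inr j) z = - (1/2) * pd m (M i j) z"
    "pd m (\<lambda>w. g w $ Inr j $ Inl i) z = - (1/2) * pd m (M i j) z"
    by (simp_all only: metric_nth pd_zero)
qed

lemma pd_M_swap_left:
  assumes "z \<in> S"
  shows "pd (Inl i) (M k l) z = pd (Inl k) (M i l) z"
  unfolding M_def by (rule pd_commute[OF open_S assms Ck_pd_C])

lemma pd_M_right: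
  assumes "z \<in> S"
  shows "pd (Inr j) (M i l) z = pd (Inl i) (pd (Inr j) (pd (Inr l) C)) z"
  unfolding M_def by (rule pd_commute[OF open_S assms Ck_pd_C])

lemma pd_M_swap_right:
  assumes "z \<in> S"
  shows "pd (Inr j) (M i l) z = pd (Inr l) (M i j) z"
  unfolding pd_M_right[OF assms]
  by (rule pd_cong_open[OF open_S assms pd_commute[OF open_S _ C4']])

text \<open>The barred derivatives are moved innermost, because the second time derivative of the
  cost is built from them and is then differentiated twice along a slice.\<close>

lemma pd2_M_right:
  assumes "z \<in> S"
  shows "pd (Inr j) (pd (Inl i) (M k l)) z = pd (Inl i) (pd (Inl k) (pd (Inr j) (pd (Inr l) C))) z"
proof -
  have "pd (Inr j) (pd (Inl i) (M k l)) z = pd (Inl i) (pd (Inr j) (M k l)) z"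
    by (rule pd_commute[OF open_S assms Ck_M])
  also have "\<dots> = pd (Inl i) (pd (Inl k) (pd (Inr j) (pd (Inr l) C))) z"
    by (rule pd_cong_open[OF open_S assms pd_M_right])
  finally show ?thesis .
qed

text \<open>The metric has only mixed entries, and its derivatives are symmetric in the indices of
  equal type. Hence for mixed lower indices the surviving terms cancel, and for lower indices of one
  type two equal terms add up when the third index has the other type.\<close>

lemma christoffel_first_values:
  assumes "z \<in> S"
  shows "christoffel_first g (Inl i) (Inl k) (Inl l) z = 0"
    "christoffel_first g (Inl i) (Inl k) (Inr j) z = - (1/2) * pd (Inl i) (M k j) z"
    "christoffel_first g (Inr i') (Inr k') (Inl l) z = - (1/2) * pd (Inr i') (M l k') z"
    "christoffel_first g (Inl i) (Inr k') b z = 0"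
    "christoffel_first g (Inr k') (Inl i) b z = 0"
  using pd_M_swap_left[OF assms] pd_M_swap_right[OF assms]
  by (cases b; simp add: christoffel_first_def pd_metric[OF assms]; simp add: field_simps)+

text \<open>The metric is block antidiagonal, its blocks being \<open>-1/2\<close> times the mixed
  Hessian and its transpose, so a kernel vector splits into kernel vectors of these two.\<close>

lemma invertible_metric:
  assumes "z \<in> S"
  shows "invertible (g z)"
proof -
  let ?H = "mixed_hessian C z"
  have ker: "u = 0" if "invertible N" "N *v u = 0" for N :: "real^'n^'n" and u
    using that by (metis invertible_left_inverse matrix_left_invertible_ker)
  have H: "invertible ?H" "invertible (transpose ?H)"
    using invertible_hessian[OF assms] by (auto simp: invertible_det_nz)
  have "u = 0" if u: "g z *v u = 0" for u
  proof -
    have comp: "(\<Sum>m\<in>UNIV. g z $ l $ m * u $ m) = 0" for l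
      using u by (simp add: vec_eq_iff matrix_vector_mult_def)
    have "(\<Sum>j\<in>UNIV. M i j z * u $ Inr j) = 0" for i
      using comp[of "Inl i"] by (simp add: sum_UNIV_Plus metric_nth sum_negf flip: sum_divide_distrib)
    then have "?H *v (\<chi> j. u $ Inr j) = 0"
      by (simp add: vec_eq_iff matrix_vector_mult_def mixed_hessian_nth)
    moreover have "(\<Sum>i\<in>UNIV. M i j z * u $ Inl i) = 0" for j
      using comp[of "Inr j"] by (simp add: sum_UNIV_Plus metric_nth sum_negf flip: sum_divide_distrib)
    then have "transpose ?H *v (\<chi> i. u $ Inl i) = 0"
      by (simp add: vec_eq_iff matrix_vector_mult_def mixed_hessian_nth transpose_def)
    ultimately have "(\<chi> j. u $ Inr j) = 0" "(\<chi> i. u $ Inl i) = 0"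
      using ker H by blast+
    then have "u $ m = 0" for m
      by (cases m) (simp_all add: vec_eq_iff)
    then show ?thesis by (simp add: vec_eq_iff)
  qed
  then show ?thesis
    by (simp add: invertible_left_inverse matrix_left_invertible_ker)
qed

lemma christoffel_mixed:
  assumes "z \<in> S"
  shows "christoffel g m (Inl i) (Inr j) z = 0" "christoffel g m (Inr j) (Inl i) z = 0"
  using christoffel_first_values(4,5)[OF assms]
  unfolding christoffel_def christoffel_first_def by auto

lemma christoffel_Inl_lower:
  assumes "z \<in> S"
  shows "(\<Sum>m\<in>UNIV. M m l z * christoffel g (Inl m) (Inl i) (Inl k) z) = pd (Inl i) (M k l) z"
  using christoffel_lower[of g z, OF invertible_metric[OF assms], of "Inr l" "Inl i" "Inl k"]
  by (simp add: sum_UNIV_Plus metric_nth christoffel_first_values[OF assms] sum_negf flip: sum_divide_distrib)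

text \<open>Lowering with an unbarred index gives a first-kind symbol with three unbarred indices,
  which is zero; the invertible Hessian can be cancelled. Geometrically, slices with fixed barred
  point are totally geodesic.\<close>

lemma christoffel_Inl_Inl_Inr:
  assumes "z \<in> S"
  shows "christoffel g (Inr m) (Inl i) (Inl k) z = 0"
proof -
  have "(\<Sum>m\<in>UNIV. M a m z * christoffel g (Inr m) (Inl i) (Inl k) z) = 0" for a
    using christoffel_lower[of g z, OF invertible_metric[OF assms], of "Inl a" "Inl i" "Inl k"]
    by (simp add: sum_UNIV_Plus metric_nth christoffel_first_values[OF assms] sum_negf flip: sum_divide_distrib)
  then have "mixed_hessian C z *v (\<chi> m. christoffel g (Inr m) (Inl i) (Inl k) z) = 0"
    by (simp add: vec_eq_iff matrix_vector_mult_def mixed_hessian_nth)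
  then have "(\<chi> m. christoffel g (Inr m) (Inl i) (Inl k) z) = 0"
    using invertible_hessian[OF assms] by (metis invertible_left_inverse matrix_left_invertible_ker)
  then show ?thesis by (simp add: vec_eq_iff)
qed

text \<open>\<open>pd\<close> is a meaningful derivative only where one exists, and the product rule
  below needs this. The symbols solve the linear system of \<open>christoffel_Inl_lower\<close>,
  whose coefficients are differentiable.\<close>

lemma christoffel_differentiable:
  assumes "z \<in> S"
  shows "(\<lambda>t. christoffel g (Inl m) (Inl i) (Inl k) (z + t *\<^sub>R axis j 1)) differentiable at 0"
proof -
  let ?z = "\<lambda>t. z + t *\<^sub>R axis j 1"
  have "(\<lambda>t. (\<chi> m. christoffel g (Inl m) (Inl i) (Inl k) (?z t)) $ m) differentiable at 0"
  proof (rule differentiable_linear_solution)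
    show "\<forall>\<^sub>F t in nhds 0. invertible (transpose (mixed_hessian C (?z t))) \<and>
       transpose (mixed_hessian C (?z t)) *v (\<chi> m. christoffel g (Inl m) (Inl i) (Inl k) (?z t))
         = (\<chi> l. pd (Inl i) (M k l) (?z t))"
    proof (rule eventually_mono[OF eventually_line_in_open[OF open_S assms]])
      fix t assume elim: "?z t \<in> S"
      have "transpose (mixed_hessian C (?z t)) *v (\<chi> m. christoffel g (Inl m) (Inl i) (Inl k) (?z t))
         = (\<chi> l. pd (Inl i) (M k l) (?z t))"
        using christoffel_Inl_lower[OF elim]
        by (simp add: vec_eq_iff matrix_vector_mult_def transpose_def mixed_hessian_nth)
      then show "invertible (transpose (mixed_hessian C (?z t))) \<and>
         transpose (mixed_hessian C (?z t)) *v (\<chi> m. christoffel g (Inl m) (Inl i) (Inl k) (?z t))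
         = (\<chi> l. pd (Inl i) (M k l) (?z t))"
        using invertible_hessian[OF elim] by (simp add: invertible_det_nz)
    qed
    show "(\<lambda>t. transpose (mixed_hessian C (?z t)) $ a $ b) differentiable at 0" for a b
      using Ck_on_differentiable[OF Ck_M assms] by (simp add: transpose_def mixed_hessian_nth)
    show "(\<lambda>t. (\<chi> l. pd (Inl i) (M k l) (?z t)) $ a) differentiable at 0" for a
      using Ck_on_differentiable[OF Ck_on_pd[OF Ck_M] assms] by simp
  qed
  then show ?thesis by simp
qed

text \<open>The identity of \<open>christoffel_Inl_lower\<close> is differentiated as a whole by the
  product rule, which avoids differentiating the inverse metric.\<close>

lemma pd_christoffel_lower:
  assumes "z \<in> S"
  shows "(\<Sum>m\<in>UNIV. M m l z * pd (Inr j) (christoffel g (Inl m) (Inl i) (Inl k)) z)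
     = pd (Inr j) (pd (Inl i) (M k l)) z
       - (\<Sum>m\<in>UNIV. pd (Inr j) (M m l) z * christoffel g (Inl m) (Inl i) (Inl k) z)"
proof -
  let ?z = "\<lambda>t. z + t *\<^sub>R axis (Inr j) 1"
  let ?G = "\<lambda>m. christoffel g (Inl m) (Inl i) (Inl k)"
  have "((\<lambda>t. \<Sum>m\<in>UNIV. M m l (?z t) * ?G m (?z t)) has_real_derivative
     (\<Sum>m\<in>UNIV. pd (Inr j) (M m l) z * ?G m (?z 0) + pd (Inr j) (?G m) z * M m l (?z 0))) (at 0)"
    by (intro DERIV_sum DERIV_mult pd_has_derivative Ck_on_differentiable[OF Ck_M assms]
        christoffel_differentiable[OF assms])
  then have "pd (Inr j) (\<lambda>w. \<Sum>m\<in>UNIV. M m l w * ?G m w) z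
     = (\<Sum>m\<in>UNIV. pd (Inr j) (M m l) z * ?G m z + pd (Inr j) (?G m) z * M m l z)"
    by (intro pd_eqI) simp
  moreover have "pd (Inr j) (\<lambda>w. \<Sum>m\<in>UNIV. M m l w * ?G m w) z = pd (Inr j) (pd (Inl i) (M k l)) z"
    by (rule pd_cong_open[OF open_S assms christoffel_Inl_lower])
  ultimately show ?thesis
    by (simp add: sum.distrib mult.commute)
qed

text \<open>All quadratic terms contain a symbol with mixed lower indices or one with two unbarred
  lower indices and a barred upper one. Those symbols vanish on all of \<open>S\<close>, so the
  first derivative term drops out as well.\<close>

lemma riemann_up_mixed:
  assumes "z \<in> S"
  shows "riemann_up g (Inl i) (Inr j) (Inl k) (Inl m) z
     = pd (Inr j) (christoffel g (Inl m) (Inl i) (Inl k)) z"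
proof -
  have "pd (Inl i) (christoffel g (Inl m) (Inr j) (Inl k)) z = pd (Inl i) (\<lambda>w. 0) z"
    by (rule pd_cong_open[OF open_S assms christoffel_mixed(2)])
  then show ?thesis
    using christoffel_mixed[OF assms] christoffel_Inl_Inl_Inr[OF assms]
    by (simp add: riemann_up_def sum_UNIV_Plus)
qed

lemma riemann_down_mixed:
  assumes "z \<in> S"
  shows "riemann_down g (Inl i) (Inr j) (Inl k) (Inr l) z
     = - (1/2) * (pd (Inl i) (pd (Inl k) (pd (Inr j) (pd (Inr l) C))) z
       - (\<Sum>m\<in>UNIV. pd (Inr j) (M m l) z * christoffel g (Inl m) (Inl i) (Inl k) z))"
proof -
  have "riemann_down g (Inl i) (Inr j) (Inl k) (Inr l) z
     = - (1/2) * (\<Sum>m\<in>UNIV. M m l z * pd (Inr j) (christoffel g (Inl m) (Inl i) (Inl k)) z)"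
    by (simp add: riemann_down_def sum_UNIV_Plus metric_nth riemann_up_mixed[OF assms]
        sum_negf sum_divide_distrib mult.commute)
  then show ?thesis
    unfolding pd_christoffel_lower[OF assms] pd2_M_right[OF assms] .
qed

text \<open>By the chain rule the left-hand side is the second derivative of
  \<open>pd (Inr l) C\<close> along a curve with velocity \<open>v\<close> and acceleration
  \<open>a\<close>.\<close>

lemma geodesic_left_lower:
  assumes z: "z \<in> S" and v: "\<And>j. v $ Inr j = 0"
    and geo: "\<And>m. a $ m + (\<Sum>j\<in>UNIV. \<Sum>k\<in>UNIV. christoffel g m j k z * v $ j * v $ k) = 0"
  shows "(\<Sum>i\<in>UNIV. a $ Inl i * M i l z)
     + (\<Sum>i\<in>UNIV. \<Sum>k\<in>UNIV. v $ Inl i * v $ Inl k * pd (Inl i) (M k l) z) = 0"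
  using geodesic_lower[of g z, OF invertible_metric[OF z] geo, of "Inr l"]
  by (simp add: sum_UNIV_Plus metric_nth christoffel_first_values[OF z] v sum_negf mult_ac
      flip: sum_divide_distrib)

lemma geodesic_right_lower:
  assumes z: "z \<in> S" and v: "\<And>i. v $ Inl i = 0"
    and geo: "\<And>m. a $ m + (\<Sum>j\<in>UNIV. \<Sum>k\<in>UNIV. christoffel g m j k z * v $ j * v $ k) = 0"
  shows "(\<Sum>j\<in>UNIV. M i j z * a $ Inr j)
     + (\<Sum>j\<in>UNIV. \<Sum>k\<in>UNIV. v $ Inr j * v $ Inr k * pd (Inr j) (M i k) z) = 0"
  using geodesic_lower[of g z, OF invertible_metric[OF z] geo, of "Inl i"]
  by (simp add: sum_UNIV_Plus metric_nth christoffel_first_values[OF z] v sum_negf mult_ac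
      flip: sum_divide_distrib)

text \<open>Up to the factor \<open>-1/2\<close> the curvature is the fourth derivative of \<open>C\<close> along the geodesic
  with acceleration \<open>a\<close>, two of the four derivatives being taken in the direction \<open>q\<close>.\<close>

lemma sec_along_geodesic:
  assumes z: "z \<in> S" and v: "v = p \<oplus>\<^sub>v 0"
    and geo: "\<And>m. a $ m + (\<Sum>j\<in>UNIV. \<Sum>k\<in>UNIV. christoffel g m j k z * v $ j * v $ k) = 0"
  shows "sec g z (p \<oplus>\<^sub>v 0) (0 \<oplus>\<^sub>v q) = - (1/2) * (\<Sum>j\<in>UNIV. \<Sum>l\<in>UNIV. q $ j * q $ l *
     ((\<Sum>i\<in>UNIV. a $ Inl i * pd (Inl i) (pd (Inr j) (pd (Inr l) C)) z)
      + (\<Sum>i\<in>UNIV. \<Sum>k\<in>UNIV. p $ i * p $ k * pd (Inl i) (pd (Inl k) (pd (Inr j) (pd (Inr l) C))) z)))"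
proof -
  let ?G = "\<lambda>m i k. christoffel g (Inl m) (Inl i) (Inl k) z"
  let ?D = "\<lambda>i k j l. pd (Inl i) (pd (Inl k) (pd (Inr j) (pd (Inr l) C))) z"
  \<comment> \<open>The unbarred components of the geodesic equation trade the Christoffel terms for
    the acceleration.\<close>
  have a: "(\<Sum>i\<in>UNIV. \<Sum>k\<in>UNIV. p $ i * p $ k * ?G m i k) = - a $ Inl m" for m
    using geo[of "Inl m"] unfolding v by (simp add: sum_UNIV_Plus mult_ac)
  have aM: "(\<Sum>i\<in>UNIV. \<Sum>k\<in>UNIV. p $ i * p $ k * (\<Sum>m\<in>UNIV. pd (Inr j) (M m l) z * ?G m i k))
     = - (\<Sum>i\<in>UNIV. a $ Inl i * pd (Inl i) (pd (Inr j) (pd (Inr l) C)) z)" for j l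
  proof -
    have "(\<Sum>i\<in>UNIV. \<Sum>k\<in>UNIV. p $ i * p $ k * (\<Sum>m\<in>UNIV. pd (Inr j) (M m l) z * ?G m i k))
       = (\<Sum>i\<in>UNIV. \<Sum>k\<in>UNIV. \<Sum>m\<in>UNIV. pd (Inr j) (M m l) z * (p $ i * p $ k * ?G m i k))"
      by (simp add: sum_distrib_left mult_ac)
    also have "\<dots> = (\<Sum>i\<in>UNIV. \<Sum>m\<in>UNIV. \<Sum>k\<in>UNIV. pd (Inr j) (M m l) z * (p $ i * p $ k * ?G m i k))"
      by (intro sum.cong refl sum.swap)
    also have "\<dots> = (\<Sum>m\<in>UNIV. \<Sum>i\<in>UNIV. \<Sum>k\<in>UNIV. pd (Inr j) (M m l) z * (p $ i * p $ k * ?G m i k))"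
      by (rule sum.swap)
    also have "\<dots> = (\<Sum>m\<in>UNIV. pd (Inr j) (M m l) z * (- a $ Inl m))"
      by (simp add: a flip: sum_distrib_left)
    finally show ?thesis
      by (simp add: pd_M_right[OF z] sum_negf mult.commute)
  qed
  have "sec g z (p \<oplus>\<^sub>v 0) (0 \<oplus>\<^sub>v q) = (\<Sum>i\<in>UNIV. \<Sum>j\<in>UNIV. \<Sum>k\<in>UNIV. \<Sum>l\<in>UNIV.
     riemann_down g (Inl i) (Inr j) (Inl k) (Inr l) z * p $ i * q $ j * p $ k * q $ l)"
    unfolding sec_def by (simp add: sum_UNIV_Plus)
  also have "\<dots> = (\<Sum>j\<in>UNIV. \<Sum>l\<in>UNIV. \<Sum>i\<in>UNIV. \<Sum>k\<in>UNIV.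
     riemann_down g (Inl i) (Inr j) (Inl k) (Inr l) z * p $ i * q $ j * p $ k * q $ l)"
    by (rule sum4_swap)
  also have "\<dots> = (\<Sum>j\<in>UNIV. \<Sum>l\<in>UNIV. - (1/2) * (q $ j * q $ l *
     ((\<Sum>i\<in>UNIV. a $ Inl i * pd (Inl i) (pd (Inr j) (pd (Inr l) C)) z)
      + (\<Sum>i\<in>UNIV. \<Sum>k\<in>UNIV. p $ i * p $ k * ?D i k j l))))"
  proof (intro sum.cong refl)
    fix j l
    have "(\<Sum>i\<in>UNIV. \<Sum>k\<in>UNIV. riemann_down g (Inl i) (Inr j) (Inl k) (Inr l) z * p $ i * q $ j * p $ k * q $ l)
      = - (1/2) * (q $ j * q $ l) * (\<Sum>i\<in>UNIV. \<Sum>k\<in>UNIV. p $ i * p $ k * (?D i k j l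
         - (\<Sum>m\<in>UNIV. pd (Inr j) (M m l) z * ?G m i k)))"
      unfolding riemann_down_mixed[OF z] sum_distrib_left[of "- (1/2) * (q $ j * q $ l)"]
      by (intro sum.cong refl) (simp only: mult_ac)
    also have "(\<Sum>i\<in>UNIV. \<Sum>k\<in>UNIV. p $ i * p $ k * (?D i k j l
         - (\<Sum>m\<in>UNIV. pd (Inr j) (M m l) z * ?G m i k)))
       = (\<Sum>i\<in>UNIV. \<Sum>k\<in>UNIV. p $ i * p $ k * ?D i k j l)
         + (\<Sum>i\<in>UNIV. a $ Inl i * pd (Inl i) (pd (Inr j) (pd (Inr l) C)) z)"
      by (simp only: right_diff_distrib sum_subtractf aM diff_minus_eq_add)
    finally show "(\<Sum>i\<in>UNIV. \<Sum>k\<in>UNIV. riemann_down g (Inl i) (Inr j) (Inl k) (Inr l) z * p $ i * q $ j * p $ k * q $ l)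
      = - (1/2) * (q $ j * q $ l *
     ((\<Sum>i\<in>UNIV. a $ Inl i * pd (Inl i) (pd (Inr j) (pd (Inr l) C)) z)
      + (\<Sum>i\<in>UNIV. \<Sum>k\<in>UNIV. p $ i * p $ k * ?D i k j l)))"
      by (simp only: mult.assoc add.commute)
  qed
  finally show ?thesis
    by (simp only: sum_distrib_left)
qed

lemma null_vector_osum:
  "null_vector g z (p \<oplus>\<^sub>v q) \<longleftrightarrow> (\<Sum>i\<in>UNIV. \<Sum>j\<in>UNIV. p $ i * q $ j * M i j z) = 0"
proof -
  have "(\<Sum>a\<in>UNIV. \<Sum>b\<in>UNIV. g z $ a $ b * (p \<oplus>\<^sub>v q) $ a * (p \<oplus>\<^sub>v q) $ b)
     = - (1/2) * (\<Sum>i\<in>UNIV. \<Sum>j\<in>UNIV. p $ i * q $ j * M i j z)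
       - (1/2) * (\<Sum>j\<in>UNIV. \<Sum>i\<in>UNIV. p $ i * q $ j * M i j z)"
    by (simp add: sum_UNIV_Plus metric_nth sum_negf mult_ac sum_divide_distrib)
  also have "\<dots> = - (\<Sum>i\<in>UNIV. \<Sum>j\<in>UNIV. p $ i * q $ j * M i j z)"
    by (subst (2) sum.swap) simp
  finally show ?thesis by (simp add: null_vector_def)
qed

end

section \<open>Functions of one real variable\<close>

text \<open>At \<open>0\<close> and \<open>1\<close> the derivatives are one-sided; they are still
  unique, since no point of the interval is isolated.\<close>

lemma real_derivative_unique_unit_interval:
  fixes F :: "real \<Rightarrow> real"
  assumes "(F has_real_derivative d) (at s within {0..1})"
    "(F has_real_derivative d') (at s within {0..1})" "s \<in> {0..1}"
  shows "d = d'"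
proof -
  have "at s within {0..1} \<noteq> bot"
    using assms(3) by (subst trivial_limit_within) (simp add: islimpt_Icc)
  then show ?thesis
    using assms(1,2) unfolding has_real_derivative_iff_has_vector_derivative
    by (rule vector_derivative_unique_within)
qed

text \<open>The derivative \<open>D\<close> is only known locally, up to the choice of a chart, but derivatives are
  unique.\<close>

lemma second_derivative_patch:
  fixes F :: "real \<Rightarrow> real"
  assumes "\<And>s. s \<in> {0..1} \<Longrightarrow> \<exists>D E. (F has_real_derivative D s) (at s within {0..1}) \<and>
     (\<forall>\<^sub>F s' in at s within {0..1}. (F has_real_derivative D s') (at s' within {0..1})) \<and>
     (D has_real_derivative E) (at s within {0..1}) \<and> R s (D s) E"
  shows "\<exists>D E. \<forall>s\<in>{0..1}. (F has_real_derivative D s) (at s within {0..1}) \<and>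
     (D has_real_derivative E s) (at s within {0..1}) \<and> R s (D s) (E s)"
proof -
  note unique = real_derivative_unique_unit_interval
  define D where "D s = (SOME d. (F has_real_derivative d) (at s within {0..1}))" for s
  have D: "(F has_real_derivative D s) (at s within {0..1})" if s: "s \<in> {0..1}" for s
  proof -
    obtain d where "(F has_real_derivative d) (at s within {0..1})"
      using assms[OF s] by (elim exE conjE)
    then show ?thesis unfolding D_def by (rule someI)
  qed
  have "\<exists>E. (D has_real_derivative E) (at s within {0..1}) \<and> R s (D s) E" if s: "s \<in> {0..1}" for s
  proof -
    obtain D' E where D': "(F has_real_derivative D' s) (at s within {0..1})"
      "\<forall>\<^sub>F s' in at s within {0..1}. (F has_real_derivative D' s') (at s' within {0..1})"
      "(D' has_real_derivative E) (at s within {0..1})" "R s (D' s) E"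
      using assms[OF s] by (elim exE conjE)
    have "D' s = D s"
      by (rule unique[OF D'(1) D[OF s] s])
    \<comment> \<open>Equality at \<open>s\<close> alone would not let the derivative of
      \<open>D'\<close> pass to \<open>D\<close>; the eventual clause gives equality on a
      neighbourhood.\<close>
    moreover have "\<forall>\<^sub>F s' in at s within {0..1}. D' s' = D s'"
    proof -
      have "\<forall>\<^sub>F s' in at s within {0..1}. s' \<in> {0..1}"
        by (simp add: eventually_at_filter)
      with D'(2) show ?thesis
        by eventually_elim (rule unique[OF _ D])
    qed
    ultimately show ?thesis
      using D'(3,4) has_field_derivative_cong_eventually[of D' D s "{0..1}" E] by auto
  qed
  then obtain E where "\<And>s. s \<in> {0..1} \<Longrightarrow> (D has_real_derivative E s) (at s within {0..1}) \<and> R s (D s) (E s)"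
    by metis
  then show ?thesis
    using D by (intro exI[of _ D] exI[of _ E]) simp
qed

lemma nonincreasing_of_derivative_nonpos:
  fixes F :: "real \<Rightarrow> real"
  assumes "a \<le> b" "\<And>s. s \<in> {a..b} \<Longrightarrow> (F has_real_derivative D s) (at s within {a..b})"
    "\<And>s. s \<in> {a..b} \<Longrightarrow> D s \<le> 0"
  shows "F b \<le> F a"
proof (rule DERIV_nonpos_imp_decreasing_open[OF assms(1)])
  show "continuous_on {a..b} F"
    using assms(2) DERIV_continuous_on by blast
  fix s assume "a < s" "s < b"
  then show "\<exists>y. (F has_real_derivative y) (at s) \<and> y \<le> 0"
    using assms(2,3)[of s] at_within_Icc_at[of a s b] by auto
qed

text \<open>\<open>F\<close> is affine, and its slope is \<open>F 1 - F 0\<close>.\<close>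

lemma first_derivative_const:
  fixes F :: "real \<Rightarrow> real"
  assumes "F 1 = F 0"
    and D: "\<And>s. s \<in> {0..1} \<Longrightarrow> (F has_real_derivative D s) (at s within {0..1})"
    and E: "\<And>s. s \<in> {0..1} \<Longrightarrow> (D has_real_derivative 0) (at s within {0..1})"
    and "s \<in> {0..1}"
  shows "D s = 0"
proof -
  have "\<exists>k. \<forall>s\<in>{0..1}. D s = k"
    using has_field_derivative_zero_constant[of "{0..1}" D] E by auto
  then obtain k where k: "\<And>s. s \<in> {0..1} \<Longrightarrow> D s = k"
    by blast
  have "((\<lambda>s. F s - k * s) has_real_derivative 0) (at s within {0..1})" if "s \<in> {0..1}" for s
    using DERIV_diff[OF D[OF that] DERIV_cmult_Id[of k]] k[OF that] by simp
  then have "\<exists>l. \<forall>s\<in>{0..1}. F s - k * s = l"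
    using has_field_derivative_zero_constant[of "{0..1}" "\<lambda>s. F s - k * s"] by auto
  then obtain l where "\<And>s. s \<in> {0..1} \<Longrightarrow> F s - k * s = l"
    by blast
  from this[of 0] this[of 1] have "k = 0"
    using assms(1) by simp
  then show ?thesis using k assms(4) by blast
qed

lemma nonincreasing_of_second_derivative_nonpos:
  fixes F :: "real \<Rightarrow> real"
  assumes D: "\<And>s. s \<in> {0..1} \<Longrightarrow> (F has_real_derivative D s) (at s within {0..1})"
    and E: "\<And>s. s \<in> {0..1} \<Longrightarrow> (D has_real_derivative E s) (at s within {0..1})"
    and "D 0 = 0" "\<And>s. s \<in> {0..1} \<Longrightarrow> E s \<le> 0"
  shows "F 1 \<le> F 0"
proof (rule nonincreasing_of_derivative_nonpos[where F = F and D = D and a = 0 and b = 1])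
  show "(F has_real_derivative D s) (at s within {0..1})" if "s \<in> {0..1}" for s
    by (rule D[OF that])
  fix s :: real assume s: "s \<in> {0..1}"
  have "D s \<le> D 0"
  proof (rule nonincreasing_of_derivative_nonpos[where F = D and D = E and a = 0 and b = s])
    show "(D has_real_derivative E s') (at s' within {0..s})" if "s' \<in> {0..s}" for s'
      using E[of s'] that s DERIV_subset[of D "E s'" s' "{0..1}" "{0..s}"] by auto
  qed (use s assms(4) in auto)
  then show "D s \<le> 0" using assms(3) by simp
qed auto

text \<open>A quantitative implicit function argument in the displacement \<open>l\<close>. Since
  \<open>G1\<close> grows in \<open>l\<close> with slope at least some \<open>m > 0\<close>, it has
  a zero at distance at most \<open>\<bar>G1 t 0\<bar> / m\<close> from \<open>0\<close>. There
  \<open>G2\<close> is nonnegative, and returning to \<open>l = 0\<close> costs at most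
  \<open>L\<close> times that distance, \<open>L\<close> being a bound for
  \<open>H2\<close>.\<close>

lemma perturbed_second_derivative_bound:
  fixes G1 G2 H1 H2 :: "real \<Rightarrow> real \<Rightarrow> real"
  assumes d: "d > 0"
    and H1: "continuous_on ({b - d..b + d} \<times> {- d..d}) (\<lambda>(t, l). H1 t l)"
    and H2: "continuous_on ({b - d..b + d} \<times> {- d..d}) (\<lambda>(t, l). H2 t l)"
    and G1: "\<And>t l. t \<in> {b - d..b + d} \<Longrightarrow> l \<in> {- d..d} \<Longrightarrow> (G1 t has_real_derivative H1 t l) (at l)"
    and G2: "\<And>t l. t \<in> {b - d..b + d} \<Longrightarrow> l \<in> {- d..d} \<Longrightarrow> (G2 t has_real_derivative H2 t l) (at l)"
    and zero: "G1 b 0 = 0" and pos: "H1 b 0 > 0" and cont: "isCont (\<lambda>t. G1 t 0) b"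
    and imp: "\<And>t l. t \<in> {b - d..b + d} \<Longrightarrow> l \<in> {- d..d} \<Longrightarrow> G1 t l = 0 \<Longrightarrow> G2 t l \<ge> 0"
  shows "\<exists>d'>0. \<exists>K. \<forall>t. \<bar>t - b\<bar> < d' \<longrightarrow> G2 t 0 \<ge> - K * \<bar>G1 t 0\<bar>"
proof -
  let ?R = "{b - d..b + d} \<times> {- d..d}"
  have "compact ((\<lambda>(t, l). H2 t l) ` ?R)"
    by (intro compact_continuous_image H2 compact_Times) auto
  then obtain L where "\<forall>z\<in>(\<lambda>(t, l). H2 t l) ` ?R. norm z \<le> L"
    by (meson bounded_iff compact_imp_bounded)
  then have L: "\<bar>H2 t l\<bar> \<le> L" if "t \<in> {b - d..b + d}" "l \<in> {- d..d}" for t l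
    using that by (simp add: ball_simps)
  have L0: "L \<ge> 0"
    using L[of b 0] d by auto
  \<comment> \<open>Half of the slope at the centre, so that by continuity the slope stays above
    \<open>m\<close> nearby.\<close>
  define m where "m = H1 b 0 / 2"
  have m: "m > 0" using pos by (simp add: m_def)
  have "(b, 0) \<in> ?R" using d by simp
  with H1 m obtain e where e: "e > 0"
    "\<And>p. p \<in> ?R \<Longrightarrow> dist p (b, 0) < e \<Longrightarrow> dist (case p of (t, l) \<Rightarrow> H1 t l) (H1 b 0) < m"
    unfolding continuous_on_iff by fastforce
  define d1 where "d1 = min d (e / 4)"
  have d1: "d1 > 0" "d1 \<le> d" using d e(1) by (auto simp: d1_def)
  have H1m: "H1 t l \<ge> m" if "\<bar>t - b\<bar> \<le> d1" "\<bar>l\<bar> \<le> d1" for t l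
  proof -
    have "dist (t, l) (b, 0) \<le> \<bar>t - b\<bar> + \<bar>l\<bar>"
      using real_sqrt_sum_squares_triangle_ineq[of "t - b" 0 0 l] by (simp add: dist_Pair_Pair dist_real_def)
    also have "\<dots> < e" using that e(1) by (auto simp: d1_def)
    finally have "dist (H1 t l) (H1 b 0) < m"
      using e(2)[of "(t, l)"] that d1 by (auto simp: abs_le_iff)
    then show ?thesis unfolding m_def dist_real_def by linarith
  qed
  have "m * d1 > 0" using m d1 by simp
  \<comment> \<open>This smallness makes the displacement \<open>l1\<close> below stay within
    \<open>d1\<close>, where the slope bound holds.\<close>
  then obtain d2 where d2: "d2 > 0" "\<And>t. \<bar>t - b\<bar> < d2 \<Longrightarrow> \<bar>G1 t 0\<bar> < m * d1"
    using cont zero unfolding continuous_at_eps_delta dist_real_def by fastforce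
  define d' where "d' = min d1 d2"
  have "G2 t 0 \<ge> - (L / m) * \<bar>G1 t 0\<bar>" if t: "\<bar>t - b\<bar> < d'" for t
  proof -
    have td: "\<bar>t - b\<bar> \<le> d1" "\<bar>t - b\<bar> < d2" using t by (auto simp: d'_def)
    then have tR: "t \<in> {b - d..b + d}" using d1 by (auto simp: abs_le_iff)
    \<comment> \<open>The displacement over which a slope of at least \<open>m\<close> makes up for
      the value \<open>G1 t 0\<close>, whatever its sign.\<close>
    define l1 where "l1 = \<bar>G1 t 0\<bar> / m"
    have l1: "0 \<le> l1" "l1 \<le> d1"
      using m d2(2)[OF td(2)] by (auto simp: l1_def pos_divide_le_eq mult.commute)
    have G1t: "(G1 t has_real_derivative H1 t l) (at l)" if "\<bar>l\<bar> \<le> d1" for l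
      by (rule G1[OF tR]) (use that d1 in \<open>auto simp: abs_le_iff\<close>)
    have incr: "G1 t u - m * u \<le> G1 t w - m * w" if "- d1 \<le> u" "u \<le> w" "w \<le> d1" for u w
    proof (rule DERIV_nonneg_imp_nondecreasing[OF that(2)])
      fix l assume "u \<le> l" "l \<le> w"
      then have l: "\<bar>l\<bar> \<le> d1" using that by auto
      have "((\<lambda>l. G1 t l - m * l) has_real_derivative H1 t l - m) (at l)"
        by (intro DERIV_diff DERIV_cmult_Id G1t l)
      then show "\<exists>y. ((\<lambda>l. G1 t l - m * l) has_real_derivative y) (at l) \<and> 0 \<le> y"
        using H1m[OF td(1) l] by (intro exI[of _ "H1 t l - m"]) simp
    qed
    have ml1: "m * l1 = \<bar>G1 t 0\<bar>" using m by (simp add: l1_def)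
    have "G1 t (- l1) \<le> 0" "0 \<le> G1 t l1"
      using incr[of "- l1" 0] incr[of 0 l1] l1 ml1 by auto
    moreover have "continuous_on {- l1..l1} (G1 t)"
      by (rule DERIV_continuous_on[OF has_field_derivative_at_within[OF G1t]]) (use l1 in auto)
    ultimately have "\<exists>l\<ge>- l1. l \<le> l1 \<and> G1 t l = 0"
      using l1(1) by (intro IVT') auto
    then obtain l where l: "- l1 \<le> l" "l \<le> l1" "G1 t l = 0" by blast
    have lR: "l \<in> {- d..d}" using l l1 d1 by auto
    have "norm (G2 t 0 - G2 t l) \<le> L * norm (0 - l)"
    proof (rule field_differentiable_bound[where S = "{- d..d}" and f' = "H2 t"])
      fix l assume "l \<in> {- d..d}"
      then show "(G2 t has_field_derivative H2 t l) (at l within {- d..d})" "norm (H2 t l) \<le> L"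
        using G2[OF tR] L[OF tR] by (auto intro: has_field_derivative_at_within)
    qed (use d lR in auto)
    also have "\<dots> \<le> L * l1" using L0 l by (intro mult_left_mono) auto
    also have "\<dots> = (L / m) * \<bar>G1 t 0\<bar>" by (simp add: l1_def)
    finally show ?thesis
      using imp[OF tR lR l(3)] by (simp add: abs_le_iff)
  qed
  then show ?thesis
    using d1(1) d2(1) by (intro exI[of _ d'] conjI exI[of _ "L / m"]) (auto simp: d'_def)
qed

text \<open>Gronwall's inequality: \<open>f' exp (K t)\<close> cannot decrease to a zero of \<open>f'\<close>.\<close>

lemma derivative_stays_positive:
  fixes f1 f2 :: "real \<Rightarrow> real"
  assumes f1: "\<And>t. t \<in> {t0<..<t1} \<Longrightarrow> (f1 has_real_derivative f2 t) (at t)"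
    and bound: "\<And>b. b \<in> {t0<..<t1} \<Longrightarrow> f1 b = 0 \<Longrightarrow>
      \<exists>d>0. \<exists>K. \<forall>t. \<bar>t - b\<bar> < d \<longrightarrow> f2 t \<ge> - K * \<bar>f1 t\<bar>"
    and ab: "t0 < a" "a \<le> b" "b < t1" and pos: "f1 a > 0"
  shows "f1 b > 0"
proof (rule ccontr)
  assume neg: "\<not> f1 b > 0"
  have cont: "continuous_on {a..b} f1"
    by (rule DERIV_continuous_on[OF has_field_derivative_at_within[OF f1]]) (use ab in auto)
  define Z where "Z = {s \<in> {a..b}. f1 s \<le> 0}"
  have "closed Z"
    unfolding Z_def using cont by (intro continuous_on_closed_Collect_le) auto
  moreover have "b \<in> Z" using neg ab by (simp add: Z_def)
  moreover have bdd: "bdd_below Z" by (auto simp: Z_def)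
  ultimately have InfZ: "Inf Z \<in> Z" by (intro closed_contains_Inf) auto
  define z where "z = Inf Z"
  have z: "a \<le> z" "z \<le> b" "f1 z \<le> 0" using InfZ by (auto simp: z_def Z_def)
  have before: "f1 s > 0" if "a \<le> s" "s < z" for s
  proof (rule ccontr)
    assume "\<not> f1 s > 0"
    then have "s \<in> Z" using that z by (simp add: Z_def)
    then show False using cInf_lower[OF _ bdd] that by (force simp: z_def)
  qed
  have az: "a < z" using z pos by (cases "a = z") auto
  have "f1 z \<ge> 0"
  proof (rule ccontr)
    assume "\<not> f1 z \<ge> 0"
    moreover have "continuous_on {a..z} f1"
      by (rule continuous_on_subset[OF cont]) (use z in auto)
    ultimately have "\<exists>s\<ge>a. s \<le> z \<and> f1 s = f1 z / 2"
      using pos z by (intro IVT2') auto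
    then obtain s where "a \<le> s" "s \<le> z" "f1 s = f1 z / 2" by blast
    then show False using before[of s] \<open>\<not> f1 z \<ge> 0\<close> by (cases "s = z") auto
  qed
  then have "f1 z = 0" using z by simp
  then obtain d K where d: "d > 0" "\<And>t. \<bar>t - z\<bar> < d \<Longrightarrow> f2 t \<ge> - K * \<bar>f1 t\<bar>"
    using bound[of z] ab z by auto
  \<comment> \<open>Strictly before the first zero \<open>z\<close>, not before \<open>a\<close>,
    and close enough to \<open>z\<close> for the bound to hold on all of
    \<open>[s, z]\<close>.\<close>
  define s where "s = max a (z - d / 2)"
  have s: "a \<le> s" "s < z" "z - s < d" using az d(1) by (auto simp: s_def)
  have "f1 s * exp (K * s) \<le> f1 z * exp (K * z)"
  proof (rule DERIV_nonneg_imp_nondecreasing[OF less_imp_le[OF s(2)]])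
    fix t assume t: "s \<le> t" "t \<le> z"
    have "((\<lambda>t. f1 t * exp (K * t)) has_real_derivative f2 t * exp (K * t) + (exp (K * t) * K) * f1 t) (at t)"
      using t s ab z by (intro DERIV_mult f1 DERIV_fun_exp DERIV_cmult_Id) auto
    \<comment> \<open>Nonnegativity removes the absolute value from the bound, which then says that
      \<open>f1 t * exp (K * t)\<close> is nondecreasing.\<close>
    moreover have "f1 t \<ge> 0"
      using before[of t] t s \<open>f1 z = 0\<close> by (cases "t = z") auto
    then have "f2 t + K * f1 t \<ge> 0"
      using d(2)[of t] t s by auto
    then have "f2 t * exp (K * t) + (exp (K * t) * K) * f1 t \<ge> 0"
      by (metis (no_types, opaque_lifting) distrib_right exp_ge_zero mult.assoc mult.commute mult_nonneg_nonneg)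
    ultimately show "\<exists>y. ((\<lambda>t. f1 t * exp (K * t)) has_real_derivative y) (at t) \<and> 0 \<le> y" by blast
  qed
  then show False
    using before[OF s(1,2)] \<open>f1 z = 0\<close> by (simp add: mult_le_0_iff)
qed

text \<open>The infimum over a punctured right neighbourhood is the limit. In \<open>ereal\<close>
  it exists without any boundedness, possibly as an infinite value.\<close>

lemma monotone_limit_at_right:
  fixes g :: "real \<Rightarrow> ereal"
  assumes "d > 0" and mono: "\<And>s t. 0 < s \<Longrightarrow> s \<le> t \<Longrightarrow> t < d \<Longrightarrow> g s \<le> g t"
  shows "\<exists>L. (g \<longlongrightarrow> L) (at_right 0)"
proof (intro exI order_tendstoI)
  have near: "\<forall>\<^sub>F s in at_right 0. s \<in> {0<..<e}" if "e > 0" for e :: real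
    by (rule eventually_at_rightI[OF _ that])
  let ?L = "Inf (g ` {0<..<d})"
  show "\<forall>\<^sub>F s in at_right 0. l < g s" if "l < ?L" for l
    using near[OF assms(1)] by eventually_elim (metis INF_lower less_le_trans that)
  show "\<forall>\<^sub>F s in at_right 0. g s < l" if L: "?L < l" for l
  proof -
    obtain t where t: "t \<in> {0<..<d}" "g t < l"
      using L unfolding INF_less_iff by blast
    have "\<forall>\<^sub>F s in at_right 0. s \<in> {0<..<t}" by (rule near) (use t in simp)
    then show ?thesis
    proof (rule eventually_mono)
      fix s assume "s \<in> {0<..<t}"
      then have "g s \<le> g t" using mono[of s t] t by simp
      then show "g s < l" using t(2) by (rule le_less_trans)
    qed
  qed
qed

lemma antimonotone_limit_at_right:
  fixes g :: "real \<Rightarrow> ereal"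
  assumes "d > 0" and mono: "\<And>s t. 0 < s \<Longrightarrow> s \<le> t \<Longrightarrow> t < d \<Longrightarrow> g t \<le> g s"
  shows "\<exists>L. (g \<longlongrightarrow> L) (at_right 0)"
proof -
  obtain L where "((\<lambda>s. - g s) \<longlongrightarrow> L) (at_right 0)"
    using monotone_limit_at_right[of d "\<lambda>s. - g s"] assms by auto
  then have "(g \<longlongrightarrow> - L) (at_right 0)"
    using tendsto_uminus_ereal[of "\<lambda>s. - g s" L] by simp
  then show ?thesis by blast
qed

text \<open>The hypothesis \<open>pos\<close> means that \<open>f\<close> first decreases and then
  increases, where either phase may be empty. So \<open>f\<close> is monotone near each end, which
  gives the limits, and no interior value exceeds both of them.\<close>

lemma maximum_principle_of_derivative_sign:
  fixes f f1 :: "real \<Rightarrow> real"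
  assumes t01: "t0 < t1"
    and f: "\<And>t. t \<in> {t0<..<t1} \<Longrightarrow> (f has_real_derivative f1 t) (at t)"
    and pos: "\<And>a b. t0 < a \<Longrightarrow> a \<le> b \<Longrightarrow> b < t1 \<Longrightarrow> f1 a > 0 \<Longrightarrow> f1 b > 0"
  shows "\<exists>L0 L1. ((\<lambda>\<epsilon>. ereal (f (t0 + \<epsilon>))) \<longlongrightarrow> L0) (at_right 0) \<and>
                 ((\<lambda>\<epsilon>. ereal (f (t1 - \<epsilon>))) \<longlongrightarrow> L1) (at_right 0) \<and>
                 (\<forall>t\<in>{t0<..<t1}. ereal (f t) \<le> max L0 L1)"
proof -
  have decr: "f t \<le> f s" if "t0 < s" "s \<le> t" "t < t1" "\<And>u. s \<le> u \<Longrightarrow> u \<le> t \<Longrightarrow> f1 u \<le> 0" for s t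
  proof (rule DERIV_nonpos_imp_nonincreasing[OF that(2)])
    fix u assume "s \<le> u" "u \<le> t"
    then show "\<exists>y. (f has_real_derivative y) (at u) \<and> y \<le> 0"
      using f[of u] that by auto
  qed
  have incr: "f s \<le> f t" if "t0 < s" "s \<le> t" "t < t1" "\<And>u. s \<le> u \<Longrightarrow> u \<le> t \<Longrightarrow> f1 u \<ge> 0" for s t
  proof (rule DERIV_nonneg_imp_nondecreasing[OF that(2)])
    fix u assume "s \<le> u" "u \<le> t"
    then show "\<exists>y. (f has_real_derivative y) (at u) \<and> 0 \<le> y"
      using f[of u] that by auto
  qed
  have "\<exists>L. ((\<lambda>\<epsilon>. ereal (f (t0 + \<epsilon>))) \<longlongrightarrow> L) (at_right 0)"
  proof (cases "\<exists>m>t0. m < t1 \<and> (\<forall>u\<in>{t0<..<m}. f1 u \<le> 0)")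
    case True
    then obtain m where m: "m > t0" "m < t1" "\<And>u. u \<in> {t0<..<m} \<Longrightarrow> f1 u \<le> 0" by blast
    show ?thesis
      by (rule antimonotone_limit_at_right[of "m - t0"]) (use m in \<open>auto intro!: decr\<close>)
  next
    case False
    \<comment> \<open>Positive values of \<open>f1\<close> accumulate at \<open>t0\<close>, so
      \<open>f1\<close> is positive throughout.\<close>
    have "f1 u \<ge> 0" if u: "u \<in> {t0<..<t1}" for u
    proof -
      obtain w where "t0 < w" "w < u" "f1 w > 0" using False u by (force simp: not_le)
      then show ?thesis using pos[of w u] u by (simp add: less_imp_le)
    qed
    then show ?thesis
      using t01 by (intro monotone_limit_at_right[of "t1 - t0"]) (auto intro!: incr)
  qed
  then obtain L0 where L0: "((\<lambda>\<epsilon>. ereal (f (t0 + \<epsilon>))) \<longlongrightarrow> L0) (at_right 0)" by blast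
  have "\<exists>L. ((\<lambda>\<epsilon>. ereal (f (t1 - \<epsilon>))) \<longlongrightarrow> L) (at_right 0)"
  proof (cases "\<exists>a\<in>{t0<..<t1}. f1 a > 0")
    case True
    then obtain a where a: "t0 < a" "a < t1" "f1 a > 0" by auto
    have "f1 u \<ge> 0" if "a \<le> u" "u < t1" for u
      using pos[of a u] a that by (simp add: less_imp_le)
    then show ?thesis
      using a by (intro antimonotone_limit_at_right[of "t1 - a"]) (auto intro!: incr)
  next
    case False
    then show ?thesis
      using t01 by (intro monotone_limit_at_right[of "t1 - t0"]) (auto intro!: decr simp: not_less)
  qed
  then obtain L1 where L1: "((\<lambda>\<epsilon>. ereal (f (t1 - \<epsilon>))) \<longlongrightarrow> L1) (at_right 0)" by blast
  have "ereal (f t) \<le> max L0 L1" if t: "t \<in> {t0<..<t1}" for t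
  \<comment> \<open>If \<open>f1\<close> has been positive by time \<open>t\<close>, then
    \<open>f\<close> increases from \<open>t\<close> on; otherwise it has decreased up to
    \<open>t\<close>.\<close>
  proof (cases "\<exists>a\<in>{t0<..t}. f1 a > 0")
    case True
    then obtain a where a: "t0 < a" "a \<le> t" "f1 a > 0" by auto
    have p: "f1 u \<ge> 0" if "a \<le> u" "u < t1" for u
      using pos[of a u] a that by (simp add: less_imp_le)
    have "\<forall>\<^sub>F \<epsilon> in at_right 0. ereal (f t) \<le> ereal (f (t1 - \<epsilon>))"
      by (rule eventually_at_rightI[of 0 "t1 - t"]) (use t a p in \<open>auto intro!: incr\<close>)
    then have "ereal (f t) \<le> L1"
      by (intro tendsto_lowerbound[OF L1]) auto
    then show ?thesis by (simp add: le_max_iff_disj)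
  next
    case False
    have "\<forall>\<^sub>F \<epsilon> in at_right 0. ereal (f t) \<le> ereal (f (t0 + \<epsilon>))"
      by (rule eventually_at_rightI[of 0 "t - t0"]) (use t False in \<open>auto intro!: decr simp: not_less\<close>)
    then have "ereal (f t) \<le> L0"
      by (intro tendsto_lowerbound[OF L0]) auto
    then show ?thesis by (simp add: le_max_iff_disj)
  qed
  then show ?thesis using L0 L1 by blast
qed

section \<open>Charts\<close>

lemma smooth_manifold_chart:
  assumes "smooth_manifold X A" "(U, \<phi>) \<in> A"
  shows "openin X U" "open (\<phi> ` U)" "homeomorphic_map (subtopology X U) (top_of_set (\<phi> ` U)) \<phi>"
  using assms unfolding smooth_manifold_def by auto

lemma chart_inj_on:
  assumes "smooth_manifold X A" "(U, \<phi>) \<in> A"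
  shows "inj_on \<phi> U"
  using homeomorphic_imp_injective_map[OF smooth_manifold_chart(3)[OF assms]]
    openin_subset[OF smooth_manifold_chart(1)[OF assms]]
  by (simp add: Int_absorb1)

lemma chart_image_open:
  assumes "smooth_manifold X A" "(U, \<phi>) \<in> A" "openin X V" "V \<subseteq> U"
  shows "open (\<phi> ` V)"
proof -
  note U = smooth_manifold_chart[OF assms(1,2)]
  have "openin (subtopology X U) V"
    using assms(3,4) by (simp add: openin_open_subtopology[OF U(1)])
  then have "openin (top_of_set (\<phi> ` U)) (\<phi> ` V)"
    using homeomorphic_map_openness[OF U(3), of V] openin_subset by blast
  then show ?thesis
    using U(2) openin_open_trans by blast
qed

lemma smooth_manifold_cover:
  assumes "smooth_manifold X A" "z \<in> topspace X"
  obtains U \<phi> where "(U, \<phi>) \<in> A" "z \<in> U"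
  using assms unfolding smooth_manifold_def by auto

section \<open>Coordinates on a direct sum\<close>

lemma osum_inject [simp]: "p \<oplus>\<^sub>v q = p' \<oplus>\<^sub>v q' \<longleftrightarrow> p = p' \<and> q = q'"
proof
  assume eq: "p \<oplus>\<^sub>v q = p' \<oplus>\<^sub>v q'"
  have "p $ i = p' $ i" "q $ i = q' $ i" for i
    using arg_cong[OF eq, of "\<lambda>v. v $ Inl i"] arg_cong[OF eq, of "\<lambda>v. v $ Inr i"] by simp_all
  then show "p = p' \<and> q = q'" by (simp add: vec_eq_iff)
qed simp

definition left_part :: "real^('n::finite + 'n) \<Rightarrow> real^'n" where "left_part v = (\<chi> i. v $ Inl i)"
definition right_part :: "real^('n::finite + 'n) \<Rightarrow> real^'n" where "right_part v = (\<chi> j. v $ Inr j)"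

lemma parts_nth [simp]: "left_part v $ i = v $ Inl i" "right_part v $ i = v $ Inr i"
  by (simp_all add: left_part_def right_part_def)

lemma parts_osum [simp]: "left_part (p \<oplus>\<^sub>v q) = p" "right_part (p \<oplus>\<^sub>v q) = q"
  by (simp_all add: vec_eq_iff)

lemma osum_parts: "left_part v \<oplus>\<^sub>v right_part v = v"
proof -
  have "(left_part v \<oplus>\<^sub>v right_part v) $ m = v $ m" for m
    by (cases m) auto
  then show ?thesis by (simp add: vec_eq_iff)
qed

lemma osum_eqI:
  assumes "\<And>i. v $ Inl i = p $ i" "\<And>i. v $ Inr i = q $ i"
  shows "v = p \<oplus>\<^sub>v q"
proof -
  have "v $ m = (p \<oplus>\<^sub>v q) $ m" for m
    by (cases m) (use assms in auto)
  then show ?thesis by (simp add: vec_eq_iff)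
qed

lemma bounded_linear_parts: "bounded_linear left_part" "bounded_linear right_part"
  "bounded_linear (\<lambda>p. p \<oplus>\<^sub>v 0)" "bounded_linear (\<lambda>q. 0 \<oplus>\<^sub>v q)"
proof -
  have eq: "v = w \<longleftrightarrow> left_part v = left_part w \<and> right_part v = right_part w" for v w :: "real^('n::finite + 'n)"
    by (metis osum_parts)
  show "bounded_linear (left_part :: real^('n + 'n) \<Rightarrow> real^'n)"
    "bounded_linear (right_part :: real^('n + 'n) \<Rightarrow> real^'n)"
    by (auto intro!: linearI simp: linear_conv_bounded_linear[symmetric] vec_eq_iff)
  show "bounded_linear (\<lambda>p. (p :: real^'n) \<oplus>\<^sub>v 0)" "bounded_linear (\<lambda>q. 0 \<oplus>\<^sub>v (q :: real^'n))"
    by (auto intro!: linearI simp: linear_conv_bounded_linear[symmetric] eq)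
      (auto simp: vec_eq_iff)
qed

lemma osum_split: "p \<oplus>\<^sub>v q = (p \<oplus>\<^sub>v 0) + (0 \<oplus>\<^sub>v q)"
  by (rule osum_eqI[symmetric]) simp_all

lemma has_vector_derivative_osum:
  assumes "(u has_vector_derivative p) F" "(w has_vector_derivative q) F"
  shows "((\<lambda>s. u s \<oplus>\<^sub>v w s) has_vector_derivative p \<oplus>\<^sub>v q) F"
  by (subst osum_split, subst osum_split[of p q])
    (intro has_vector_derivative_add bounded_linear.has_vector_derivative[OF bounded_linear_parts(3)]
      bounded_linear.has_vector_derivative[OF bounded_linear_parts(4)] assms)

lemma continuous_on_osum:
  assumes "continuous_on T u" "continuous_on T w"
  shows "continuous_on T (\<lambda>s. u s \<oplus>\<^sub>v w s)"
  by (subst osum_split)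
    (intro continuous_on_add bounded_linear.continuous_on[OF bounded_linear_parts(3)]
      bounded_linear.continuous_on[OF bounded_linear_parts(4)] assms)

lemma open_osum_Times:
  assumes "open P" "open Q"
  shows "open ((\<lambda>(p, q). p \<oplus>\<^sub>v q) ` (P \<times> Q))"
proof -
  have "(\<lambda>(p, q). p \<oplus>\<^sub>v q) ` (P \<times> Q) = left_part -` P \<inter> right_part -` Q"
  proof (intro set_eqI iffI)
    fix v assume "v \<in> left_part -` P \<inter> right_part -` Q"
    then show "v \<in> (\<lambda>(p, q). p \<oplus>\<^sub>v q) ` (P \<times> Q)"
      by (intro image_eqI[of _ _ "(left_part v, right_part v)"]) (auto simp: osum_parts)
  qed auto
  then show ?thesis
    using assms by (auto intro!: open_Int open_vimage linear_continuous_on bounded_linear_parts)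
qed

section \<open>The cost over a fixed geodesic with constant first component\<close>

locale cost_setting =
  fixes X :: "'a topology" and A :: "('a, 'n::finite) chart set"
    and Y :: "'b topology" and B :: "('b, 'n) chart set"
    and c :: "'a \<times> 'b \<Rightarrow> ereal" and N :: "('a \<times> 'b) set" and x :: 'a and xb :: "real \<Rightarrow> 'b"
  assumes X: "smooth_manifold X A" and Y: "smooth_manifold Y B"
    and N: "openin (prod_topology X Y) N" and regular: "weakly_regular A B N c"
    and geodesic: "geodesic_on X A Y B N c {0<..<1} (\<lambda>t. (x, xb t))"
begin

abbreviation K where "K U \<phi> W \<psi> \<equiv> (N \<inter> (U \<times> W), \<lambda>(x, y). \<phi> x \<oplus>\<^sub>v \<psi> y)"
abbreviation C where "C U \<phi> W \<psi> \<equiv> local_cost c (K U \<phi> W \<psi>)"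
abbreviation S where "S U \<phi> W \<psi> \<equiv> (\<lambda>(x, y). \<phi> x \<oplus>\<^sub>v \<psi> y) ` (N \<inter> (U \<times> W))"

definition \<kappa> :: "'a \<Rightarrow> real \<Rightarrow> real" where "\<kappa> z t = real_of_ereal (c (z, xb t))"

lemma K_chart: "(U, \<phi>) \<in> A \<Longrightarrow> (W, \<psi>) \<in> B \<Longrightarrow> K U \<phi> W \<psi> \<in> product_charts A B N"
  unfolding product_charts_def by blast

lemma openin_K:
  assumes "(U, \<phi>) \<in> A" "(W, \<psi>) \<in> B"
  shows "openin (prod_topology X Y) (N \<inter> (U \<times> W))"
  using N smooth_manifold_chart(1)[OF X assms(1)] smooth_manifold_chart(1)[OF Y assms(2)]
  by (intro openin_Int) (simp_all add: openin_prod_Times_iff)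

text \<open>\<open>N\<close> need not be a product, so openness is checked at each point, on a
  rectangle inside \<open>N\<close>, whose image is a rectangle in the direct sum.\<close>

lemma open_S:
  assumes "(U, \<phi>) \<in> A" "(W, \<psi>) \<in> B"
  shows "open (S U \<phi> W \<psi>)"
proof (subst open_subopen, intro ballI)
  fix u assume "u \<in> S U \<phi> W \<psi>"
  then obtain z b where zb: "(z, b) \<in> N \<inter> (U \<times> W)" "u = \<phi> z \<oplus>\<^sub>v \<psi> b" by auto
  obtain U' W' where *: "openin X U'" "openin Y W'" "z \<in> U'" "b \<in> W'" "U' \<times> W' \<subseteq> N \<inter> (U \<times> W)"
    using openin_K[OF assms, unfolded openin_prod_topology_alt, rule_format, OF zb(1)]
    by (elim exE conjE)
  have "U' \<subseteq> U" "W' \<subseteq> W" using * by auto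
  then have "open (\<phi> ` U')" "open (\<psi> ` W')"
    using chart_image_open[OF X assms(1)] chart_image_open[OF Y assms(2)] * by auto
  then have "open ((\<lambda>(p, q). p \<oplus>\<^sub>v q) ` (\<phi> ` U' \<times> \<psi> ` W'))"
    by (rule open_osum_Times)
  moreover have "(\<lambda>(p, q). p \<oplus>\<^sub>v q) ` (\<phi> ` U' \<times> \<psi> ` W') = (\<lambda>(x, y). \<phi> x \<oplus>\<^sub>v \<psi> y) ` (U' \<times> W')"
    by (simp add: map_prod_surj_on[OF refl refl, symmetric] image_image split_beta)
  moreover have "u \<in> (\<lambda>(x, y). \<phi> x \<oplus>\<^sub>v \<psi> y) ` (U' \<times> W')"
    using zb(2) *(3,4) by (intro image_eqI[of _ _ "(z, b)"]) auto
  moreover have "(\<lambda>(x, y). \<phi> x \<oplus>\<^sub>v \<psi> y) ` (U' \<times> W') \<subseteq> S U \<phi> W \<psi>"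
    by (rule image_mono[OF *(5)])
  ultimately have "open ((\<lambda>(x, y). \<phi> x \<oplus>\<^sub>v \<psi> y) ` (U' \<times> W')) \<and>
      u \<in> (\<lambda>(x, y). \<phi> x \<oplus>\<^sub>v \<psi> y) ` (U' \<times> W') \<and>
      (\<lambda>(x, y). \<phi> x \<oplus>\<^sub>v \<psi> y) ` (U' \<times> W') \<subseteq> S U \<phi> W \<psi>"
    by (simp only: simp_thms)
  then show "\<exists>T. open T \<and> u \<in> T \<and> T \<subseteq> S U \<phi> W \<psi>" by (rule exI)
qed

lemma coordinates:
  assumes "(U, \<phi>) \<in> A" "(W, \<psi>) \<in> B"
  shows "cost_in_coordinates (C U \<phi> W \<psi>) (S U \<phi> W \<psi>)"
proof
  note K = K_chart[OF assms]
  show "open (S U \<phi> W \<psi>)" by (rule open_S[OF assms])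
  have "\<forall>K\<in>product_charts A B N. Ck_on 4 (snd K ` fst K) (local_cost c K)"
    using regular unfolding weakly_regular_def cost_C4_on_def by blast
  from bspec[OF this K] show "Ck_on 4 (S U \<phi> W \<psi>) (C U \<phi> W \<psi>)"
    unfolding fst_conv snd_conv .
  have "\<forall>K\<in>product_charts A B N. \<forall>z\<in>snd K ` fst K. invertible (mixed_hessian (local_cost c K) z)"
    using regular unfolding weakly_regular_def nondegenerate_def by blast
  from bspec[OF this K, unfolded fst_conv snd_conv]
  show "invertible (mixed_hessian (C U \<phi> W \<psi>) u)" if "u \<in> S U \<phi> W \<psi>" for u
    using that by (rule bspec)
qed

lemma sec_nonneg:
  assumes "(U, \<phi>) \<in> A" "(W, \<psi>) \<in> B" "u \<in> S U \<phi> W \<psi>"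
    "null_vector (cost_metric (C U \<phi> W \<psi>)) u (p \<oplus>\<^sub>v q)"
  shows "sec (cost_metric (C U \<phi> W \<psi>)) u (p \<oplus>\<^sub>v 0) (0 \<oplus>\<^sub>v q) \<ge> 0"
proof -
  have "\<forall>K\<in>product_charts A B N. \<forall>z\<in>snd K ` fst K. \<forall>p q.
      null_vector (cost_metric (local_cost c K)) z (p \<oplus>\<^sub>v q) \<longrightarrow>
      sec (cost_metric (local_cost c K)) z (p \<oplus>\<^sub>v 0) (0 \<oplus>\<^sub>v q) \<ge> 0"
    using regular unfolding weakly_regular_def by blast
  from bspec[OF this K_chart[OF assms(1,2)], unfolded fst_conv snd_conv, rule_format, OF assms(3,4)]
  show ?thesis .
qed

lemma C_eq:
  assumes "(U, \<phi>) \<in> A" "(W, \<psi>) \<in> B" "(z, b) \<in> N \<inter> (U \<times> W)"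
  shows "C U \<phi> W \<psi> (\<phi> z \<oplus>\<^sub>v \<psi> b) = real_of_ereal (c (z, b))"
proof -
  have "inj_on (\<lambda>(x, y). \<phi> x \<oplus>\<^sub>v \<psi> y) (N \<inter> (U \<times> W))"
    by (rule inj_onI) (auto dest: inj_onD[OF chart_inj_on[OF X assms(1)]]
        inj_onD[OF chart_inj_on[OF Y assms(2)]])
  then have "inv_into (N \<inter> (U \<times> W)) (\<lambda>(x, y). \<phi> x \<oplus>\<^sub>v \<psi> y) (\<phi> z \<oplus>\<^sub>v \<psi> b) = (z, b)"
    using inv_into_f_f[OF _ assms(3), of "\<lambda>(x, y). \<phi> x \<oplus>\<^sub>v \<psi> y"] by simp
  then show ?thesis by (simp add: local_cost_def)
qed

lemma continuous_map_x_xb: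
  "continuous_map (top_of_set {0<..<1}) (prod_topology X Y) (\<lambda>t. (x, xb t))"
  "\<And>t. t \<in> {0<..<1} \<Longrightarrow> (x, xb t) \<in> N"
  using geodesic unfolding geodesic_on_def continuous_map_in_subtopology by auto

lemma continuous_map_xb: "continuous_map (top_of_set {0<..<1}) Y xb"
  using continuous_map_compose[OF continuous_map_x_xb(1) continuous_map_snd] by (simp add: o_def)

lemma open_times:
  assumes "openin (prod_topology X Y) O'" "z \<in> topspace X"
  shows "open {t \<in> {0<..<1}. (z, xb t) \<in> O'}"
proof -
  have "continuous_map (top_of_set {0<..<1}) (prod_topology X Y) (\<lambda>t. (z, xb t))"
    using continuous_map_xb assms(2) by (simp add: continuous_map_pairwise o_def)
  from openin_continuous_map_preimage[OF this assms(1)]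
  have "openin (top_of_set {0<..<1}) {t \<in> {0<..<1}. (z, xb t) \<in> O'}" by simp
  then show ?thesis by (rule openin_open_trans) auto
qed

lemma N_subset: "N \<subseteq> topspace X \<times> topspace Y"
  using openin_subset[OF N] by simp

lemma x_in_topspace: "x \<in> topspace X"
  using continuous_map_x_xb(2)[of "1/2"] N_subset by auto

text \<open>The first component of the curve is constant, so its velocity is purely barred and only
  the lowered equations with an unbarred free index remain. Their derivatives are ordered with the
  unbarred one outermost, as needed for pairing with the velocity of a slice geodesic.\<close>

lemma velocity_exists:
  assumes U: "(U, \<phi>) \<in> A" "x \<in> U" and W: "(W, \<psi>) \<in> B"
  shows "\<exists>q r. \<forall>t\<in>{0<..<1}. xb t \<in> W \<longrightarrow>
     ((\<lambda>s. \<psi> (xb s)) has_vector_derivative q t) (at t) \<and> (q has_vector_derivative r t) (at t) \<and>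
     (\<forall>i. (\<Sum>j\<in>UNIV. r t $ j * pd (Inl i) (pd (Inr j) (C U \<phi> W \<psi>)) (\<phi> x \<oplus>\<^sub>v \<psi> (xb t)))
       + (\<Sum>j\<in>UNIV. \<Sum>l\<in>UNIV. q t $ j * q t $ l *
          pd (Inl i) (pd (Inr j) (pd (Inr l) (C U \<phi> W \<psi>))) (\<phi> x \<oplus>\<^sub>v \<psi> (xb t))) = 0)"
proof -
  interpret cc: cost_in_coordinates "C U \<phi> W \<psi>" "S U \<phi> W \<psi>"
    by (rule coordinates[OF U(1) W])
  let ?J = "{t \<in> {0<..<1}. (x, xb t) \<in> N \<inter> (U \<times> W)}"
  have J_iff: "t \<in> ?J \<longleftrightarrow> t \<in> {0<..<1} \<and> xb t \<in> W" for t
    using continuous_map_x_xb(2)[of t] U(2) by auto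
  obtain v a where va: "\<And>t. t \<in> ?J \<Longrightarrow>
     ((\<lambda>s. \<phi> x \<oplus>\<^sub>v \<psi> (xb s)) has_vector_derivative v t) (at t) \<and>
     (v has_vector_derivative a t) (at t) \<and>
     (\<forall>m. a t $ m + (\<Sum>j\<in>UNIV. \<Sum>k\<in>UNIV.
        christoffel cc.g m j k (\<phi> x \<oplus>\<^sub>v \<psi> (xb t)) * v t $ j * v t $ k) = 0)"
  proof -
    obtain v a where *: "\<forall>t\<in>{0<..<1}. (x, xb t) \<in> N \<inter> (U \<times> W) \<longrightarrow>
     ((\<lambda>s. \<phi> x \<oplus>\<^sub>v \<psi> (xb s)) has_vector_derivative v t) (at t within {0<..<1}) \<and>
     (v has_vector_derivative a t) (at t within {0<..<1}) \<and>
     (\<forall>m. a t $ m + (\<Sum>j\<in>UNIV. \<Sum>k\<in>UNIV.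
        christoffel cc.g m j k (\<phi> x \<oplus>\<^sub>v \<psi> (xb t)) * v t $ j * v t $ k) = 0)"
      using geodesic K_chart[OF U(1) W] unfolding geodesic_on_def by fastforce
    have "at t within {0<..<1} = at t" if "t \<in> ?J" for t :: real
      using that by (intro at_within_open) auto
    then show thesis
      using * by (intro that[of v a]) auto
  qed
  have v0: "v t $ Inl i = 0" if "t \<in> ?J" for t i
    using has_vector_derivative_vec_nth[of "\<lambda>s. \<phi> x \<oplus>\<^sub>v \<psi> (xb s)" "v t" "at t" "Inl i"] va[OF that]
    by (auto dest: DERIV_unique[OF _ DERIV_const])
  define q where "q t = right_part (v t)" for t
  define r where "r t = right_part (a t)" for t
  show ?thesis
  proof (rule exI[of _ q], rule exI[of _ r], intro ballI impI conjI allI)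
    fix t :: real and i assume "t \<in> {0<..<1}" "xb t \<in> W"
    then have t: "t \<in> ?J" unfolding J_iff by blast
    show "((\<lambda>s. \<psi> (xb s)) has_vector_derivative q t) (at t)"
      using bounded_linear.has_vector_derivative[OF bounded_linear_parts(2) va[OF t, THEN conjunct1]]
      by (simp add: q_def)
    show "(q has_vector_derivative r t) (at t)"
      using bounded_linear.has_vector_derivative[OF bounded_linear_parts(2), of v "a t" "at t"] va[OF t]
      by (simp add: q_def[abs_def] r_def)
    have in_S: "\<phi> x \<oplus>\<^sub>v \<psi> (xb t) \<in> S U \<phi> W \<psi>" using t by force
    show "(\<Sum>j\<in>UNIV. r t $ j * pd (Inl i) (pd (Inr j) (C U \<phi> W \<psi>)) (\<phi> x \<oplus>\<^sub>v \<psi> (xb t)))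
       + (\<Sum>j\<in>UNIV. \<Sum>l\<in>UNIV. q t $ j * q t $ l *
          pd (Inl i) (pd (Inr j) (pd (Inr l) (C U \<phi> W \<psi>))) (\<phi> x \<oplus>\<^sub>v \<psi> (xb t))) = 0"
      using cc.geodesic_right_lower[OF in_S v0[OF t], of "a t" i] va[OF t]
      by (simp add: q_def r_def cc.pd_M_right[OF in_S]) (simp add: cc.M_def mult.commute)
  qed
qed

end

section \<open>Derivatives along the two families of geodesics\<close>

context cost_setting
begin

text \<open>The second component equals \<open>b\<close> only for parameters in
  \<open>{0..1}\<close>, so the derivative has to be transferred within that interval; its barred
  part is then the derivative of a constant.\<close>

lemma slice_geodesic_in_chart:
  assumes U: "(U, \<phi>) \<in> A" and W: "(W, \<psi>) \<in> B"
    and geo: "geodesic_on X A Y B N c {0..1} \<gamma>" and slice: "\<gamma> ` {0..1} \<subseteq> slice N b \<times> {b}"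
  shows "\<exists>v a. \<forall>s\<in>{0..1}. \<gamma> s \<in> N \<inter> (U \<times> W) \<longrightarrow>
       ((\<lambda>s. \<phi> (fst (\<gamma> s)) \<oplus>\<^sub>v \<psi> b) has_vector_derivative v s) (at s within {0..1}) \<and>
       (v has_vector_derivative a s) (at s within {0..1}) \<and>
       (\<forall>j. v s $ Inr j = 0) \<and>
       (\<forall>m. a s $ m + (\<Sum>j\<in>UNIV. \<Sum>k\<in>UNIV.
         christoffel (cost_metric (C U \<phi> W \<psi>)) m j k (\<phi> (fst (\<gamma> s)) \<oplus>\<^sub>v \<psi> b) * v s $ j * v s $ k) = 0)"
proof -
  let ?u = "\<lambda>s. \<phi> (fst (\<gamma> s)) \<oplus>\<^sub>v \<psi> b"
  let ?u' = "\<lambda>s. case \<gamma> s of (x, y) \<Rightarrow> \<phi> x \<oplus>\<^sub>v \<psi> y"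
  have eq: "?u s = ?u' s" if "s \<in> {0..1}" for s
  proof -
    have "snd (\<gamma> s) = b" using subsetD[OF slice imageI[OF that]] by (simp add: mem_Times_iff)
    then show ?thesis by (simp add: split_beta)
  qed
  have "\<forall>K\<in>product_charts A B N. \<exists>v a. \<forall>s\<in>{0..1}. \<gamma> s \<in> fst K \<longrightarrow>
        ((\<lambda>s. snd K (\<gamma> s)) has_vector_derivative v s) (at s within {0..1}) \<and>
        (v has_vector_derivative a s) (at s within {0..1}) \<and>
        (\<forall>m. a s $ m + (\<Sum>j\<in>UNIV. \<Sum>k\<in>UNIV.
           christoffel (cost_metric (local_cost c K)) m j k (snd K (\<gamma> s)) * v s $ j * v s $ k) = 0)"
    using geo unfolding geodesic_on_def by (rule conjunct2)
  from bspec[OF this K_chart[OF U W], unfolded fst_conv snd_conv]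
  obtain v a where va: "\<forall>s\<in>{0..1}. \<gamma> s \<in> N \<inter> (U \<times> W) \<longrightarrow>
        (?u' has_vector_derivative v s) (at s within {0..1}) \<and>
        (v has_vector_derivative a s) (at s within {0..1}) \<and>
        (\<forall>m. a s $ m + (\<Sum>j\<in>UNIV. \<Sum>k\<in>UNIV.
           christoffel (cost_metric (C U \<phi> W \<psi>)) m j k (?u' s) * v s $ j * v s $ k) = 0)"
    by (elim exE)
  have u: "(?u has_vector_derivative v s) (at s within {0..1})"
    if s: "s \<in> {0..1}" "\<gamma> s \<in> N \<inter> (U \<times> W)" for s
    by (rule has_vector_derivative_transform[OF s(1) eq])
      (use va[rule_format, OF s] in simp_all)
  show ?thesis
  proof (rule exI[of _ v], rule exI[of _ a], intro ballI impI conjI allI)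
    fix s :: real assume s: "s \<in> {0..1}" "\<gamma> s \<in> N \<inter> (U \<times> W)"
    show "(?u has_vector_derivative v s) (at s within {0..1})" by (rule u[OF s])
    show "(v has_vector_derivative a s) (at s within {0..1})"
      using va[rule_format, OF s] by blast
    show "v s $ Inr j = 0" for j
      using has_vector_derivative_vec_nth[OF u[OF s], of "Inr j"]
      by (intro real_derivative_unique_unit_interval[OF _ DERIV_const s(1)]) simp
    show "a s $ m + (\<Sum>j\<in>UNIV. \<Sum>k\<in>UNIV.
       christoffel (cost_metric (C U \<phi> W \<psi>)) m j k (?u s) * v s $ j * v s $ k) = 0" for m
      using va[rule_format, OF s] unfolding eq[OF s(1)] by blast
  qed
qed

lemma slice_geodesic_times_open:
  assumes "geodesic_on X A Y B N c {0..1} \<gamma>" "openin (prod_topology X Y) O'"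
  shows "openin (top_of_set {0..1}) {s \<in> {0..1}. \<gamma> s \<in> O'}"
proof -
  have "continuous_map (top_of_set {0..1}) (prod_topology X Y) \<gamma>"
    using assms(1) unfolding geodesic_on_def continuous_map_in_subtopology by blast
  from openin_continuous_map_preimage[OF this assms(2)] show ?thesis by simp
qed

end

lemma eventually_within_openin:
  assumes "openin (top_of_set T) J" "s \<in> J"
  shows "\<forall>\<^sub>F s' in at s within T. s' \<in> J"
proof -
  obtain V where V: "open V" "J = T \<inter> V"
    using assms(1) by (auto simp: openin_open)
  then show ?thesis
    using assms(2) unfolding eventually_at_topological by (intro exI[of _ V]) auto
qed

lemma has_derivative_openin_cong:
  fixes R G :: "real \<Rightarrow> real"
  assumes "openin (top_of_set T) J" "s \<in> J" "\<And>s. s \<in> J \<Longrightarrow> R s = G s"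
    and "(G has_real_derivative D) (at s within T)"
  shows "(R has_real_derivative D) (at s within T)"
proof -
  have "\<forall>\<^sub>F s' in at s within T. R s' = G s'"
    using eventually_within_openin[OF assms(1,2)] by (rule eventually_mono) (rule assms(3))
  from has_field_derivative_cong_eventually[OF this assms(3)[OF assms(2)]] show ?thesis
    using assms(4) by blast
qed

text \<open>The barred velocity is assumed to vanish at \<open>s\<close> only. For the second
  derivative the sum is therefore restricted to the unbarred indices before it is
  differentiated.\<close>

lemma has_derivative_along_left_curve:
  fixes F :: "real^('n::finite + 'n) \<Rightarrow> real"
  assumes "open S" "u s \<in> S" "Ck_on (Suc (Suc k)) S F"
    and u: "(u has_vector_derivative v s) (at s within T)" and v: "\<And>j. v s $ Inr j = 0"
  shows "((\<lambda>s. F (u s)) has_real_derivative (\<Sum>i\<in>UNIV. v s $ Inl i * pd (Inl i) F (u s))) (at s within T)"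
    and "(v has_vector_derivative a) (at s within T) \<Longrightarrow>
      ((\<lambda>s. \<Sum>i\<in>UNIV. v s $ Inl i * pd (Inl i) F (u s)) has_real_derivative
       (\<Sum>i\<in>UNIV. a $ Inl i * pd (Inl i) F (u s))
       + (\<Sum>i\<in>UNIV. \<Sum>k\<in>UNIV. v s $ Inl i * v s $ Inl k * pd (Inl i) (pd (Inl k) F) (u s))) (at s within T)"
proof -
  show "((\<lambda>s. F (u s)) has_real_derivative (\<Sum>i\<in>UNIV. v s $ Inl i * pd (Inl i) F (u s))) (at s within T)"
    using has_derivative_along_curve[OF assms(1-3) u] by (simp add: sum_UNIV_Plus v)
  assume a: "(v has_vector_derivative a) (at s within T)"
  have *: "((\<lambda>s. v s $ Inl k * pd (Inl k) F (u s)) has_real_derivative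
     a $ Inl k * pd (Inl k) F (u s)
     + (\<Sum>i\<in>UNIV. v s $ Inl i * pd (Inl i) (pd (Inl k) F) (u s)) * v s $ Inl k) (at s within T)" for k
  proof -
    have "((\<lambda>s. pd (Inl k) F (u s)) has_real_derivative
        (\<Sum>i\<in>UNIV. v s $ Inl i * pd (Inl i) (pd (Inl k) F) (u s))) (at s within T)"
      using has_derivative_along_curve[OF assms(1,2) Ck_on_pd[OF assms(3)] u]
      by (simp add: sum_UNIV_Plus v)
    then show ?thesis
      by (rule DERIV_mult[OF has_vector_derivative_vec_nth[OF a]])
  qed
  have "(\<Sum>i\<in>UNIV. \<Sum>k\<in>UNIV. v s $ Inl i * v s $ Inl k * pd (Inl i) (pd (Inl k) F) (u s))
      = (\<Sum>k\<in>UNIV. \<Sum>i\<in>UNIV. v s $ Inl i * v s $ Inl k * pd (Inl i) (pd (Inl k) F) (u s))"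
    by (rule sum.swap)
  then show "((\<lambda>s. \<Sum>i\<in>UNIV. v s $ Inl i * pd (Inl i) F (u s)) has_real_derivative
       (\<Sum>i\<in>UNIV. a $ Inl i * pd (Inl i) F (u s))
       + (\<Sum>i\<in>UNIV. \<Sum>k\<in>UNIV. v s $ Inl i * v s $ Inl k * pd (Inl i) (pd (Inl k) F) (u s))) (at s within T)"
    by (intro DERIV_cong[OF DERIV_sum[OF *]])
      (simp add: sum.distrib sum_distrib_left sum_distrib_right mult_ac)
qed

text \<open>Together with \<open>right_second\<close>, the first and second derivative of
  \<open>C\<close> along a barred curve with velocity \<open>q\<close> and acceleration
  \<open>r\<close>. The point \<open>u\<close> is a separate argument, so that it can be varied in
  unbarred directions with \<open>q\<close> and \<open>r\<close> frozen.\<close>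

definition right_first :: "(real^('n + 'n) \<Rightarrow> real) \<Rightarrow> real^'n \<Rightarrow> real^('n::finite + 'n) \<Rightarrow> real" where
  "right_first C q u = (\<Sum>j\<in>UNIV. q $ j * pd (Inr j) C u)"

definition right_second ::
    "(real^('n + 'n) \<Rightarrow> real) \<Rightarrow> real^'n \<Rightarrow> real^'n \<Rightarrow> real^('n::finite + 'n) \<Rightarrow> real" where
  "right_second C q r u = (\<Sum>j\<in>UNIV. r $ j * pd (Inr j) C u)
     + (\<Sum>j\<in>UNIV. \<Sum>l\<in>UNIV. q $ j * q $ l * pd (Inr j) (pd (Inr l) C) u)"

text \<open>The coordinates of \<open>xb\<close> depend only on \<open>\<psi>\<close>, so the same
  \<open>q\<close> and \<open>r\<close> serve every chart of the first factor. The chart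
  \<open>U\<^sub>0\<close> at \<open>x\<close> is kept because \<open>geodesic_x\<close> is
  expressed in it.\<close>

locale moving_chart = cost_setting +
  fixes U\<^sub>0 \<phi>\<^sub>0 W \<psi> q r
  assumes U\<^sub>0: "(U\<^sub>0, \<phi>\<^sub>0) \<in> A" and x_in_U\<^sub>0: "x \<in> U\<^sub>0" and W: "(W, \<psi>) \<in> B"
    and velocity: "\<And>t. t \<in> {0<..<1} \<Longrightarrow> xb t \<in> W \<Longrightarrow> ((\<lambda>s. \<psi> (xb s)) has_vector_derivative q t) (at t)"
    and acceleration: "\<And>t. t \<in> {0<..<1} \<Longrightarrow> xb t \<in> W \<Longrightarrow> (q has_vector_derivative r t) (at t)"
    and geodesic_x: "\<And>t i. t \<in> {0<..<1} \<Longrightarrow> xb t \<in> W \<Longrightarrow>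
      (\<Sum>j\<in>UNIV. r t $ j * pd (Inl i) (pd (Inr j) (C U\<^sub>0 \<phi>\<^sub>0 W \<psi>)) (\<phi>\<^sub>0 x \<oplus>\<^sub>v \<psi> (xb t)))
       + (\<Sum>j\<in>UNIV. \<Sum>l\<in>UNIV. q t $ j * q t $ l *
          pd (Inl i) (pd (Inr j) (pd (Inr l) (C U\<^sub>0 \<phi>\<^sub>0 W \<psi>))) (\<phi>\<^sub>0 x \<oplus>\<^sub>v \<psi> (xb t))) = 0"
begin

lemma coordinate_point_in_S:
  "(z, b) \<in> N \<inter> (U \<times> W) \<Longrightarrow> \<phi> z \<oplus>\<^sub>v \<psi> b \<in> S U \<phi> W \<psi>"
  by (rule image_eqI[of _ _ "(z, b)"]) auto

lemma times_open:
  assumes "(U, \<phi>) \<in> A" "(z, xb t) \<in> N \<inter> (U \<times> W)"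
  shows "open {t \<in> {0<..<1}. (z, xb t) \<in> N \<inter> (U \<times> W)}"
  by (rule open_times[OF openin_K[OF assms(1) W]]) (use assms N_subset in auto)

text \<open>The derivatives of \<kappa> involve no chart, whereas their coordinate expressions hold
  in any chart around \<open>z\<close>. This is what links different charts along a slice
  geodesic.\<close>

lemma time_derivatives:
  assumes U: "(U, \<phi>) \<in> A" and t: "t \<in> {0<..<1}" and z: "(z, xb t) \<in> N \<inter> (U \<times> W)"
  shows "(\<kappa> z has_real_derivative deriv (\<kappa> z) t) (at t)" (is ?A)
    and "deriv (\<kappa> z) t = right_first (C U \<phi> W \<psi>) (q t) (\<phi> z \<oplus>\<^sub>v \<psi> (xb t))" (is ?B)
    and "(deriv (\<kappa> z) has_real_derivative deriv (deriv (\<kappa> z)) t) (at t)" (is ?C)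
    and "deriv (deriv (\<kappa> z)) t = right_second (C U \<phi> W \<psi>) (q t) (r t) (\<phi> z \<oplus>\<^sub>v \<psi> (xb t))" (is ?D)
proof -
  interpret cc: cost_in_coordinates "C U \<phi> W \<psi>" "S U \<phi> W \<psi>"
    by (rule coordinates[OF U W])
  let ?J = "{t \<in> {0<..<1}. (z, xb t) \<in> N \<inter> (U \<times> W)}"
  let ?u = "\<lambda>s. \<phi> z \<oplus>\<^sub>v \<psi> (xb s)"
  have J: "open ?J" by (rule times_open[OF U z])
  have u: "(?u has_vector_derivative 0 \<oplus>\<^sub>v q s) (at s)" if s: "s \<in> ?J" for s
    by (intro has_vector_derivative_osum has_vector_derivative_const velocity) (use s in auto)
  have in_S: "?u s \<in> S U \<phi> W \<psi>" if s: "s \<in> ?J" for s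
    by (rule coordinate_point_in_S) (use s in blast)
  have first: "(\<kappa> z has_real_derivative right_first (C U \<phi> W \<psi>) (q s) (?u s)) (at s)" if s: "s \<in> ?J" for s
  proof (rule has_field_derivative_transform_within_open[OF _ J s])
    show "((\<lambda>s. C U \<phi> W \<psi> (?u s)) has_real_derivative right_first (C U \<phi> W \<psi>) (q s) (?u s)) (at s)"
      using has_derivative_along_curve[OF cc.open_S in_S[OF s] cc.C4' u[OF s]]
      by (simp add: sum_UNIV_Plus right_first_def)
    show "C U \<phi> W \<psi> (?u s) = \<kappa> z s" if "s \<in> ?J" for s
      unfolding \<kappa>_def by (rule C_eq[OF U W]) (use that in blast)
  qed
  have t_in: "t \<in> ?J" using t z by blast
  show ?A ?B
    using first[OF t_in] DERIV_imp_deriv by fastforce+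
  have eq: "right_first (C U \<phi> W \<psi>) (q s) (?u s) = deriv (\<kappa> z) s" if "s \<in> ?J" for s
    using DERIV_imp_deriv[OF first[OF that]] by simp
  have "(deriv (\<kappa> z) has_real_derivative right_second (C U \<phi> W \<psi>) (q t) (r t) (?u t)) (at t)"
  proof (rule has_field_derivative_transform_within_open[OF _ J t_in eq])
    have "((\<lambda>s. 0 \<oplus>\<^sub>v q s) has_vector_derivative 0 \<oplus>\<^sub>v r t) (at t)"
      by (intro has_vector_derivative_osum has_vector_derivative_const acceleration) (use t z in auto)
    from has_second_derivative_along_curve[where v = "\<lambda>s. 0 \<oplus>\<^sub>v q s", OF cc.open_S in_S[OF t_in] cc.C4' u[OF t_in] this]
    show "((\<lambda>s. right_first (C U \<phi> W \<psi>) (q s) (?u s)) has_real_derivative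
        right_second (C U \<phi> W \<psi>) (q t) (r t) (?u t)) (at t)"
      by (simp add: sum_UNIV_Plus right_first_def right_second_def)
  qed
  then show ?C ?D
    using DERIV_imp_deriv by fastforce+
qed

end

lemma sum_mult_swap:
  "(\<Sum>j\<in>J. b j * (\<Sum>i\<in>I. v i * f i j)) = (\<Sum>i\<in>I. v i * (\<Sum>j\<in>J. b j * f i j))"
  for b :: "'j \<Rightarrow> real" and v :: "'i \<Rightarrow> real"
proof -
  have "(\<Sum>j\<in>J. b j * (\<Sum>i\<in>I. v i * f i j)) = (\<Sum>j\<in>J. \<Sum>i\<in>I. v i * (b j * f i j))"
    by (simp only: sum_distrib_left mult.left_commute)
  also have "\<dots> = (\<Sum>i\<in>I. \<Sum>j\<in>J. v i * (b j * f i j))"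
    by (rule sum.swap)
  finally show ?thesis
    by (simp only: sum_distrib_left)
qed

lemma sum_mult_swap2:
  "(\<Sum>j\<in>J. \<Sum>l\<in>L. b j l * (\<Sum>i\<in>I. v i * f i j l))
    = (\<Sum>i\<in>I. v i * (\<Sum>j\<in>J. \<Sum>l\<in>L. b j l * f i j l))"
  for b :: "'j \<Rightarrow> 'l \<Rightarrow> real" and v :: "'i \<Rightarrow> real"
  unfolding sum.cartesian_product split_beta by (rule sum_mult_swap)

context moving_chart
begin

text \<open>Along the geodesic \<open>\<gamma>\<close> from \<open>(x, xb t)\<close> to \<open>(z, xb t)\<close>, \<open>s \<mapsto> deriv (\<kappa> (fst (\<gamma> s))) t\<close> is
  affine; it takes the same value at both ends, so the velocity of \<open>\<gamma>\<close> and that of \<open>xb\<close> form a null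
  vector all along \<open>\<gamma>\<close>. Hence the second time derivative is a concave function of \<open>s\<close>, and it is
  stationary at \<open>s = 0\<close> because \<open>xb\<close> is a geodesic over \<open>x\<close>.\<close>

lemma illuminated_second_derivative_le:
  assumes t: "t \<in> {0<..<1}" "xb t \<in> W"
    and z: "z \<in> illuminated X A Y B N c x (xb t)"
    and crit: "deriv (\<kappa> z) t = deriv (\<kappa> x) t"
  shows "deriv (deriv (\<kappa> z)) t \<le> deriv (deriv (\<kappa> x)) t"
proof -
  obtain \<gamma> where \<gamma>: "\<gamma> 0 = (x, xb t)" "\<gamma> 1 = (z, xb t)" "\<gamma> ` {0..1} \<subseteq> slice N (xb t) \<times> {xb t}"
    "geodesic_on X A Y B N c {0..1} \<gamma>"
    using z unfolding illuminated_def by blast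
  have \<gamma>_eq: "\<gamma> s = (fst (\<gamma> s), xb t)" "\<gamma> s \<in> N" if "s \<in> {0..1}" for s
    using subsetD[OF \<gamma>(3) imageI[OF that]] by (auto simp: slice_def)
  define P where "P s = deriv (\<kappa> (fst (\<gamma> s))) t" for s
  define Q where "Q s = deriv (deriv (\<kappa> (fst (\<gamma> s)))) t" for s
  \<comment> \<open>At \<open>s = 0\<close> the chart is fixed to be \<open>U\<^sub>0\<close>, so
    that \<open>geodesic_x\<close> can be used there.\<close>
  have chart: "\<exists>U \<phi>. (U, \<phi>) \<in> A \<and> \<gamma> s \<in> N \<inter> (U \<times> W) \<and> (s = 0 \<longrightarrow> U = U\<^sub>0 \<and> \<phi> = \<phi>\<^sub>0)"
    if s: "s \<in> {0..1}" for s :: real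
  proof (cases "s = 0")
    case True
    have "\<gamma> s \<in> N \<inter> (U\<^sub>0 \<times> W)"
      using \<gamma>_eq(2)[OF s] \<gamma>(1) True x_in_U\<^sub>0 t(2) by simp
    then show ?thesis using U\<^sub>0 by (intro exI[of _ U\<^sub>0] exI[of _ \<phi>\<^sub>0] conjI impI refl)
  next
    case False
    have "fst (\<gamma> s) \<in> topspace X"
      using \<gamma>_eq(2)[OF s] N_subset by auto
    then obtain U \<phi> where U: "(U, \<phi>) \<in> A" "fst (\<gamma> s) \<in> U"
      by (rule smooth_manifold_cover[OF X])
    then have "\<gamma> s \<in> N \<inter> (U \<times> W)"
      using \<gamma>_eq[OF s] t(2) by (simp add: mem_Times_iff) (metis snd_conv)
    then show ?thesis using U(1) False by (intro exI[of _ U] exI[of _ \<phi>]) simp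
  qed
  define qt where "qt = q t"
  define rt where "rt = r t"

  have P'': "\<exists>D E. (P has_real_derivative D s) (at s within {0..1}) \<and>
     (\<forall>\<^sub>F s' in at s within {0..1}. (P has_real_derivative D s') (at s' within {0..1})) \<and>
     (D has_real_derivative E) (at s within {0..1}) \<and> E = 0" if s: "s \<in> {0..1}" for s
  proof -
    obtain U \<phi> where U: "(U, \<phi>) \<in> A" "\<gamma> s \<in> N \<inter> (U \<times> W)" "s = 0 \<longrightarrow> U = U\<^sub>0 \<and> \<phi> = \<phi>\<^sub>0"
      using chart[OF s] by (elim exE conjE)
    interpret cc: cost_in_coordinates "C U \<phi> W \<psi>" "S U \<phi> W \<psi>"
      by (rule coordinates[OF U(1) W])
    obtain v a where *: "\<forall>s\<in>{0..1}. \<gamma> s \<in> N \<inter> (U \<times> W) \<longrightarrow>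
       ((\<lambda>s. \<phi> (fst (\<gamma> s)) \<oplus>\<^sub>v \<psi> (xb t)) has_vector_derivative v s) (at s within {0..1}) \<and>
       (v has_vector_derivative a s) (at s within {0..1}) \<and>
       (\<forall>j. v s $ Inr j = 0) \<and>
       (\<forall>m. a s $ m + (\<Sum>j\<in>UNIV. \<Sum>k\<in>UNIV.
         christoffel (cost_metric (C U \<phi> W \<psi>)) m j k (\<phi> (fst (\<gamma> s)) \<oplus>\<^sub>v \<psi> (xb t)) * v s $ j * v s $ k) = 0)"
      using slice_geodesic_in_chart[OF U(1) W \<gamma>(4,3)] by (elim exE)
    note va = *[rule_format, THEN conjunct1] *[rule_format, THEN conjunct2, THEN conjunct1]
      *[rule_format, THEN conjunct2, THEN conjunct2, THEN conjunct1, rule_format]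
      *[rule_format, THEN conjunct2, THEN conjunct2, THEN conjunct2, rule_format]
    let ?u = "\<lambda>s. \<phi> (fst (\<gamma> s)) \<oplus>\<^sub>v \<psi> (xb t)"
    let ?J = "{s \<in> {0..1}. \<gamma> s \<in> N \<inter> (U \<times> W)}"
    let ?F = "\<lambda>j. pd (Inr j) (C U \<phi> W \<psi>)"
    let ?D1 = "\<lambda>F s. \<Sum>i\<in>UNIV. v s $ Inl i * pd (Inl i) F (?u s)"
    let ?D2 = "\<lambda>F. (\<Sum>i\<in>UNIV. a s $ Inl i * pd (Inl i) F (?u s))
       + (\<Sum>i\<in>UNIV. \<Sum>k\<in>UNIV. v s $ Inl i * v s $ Inl k * pd (Inl i) (pd (Inl k) F) (?u s))"
    let ?D = "\<lambda>s. \<Sum>j\<in>UNIV. qt $ j * ?D1 (?F j) s"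
    have J: "openin (top_of_set {0..1}) ?J"
      by (rule slice_geodesic_times_open[OF \<gamma>(4) openin_K[OF U(1) W]])
    have J_in: "(fst (\<gamma> s), xb t) \<in> N \<inter> (U \<times> W)" if "s \<in> ?J" for s
      using that \<gamma>_eq(1)[of s] by simp
    have P_eq: "P s = (\<Sum>j\<in>UNIV. qt $ j * ?F j (?u s))" if "s \<in> ?J" for s
      using time_derivatives(2)[OF U(1) t(1) J_in[OF that]] by (simp add: P_def right_first_def qt_def)
    have in_S: "?u s \<in> S U \<phi> W \<psi>" if "s \<in> ?J" for s
      by (rule coordinate_point_in_S[OF J_in[OF that]])
    have sJ: "s \<in> ?J" using s U(2) by blast
    have F1: "((\<lambda>s. F (?u s)) has_real_derivative ?D1 F s') (at s' within {0..1})"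
      if s': "s' \<in> ?J" and F: "Ck_on (Suc (Suc 0)) (S U \<phi> W \<psi>) F" for s' F
      by (rule has_derivative_along_left_curve(1)[where u = ?u and v = v, OF cc.open_S in_S[OF s'] F va(1,3)])
        (use s' in blast)+
    have F2: "(?D1 F has_real_derivative ?D2 F) (at s within {0..1})"
      if F: "Ck_on (Suc (Suc 0)) (S U \<phi> W \<psi>) F" for F
      by (rule has_derivative_along_left_curve(2)[where u = ?u and v = v, OF cc.open_S in_S[OF sJ] F va(1,3,2)])
        (use sJ in blast)+
    have CkF: "Ck_on (Suc (Suc 0)) (S U \<phi> W \<psi>) (?F j)" for j
      by (rule Ck_on_Suc_imp[OF cc.Ck_pd_C])
    have P': "(P has_real_derivative ?D s') (at s' within {0..1})" if s': "s' \<in> ?J" for s'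
      by (rule has_derivative_openin_cong[OF J s' P_eq], assumption)
        (intro DERIV_sum DERIV_cmult F1[OF s'] CkF)
    have "(?D has_real_derivative (\<Sum>j\<in>UNIV. qt $ j * ?D2 (?F j))) (at s within {0..1})"
      by (intro DERIV_sum DERIV_cmult F2 CkF)
    \<comment> \<open>Second derivatives of the barred first derivatives of the cost vanish along a
      slice geodesic, so \<open>P\<close> is affine.\<close>
    moreover have "?D2 (?F j) = 0" for j
      using cc.geodesic_left_lower[OF in_S[OF sJ] va(3)[OF s U(2)] va(4)[OF s U(2)], of j]
      unfolding cc.M_def .
    ultimately have "(?D has_real_derivative 0) (at s within {0..1})" by simp
    moreover have "\<forall>\<^sub>F s' in at s within {0..1}. (P has_real_derivative ?D s') (at s' within {0..1})"
      by (rule eventually_mono[OF eventually_within_openin[OF J sJ]]) (rule P')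
    ultimately show ?thesis
      using P'[OF sJ] by (intro exI[of _ ?D] exI[of _ "0::real"] conjI refl)
  qed
  have "\<exists>D E. \<forall>s\<in>{0..1}. (P has_real_derivative D s) (at s within {0..1}) \<and>
     (D has_real_derivative E s) (at s within {0..1}) \<and> E s = 0"
    by (rule second_derivative_patch[where R = "\<lambda>s d e. e = 0"], rule P'', assumption)
  then obtain D E where "\<forall>s\<in>{0..1}. (P has_real_derivative D s) (at s within {0..1}) \<and>
     (D has_real_derivative E s) (at s within {0..1}) \<and> E s = 0"
    by (elim exE)
  then have DE: "(P has_real_derivative D s) (at s within {0..1})"
    "(D has_real_derivative 0) (at s within {0..1})" if "s \<in> {0..1}" for s
    using that by metis+
  have "P 1 = P 0" using crit by (simp add: P_def \<gamma>)
  then have "D s = 0" if "s \<in> {0..1}" for s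
    by (rule first_derivative_const[of P D s]) (use DE that in blast)+
  then have P'0: "(P has_real_derivative 0) (at s within {0..1})" if "s \<in> {0..1}" for s
    using DE(1)[OF that] that by metis

  have Q'': "\<exists>D E. (Q has_real_derivative D s) (at s within {0..1}) \<and>
     (\<forall>\<^sub>F s' in at s within {0..1}. (Q has_real_derivative D s') (at s' within {0..1})) \<and>
     (D has_real_derivative E) (at s within {0..1}) \<and> (E \<le> 0 \<and> (s = 0 \<longrightarrow> D s = 0))"
    if s: "s \<in> {0..1}" for s
  proof -
    obtain U \<phi> where U: "(U, \<phi>) \<in> A" "\<gamma> s \<in> N \<inter> (U \<times> W)" "s = 0 \<longrightarrow> U = U\<^sub>0 \<and> \<phi> = \<phi>\<^sub>0"
      using chart[OF s] by (elim exE conjE)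
    interpret cc: cost_in_coordinates "C U \<phi> W \<psi>" "S U \<phi> W \<psi>"
      by (rule coordinates[OF U(1) W])
    obtain v a where *: "\<forall>s\<in>{0..1}. \<gamma> s \<in> N \<inter> (U \<times> W) \<longrightarrow>
       ((\<lambda>s. \<phi> (fst (\<gamma> s)) \<oplus>\<^sub>v \<psi> (xb t)) has_vector_derivative v s) (at s within {0..1}) \<and>
       (v has_vector_derivative a s) (at s within {0..1}) \<and>
       (\<forall>j. v s $ Inr j = 0) \<and>
       (\<forall>m. a s $ m + (\<Sum>j\<in>UNIV. \<Sum>k\<in>UNIV.
         christoffel (cost_metric (C U \<phi> W \<psi>)) m j k (\<phi> (fst (\<gamma> s)) \<oplus>\<^sub>v \<psi> (xb t)) * v s $ j * v s $ k) = 0)"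
      using slice_geodesic_in_chart[OF U(1) W \<gamma>(4,3)] by (elim exE)
    note va = *[rule_format, THEN conjunct1] *[rule_format, THEN conjunct2, THEN conjunct1]
      *[rule_format, THEN conjunct2, THEN conjunct2, THEN conjunct1, rule_format]
      *[rule_format, THEN conjunct2, THEN conjunct2, THEN conjunct2, rule_format]
    let ?u = "\<lambda>s. \<phi> (fst (\<gamma> s)) \<oplus>\<^sub>v \<psi> (xb t)"
    let ?J = "{s \<in> {0..1}. \<gamma> s \<in> N \<inter> (U \<times> W)}"
    let ?F = "\<lambda>j. pd (Inr j) (C U \<phi> W \<psi>)"
    let ?FF = "\<lambda>j l. pd (Inr j) (pd (Inr l) (C U \<phi> W \<psi>))"
    let ?D1 = "\<lambda>F s. \<Sum>i\<in>UNIV. v s $ Inl i * pd (Inl i) F (?u s)"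
    let ?D2 = "\<lambda>F. (\<Sum>i\<in>UNIV. a s $ Inl i * pd (Inl i) F (?u s))
       + (\<Sum>i\<in>UNIV. \<Sum>k\<in>UNIV. v s $ Inl i * v s $ Inl k * pd (Inl i) (pd (Inl k) F) (?u s))"
    let ?D = "\<lambda>s. (\<Sum>j\<in>UNIV. rt $ j * ?D1 (?F j) s) + (\<Sum>j\<in>UNIV. \<Sum>l\<in>UNIV. qt $ j * qt $ l * ?D1 (?FF j l) s)"
    let ?E = "(\<Sum>j\<in>UNIV. rt $ j * ?D2 (?F j)) + (\<Sum>j\<in>UNIV. \<Sum>l\<in>UNIV. qt $ j * qt $ l * ?D2 (?FF j l))"
    have J: "openin (top_of_set {0..1}) ?J"
      by (rule slice_geodesic_times_open[OF \<gamma>(4) openin_K[OF U(1) W]])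
    have J_in: "(fst (\<gamma> s), xb t) \<in> N \<inter> (U \<times> W)" if "s \<in> ?J" for s
      using that \<gamma>_eq(1)[of s] by simp
    have P_eq: "P s = (\<Sum>j\<in>UNIV. qt $ j * ?F j (?u s))" if "s \<in> ?J" for s
      using time_derivatives(2)[OF U(1) t(1) J_in[OF that]] by (simp add: P_def right_first_def qt_def)
    have Q_eq: "Q s = (\<Sum>j\<in>UNIV. rt $ j * ?F j (?u s))
        + (\<Sum>j\<in>UNIV. \<Sum>l\<in>UNIV. qt $ j * qt $ l * ?FF j l (?u s))" if "s \<in> ?J" for s
      using time_derivatives(4)[OF U(1) t(1) J_in[OF that]]
      by (simp add: Q_def right_second_def qt_def rt_def)
    have in_S: "?u s \<in> S U \<phi> W \<psi>" if "s \<in> ?J" for s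
      by (rule coordinate_point_in_S[OF J_in[OF that]])
    have sJ: "s \<in> ?J" using s U(2) by blast
    have F1: "((\<lambda>s. F (?u s)) has_real_derivative ?D1 F s') (at s' within {0..1})"
      if s': "s' \<in> ?J" and F: "Ck_on (Suc (Suc 0)) (S U \<phi> W \<psi>) F" for s' F
      by (rule has_derivative_along_left_curve(1)[where u = ?u and v = v, OF cc.open_S in_S[OF s'] F va(1,3)])
        (use s' in blast)+
    have F2: "(?D1 F has_real_derivative ?D2 F) (at s within {0..1})"
      if F: "Ck_on (Suc (Suc 0)) (S U \<phi> W \<psi>) F" for F
      by (rule has_derivative_along_left_curve(2)[where u = ?u and v = v, OF cc.open_S in_S[OF sJ] F va(1,3,2)])
        (use sJ in blast)+
    have CkF: "Ck_on (Suc (Suc 0)) (S U \<phi> W \<psi>) (?F j)" for j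
      by (rule Ck_on_Suc_imp[OF cc.Ck_pd_C])
    have "(P has_real_derivative (\<Sum>j\<in>UNIV. qt $ j * ?D1 (?F j) s)) (at s within {0..1})"
      by (rule has_derivative_openin_cong[OF J sJ P_eq], assumption)
        (intro DERIV_sum DERIV_cmult F1[OF sJ] CkF)
    \<comment> \<open>The derivative of \<open>P\<close>, known to be zero, is in coordinates the
      pairing of the two velocities by the mixed Hessian, that is, up to sign, the metric on their
      sum.\<close>
    then have "(\<Sum>j\<in>UNIV. qt $ j * ?D1 (?F j) s) = 0"
      by (rule real_derivative_unique_unit_interval[OF _ P'0[OF s] s])
    then have "(\<Sum>j\<in>UNIV. \<Sum>i\<in>UNIV. v s $ Inl i * qt $ j * cc.M i j (?u s)) = 0"
      by (simp add: cc.M_def sum_distrib_left mult_ac)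
    then have "null_vector cc.g (?u s) (left_part (v s) \<oplus>\<^sub>v qt)"
      unfolding cc.null_vector_osum by (subst sum.swap) simp
    from sec_nonneg[OF U(1) W in_S[OF sJ] this]
    have sec: "sec cc.g (?u s) (left_part (v s) \<oplus>\<^sub>v 0) (0 \<oplus>\<^sub>v qt) \<ge> 0" .
    have v_eq: "v s = left_part (v s) \<oplus>\<^sub>v 0"
      by (rule osum_eqI) (simp_all add: va(3)[OF s U(2)])
    have "sec cc.g (?u s) (left_part (v s) \<oplus>\<^sub>v 0) (0 \<oplus>\<^sub>v qt)
        = - (1/2) * (\<Sum>j\<in>UNIV. \<Sum>l\<in>UNIV. qt $ j * qt $ l * ?D2 (?FF j l))"
      using cc.sec_along_geodesic[OF in_S[OF sJ] v_eq va(4)[OF s U(2)], of qt]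
      by (simp only: parts_nth)
    moreover have "?D2 (?F j) = 0" for j
      using cc.geodesic_left_lower[OF in_S[OF sJ] va(3)[OF s U(2)] va(4)[OF s U(2)], of j]
      unfolding cc.M_def .
    \<comment> \<open>The terms with \<open>rt\<close> drop out by the geodesic equation of the
      slice; what is left is \<open>-2\<close> times the curvature.\<close>
    ultimately have E: "?E \<le> 0"
      using sec by simp
    have Q': "(Q has_real_derivative ?D s') (at s' within {0..1})" if s': "s' \<in> ?J" for s'
      by (rule has_derivative_openin_cong[OF J s' Q_eq], assumption)
        (intro DERIV_add DERIV_sum DERIV_cmult F1[OF s'] CkF cc.Ck_pd2_C)
    have D': "(?D has_real_derivative ?E) (at s within {0..1})"
      by (intro DERIV_add DERIV_sum DERIV_cmult F2 CkF cc.Ck_pd2_C)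
    \<comment> \<open>After exchanging the sums, each component of the slice velocity multiplies an
      instance of the geodesic equation of \<open>xb\<close> over \<open>x\<close>.\<close>
    have D0: "?D s = 0" if "s = 0"
    proof -
      have U0: "U = U\<^sub>0" "\<phi> = \<phi>\<^sub>0" "\<gamma> s = (x, xb t)" using U(3) that \<gamma>(1) by auto
      have "?D s = (\<Sum>i\<in>UNIV. v s $ Inl i * ((\<Sum>j\<in>UNIV. rt $ j * pd (Inl i) (?F j) (?u s))
          + (\<Sum>j\<in>UNIV. \<Sum>l\<in>UNIV. qt $ j * qt $ l * pd (Inl i) (?FF j l) (?u s))))"
        by (simp only: sum_mult_swap[of "($) rt"] sum_mult_swap2[of "\<lambda>j l. qt $ j * qt $ l"] distrib_left sum.distrib)
      also have "\<dots> = 0"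
        using geodesic_x[OF t] unfolding U0 qt_def rt_def by simp
      finally show ?thesis .
    qed
    have "\<forall>\<^sub>F s' in at s within {0..1}. (Q has_real_derivative ?D s') (at s' within {0..1})"
      by (rule eventually_mono[OF eventually_within_openin[OF J sJ]]) (rule Q')
    then show ?thesis
      using Q'[OF sJ] D' E D0
      by (intro exI[of _ ?D] exI[of _ ?E] conjI impI)
  qed
  have "\<exists>D E. \<forall>s\<in>{0..1}. (Q has_real_derivative D s) (at s within {0..1}) \<and>
     (D has_real_derivative E s) (at s within {0..1}) \<and> (E s \<le> 0 \<and> (s = 0 \<longrightarrow> D s = 0))"
    by (rule second_derivative_patch[where R = "\<lambda>s d e. e \<le> 0 \<and> (s = 0 \<longrightarrow> d = 0)"], rule Q'', assumption)
  then obtain D E where "\<forall>s\<in>{0..1}. (Q has_real_derivative D s) (at s within {0..1}) \<and>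
     (D has_real_derivative E s) (at s within {0..1}) \<and> (E s \<le> 0 \<and> (s = 0 \<longrightarrow> D s = 0))"
    by (elim exE)
  then have DE: "(Q has_real_derivative D s) (at s within {0..1})"
    "(D has_real_derivative E s) (at s within {0..1})" "E s \<le> 0" "s = 0 \<Longrightarrow> D s = 0"
    if "s \<in> {0..1}" for s
    using that by blast+
  have "Q 1 \<le> Q 0"
    by (rule nonincreasing_of_second_derivative_nonpos[of Q D E]) (use DE in auto)
  then show ?thesis by (simp add: Q_def \<gamma>)
qed

end

section \<open>The maximum principle\<close>

context moving_chart
begin

text \<open>Uniqueness of the constant geodesic without an existence and uniqueness theorem: the
  time derivative of \<open>pd (Inl i) C\<close> over \<open>x\<close> is constant, so it vanishes
  near \<open>b\<close> once it vanishes at \<open>b\<close>. An invertible Hessian then leaves only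
  \<open>q t = 0\<close>.\<close>

lemma velocity_zero_locally:
  assumes b: "\<And>t. \<bar>t - b\<bar> < d \<Longrightarrow> t \<in> {0<..<1} \<and> xb t \<in> W" and zero: "q b = 0" and t: "\<bar>t - b\<bar> < d"
  shows "q t = 0"
proof -
  interpret cx: cost_in_coordinates "C U\<^sub>0 \<phi>\<^sub>0 W \<psi>" "S U\<^sub>0 \<phi>\<^sub>0 W \<psi>"
    by (rule coordinates[OF U\<^sub>0 W])
  let ?u = "\<lambda>t. \<phi>\<^sub>0 x \<oplus>\<^sub>v \<psi> (xb t)"
  let ?l = "\<lambda>i t. \<Sum>j\<in>UNIV. q t $ j * cx.M i j (?u t)"
  have in_S: "?u s \<in> S U\<^sub>0 \<phi>\<^sub>0 W \<psi>" if "\<bar>s - b\<bar> < d" for s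
    by (rule coordinate_point_in_S) (use b[OF that] continuous_map_x_xb(2)[of s] x_in_U\<^sub>0 in simp)
  have l0: "(?l i has_real_derivative 0) (at s within ball b d)" if "s \<in> ball b d" for s i
  proof -
    have s: "\<bar>s - b\<bar> < d" using that by (simp add: dist_real_def abs_minus_commute)
    note sW = b[OF s, THEN conjunct1] b[OF s, THEN conjunct2]
    have u: "(?u has_vector_derivative 0 \<oplus>\<^sub>v q s) (at s)"
      by (intro has_vector_derivative_osum has_vector_derivative_const velocity sW)
    have "((\<lambda>s. cx.M i j (?u s)) has_real_derivative
        (\<Sum>l\<in>UNIV. q s $ l * pd (Inl i) (pd (Inr l) (pd (Inr j) (C U\<^sub>0 \<phi>\<^sub>0 W \<psi>))) (?u s))) (at s)" for j
      using has_derivative_along_curve[OF cx.open_S in_S[OF s] cx.Ck_M u]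
      by (simp add: sum_UNIV_Plus cx.pd_M_right[OF in_S[OF s]])
    then have "(?l i has_real_derivative (\<Sum>j\<in>UNIV. r s $ j * cx.M i j (?u s)
        + (\<Sum>l\<in>UNIV. q s $ l * pd (Inl i) (pd (Inr l) (pd (Inr j) (C U\<^sub>0 \<phi>\<^sub>0 W \<psi>))) (?u s)) * q s $ j)) (at s)"
      by (intro DERIV_sum DERIV_mult has_vector_derivative_vec_nth acceleration sW)
    moreover have "(\<Sum>j\<in>UNIV. r s $ j * cx.M i j (?u s)
        + (\<Sum>l\<in>UNIV. q s $ l * pd (Inl i) (pd (Inr l) (pd (Inr j) (C U\<^sub>0 \<phi>\<^sub>0 W \<psi>))) (?u s)) * q s $ j) = 0"
    proof -
      have "(\<Sum>j\<in>UNIV. \<Sum>l\<in>UNIV. q s $ l * pd (Inl i) (pd (Inr l) (pd (Inr j) (C U\<^sub>0 \<phi>\<^sub>0 W \<psi>))) (?u s) * q s $ j)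
          = (\<Sum>l\<in>UNIV. \<Sum>j\<in>UNIV. q s $ l * q s $ j * pd (Inl i) (pd (Inr l) (pd (Inr j) (C U\<^sub>0 \<phi>\<^sub>0 W \<psi>))) (?u s))"
        by (subst sum.swap) (intro sum.cong refl, simp)
      then show ?thesis
        using geodesic_x[OF sW, of i] by (simp add: sum.distrib sum_distrib_right cx.M_def)
    qed
    ultimately show ?thesis by (simp add: has_field_derivative_at_within)
  qed
  have "?l i t = ?l i b" for i
  proof -
    have "\<exists>k. \<forall>s\<in>ball b d. ?l i s = k"
      by (rule has_field_derivative_zero_constant[OF convex_ball l0])
    then obtain k where k: "\<forall>s\<in>ball b d. ?l i s = k" by (elim exE)
    have "t \<in> ball b d" "b \<in> ball b d"
      using t by (auto simp: dist_real_def abs_minus_commute)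
    from k[rule_format, OF this(1)] k[rule_format, OF this(2)] show ?thesis
      by (rule trans[OF _ sym])
  qed
  then have "mixed_hessian (C U\<^sub>0 \<phi>\<^sub>0 W \<psi>) (?u t) *v q t = 0"
    by (simp add: vec_eq_iff matrix_vector_mult_def cx.mixed_hessian_nth zero mult.commute)
  then show ?thesis
    using cx.invertible_hessian[OF in_S[OF t]]
    by (metis invertible_left_inverse matrix_left_invertible_ker)
qed

text \<open>A geodesic is only required to have an acceleration. Continuity of \<open>r\<close> is
  recovered by solving the lowered geodesic equation for it, with coefficients that are continuous
  in time.\<close>

lemma continuous_on_velocity:
  assumes "\<And>t. t \<in> T \<Longrightarrow> t \<in> {0<..<1} \<and> xb t \<in> W"
  shows "continuous_on T (\<lambda>t. \<psi> (xb t))" "continuous_on T q" "continuous_on T r"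
proof -
  interpret cx: cost_in_coordinates "C U\<^sub>0 \<phi>\<^sub>0 W \<psi>" "S U\<^sub>0 \<phi>\<^sub>0 W \<psi>"
    by (rule coordinates[OF U\<^sub>0 W])
  let ?u = "\<lambda>t. \<phi>\<^sub>0 x \<oplus>\<^sub>v \<psi> (xb t)"
  have in_S: "?u t \<in> S U\<^sub>0 \<phi>\<^sub>0 W \<psi>" if "t \<in> T" for t
    by (rule coordinate_point_in_S) (use assms[OF that] continuous_map_x_xb(2)[of t] x_in_U\<^sub>0 in simp)
  show w: "continuous_on T (\<lambda>t. \<psi> (xb t))"
    by (intro continuous_at_imp_continuous_on ballI has_vector_derivative_continuous[OF velocity])
      (use assms in blast)+
  show q: "continuous_on T q"
    by (intro continuous_at_imp_continuous_on ballI has_vector_derivative_continuous[OF acceleration])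
      (use assms in blast)+
  have qc: "continuous_on T (\<lambda>t. q t $ j)" for j
    by (rule continuous_on_component[OF q])
  have u: "continuous_on T ?u"
    by (intro continuous_on_osum continuous_on_const w)
  have comp: "continuous_on T (\<lambda>t. F (?u t))" if "continuous_on (S U\<^sub>0 \<phi>\<^sub>0 W \<psi>) F" for F :: "_ \<Rightarrow> real"
    by (rule continuous_on_compose2[OF that u]) (use in_S in blast)
  let ?b = "\<lambda>t. \<chi> i. - (\<Sum>j\<in>UNIV. \<Sum>l\<in>UNIV. q t $ j * q t $ l *
          pd (Inl i) (pd (Inr j) (pd (Inr l) (C U\<^sub>0 \<phi>\<^sub>0 W \<psi>))) (?u t))"
  have "continuous_on T (\<lambda>t. r t $ j)" for j
  proof (rule continuous_on_linear_solution[where M = "\<lambda>t. mixed_hessian (C U\<^sub>0 \<phi>\<^sub>0 W \<psi>) (?u t)" and b = ?b])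
    show "invertible (mixed_hessian (C U\<^sub>0 \<phi>\<^sub>0 W \<psi>) (?u t))" if "t \<in> T" for t
      by (rule cx.invertible_hessian[OF in_S[OF that]])
    show "mixed_hessian (C U\<^sub>0 \<phi>\<^sub>0 W \<psi>) (?u t) *v r t = ?b t" if "t \<in> T" for t
      using geodesic_x[of t] assms[OF that]
      by (simp add: vec_eq_iff matrix_vector_mult_def cx.mixed_hessian_nth cx.M_def mult.commute[of _ "r _ $ _"]
          add_eq_0_iff)
    show "continuous_on T (\<lambda>t. mixed_hessian (C U\<^sub>0 \<phi>\<^sub>0 W \<psi>) (?u t) $ i $ j)" for i j
      unfolding cx.mixed_hessian_nth by (rule comp[OF Ck_on_imp_continuous[OF cx.Ck_M]])
    show "continuous_on T (\<lambda>t. ?b t $ i)" for i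
      unfolding vec_lambda_beta
      by (intro continuous_intros qc comp Ck_on_imp_continuous[OF Ck_on_pd[OF cx.Ck_pd2_C]])
  qed
  then have "continuous_on T (\<lambda>t. \<chi> j. r t $ j)"
    by (rule continuous_on_vec_lambda)
  then show "continuous_on T r" by simp
qed

text \<open>The bound comes from moving \<open>y\<close> to a nearby point at which the first time derivative vanishes,
  where \<open>illuminated_second_derivative_le\<close> applies.\<close>

lemma second_derivative_bound:
  assumes b: "b \<in> {0<..<1}" "xb b \<in> W" and \<delta>: "\<delta> > 0" and V: "openin X V" "y \<in> V"
    and lit: "\<And>t z. \<bar>t - b\<bar> < \<delta> \<Longrightarrow> z \<in> V \<Longrightarrow> t \<in> {0<..<1} \<and> z \<in> illuminated X A Y B N c x (xb t)"
    and crit: "deriv (\<kappa> y) b = deriv (\<kappa> x) b"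
  shows "\<exists>d>0. \<exists>k. \<forall>t. \<bar>t - b\<bar> < d \<longrightarrow> deriv (deriv (\<kappa> x)) t - deriv (deriv (\<kappa> y)) t
     \<ge> - k * \<bar>deriv (\<kappa> x) t - deriv (\<kappa> y) t\<bar>"
proof -
  have "y \<in> topspace X" using openin_subset[OF V(1)] V(2) by blast
  then obtain U \<phi> where U: "(U, \<phi>) \<in> A" "y \<in> U"
    by (rule smooth_manifold_cover[OF X])
  interpret cy: cost_in_coordinates "C U \<phi> W \<psi>" "S U \<phi> W \<psi>"
    by (rule coordinates[OF U(1) W])
  have xb_N: "(x, xb b) \<in> N \<inter> (U\<^sub>0 \<times> W)"
    using continuous_map_x_xb(2)[OF b(1)] x_in_U\<^sub>0 b(2) by simp
  have "b \<in> {t \<in> {0<..<1}. (x, xb t) \<in> N \<inter> (U\<^sub>0 \<times> W)}" using b(1) xb_N by blast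
  with times_open[OF U\<^sub>0 xb_N] obtain \<delta>' where \<delta>': "\<delta>' > 0"
    "ball b \<delta>' \<subseteq> {t \<in> {0<..<1}. (x, xb t) \<in> N \<inter> (U\<^sub>0 \<times> W)}"
    unfolding open_contains_ball by meson
  define \<delta>1 where "\<delta>1 = min \<delta> \<delta>'"
  have \<delta>1: "\<delta>1 > 0" "\<delta>1 \<le> \<delta>" using \<delta> \<delta>'(1) by (auto simp: \<delta>1_def)
  have near: "t \<in> {0<..<1} \<and> (x, xb t) \<in> N \<inter> (U\<^sub>0 \<times> W)" if "\<bar>t - b\<bar> < \<delta>1" for t
    using subsetD[OF \<delta>'(2), of t] that by (simp add: dist_real_def \<delta>1_def abs_minus_commute)
  then have nearW: "t \<in> {0<..<1} \<and> xb t \<in> W" if "\<bar>t - b\<bar> < \<delta>1" for t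
    using that by simp
  have z_in: "(z, xb t) \<in> N \<inter> (U \<times> W)" if "\<bar>t - b\<bar> < \<delta>1" "z \<in> U" "z \<in> V" for t z
  proof -
    have "z \<in> illuminated X A Y B N c x (xb t)" using lit[of t z] that \<delta>1 by simp
    then have "(z, xb t) \<in> N" by (simp add: illuminated_def slice_def)
    then show ?thesis using that(2) nearW[OF that(1)] by simp
  qed
  define f1 where "f1 t = deriv (\<kappa> x) t - deriv (\<kappa> y) t" for t
  define f2 where "f2 t = deriv (deriv (\<kappa> x)) t - deriv (deriv (\<kappa> y)) t" for t
  have f12: "(f1 has_real_derivative f2 t) (at t)" if t: "\<bar>t - b\<bar> < \<delta>1" for t
    unfolding f1_def f2_def
    by (intro DERIV_diff time_derivatives(3)[OF U\<^sub>0] time_derivatives(3)[OF U(1)] z_in[OF t] U V)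
      (use near[OF t] in blast)+
  have "\<exists>d>0. \<exists>k. \<forall>t. \<bar>t - b\<bar> < d \<longrightarrow> f2 t \<ge> - k * \<bar>f1 t\<bar>"
  proof (cases "q b = 0")
    case True
    \<comment> \<open>When the velocity vanishes at \<open>b\<close>, moving \<open>y\<close> does
      not change the first derivative, so no zero can be produced; but then \<open>xb\<close> is
      stationary near \<open>b\<close> and the bound is trivial.\<close>
    have f1_0: "f1 t = 0" if t: "\<bar>t - b\<bar> < \<delta>1" for t
    proof -
      have "q t = 0" by (rule velocity_zero_locally[OF nearW True t])
      then show ?thesis
        using time_derivatives(2)[OF U\<^sub>0, of t x] time_derivatives(2)[OF U(1) _ z_in[OF t U(2) V(2)]] near[OF t]
        by (simp add: f1_def right_first_def)
    qed
    have "f2 t = 0" if t: "\<bar>t - b\<bar> < \<delta>1" for t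
    proof -
      have "((\<lambda>t. 0) has_real_derivative f2 t) (at t)"
      proof (rule has_field_derivative_transform_within_open[OF f12[OF t]])
        show "t \<in> ball b \<delta>1" using t by (simp add: dist_real_def abs_minus_commute)
      qed (auto simp: dist_real_def abs_minus_commute f1_0)
      then show ?thesis using DERIV_unique[OF _ DERIV_const] by blast
    qed
    then show ?thesis using \<delta>1(1) by (intro exI[of _ \<delta>1] conjI exI[of _ 0]) auto
  next
    case False
    define O' where "O' = \<phi> ` (U \<inter> V)"
    have O': "open O'"
      unfolding O'_def
      by (rule chart_image_open[OF X U(1)]) (use smooth_manifold_chart(1)[OF X U(1)] V in auto)
    have "\<phi> y \<in> O'" using U V by (auto simp: O'_def)
    \<comment> \<open>The coordinate gradient at \<open>y\<close> of the first derivative of the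
      difference at time \<open>b\<close>. Moving \<open>y\<close> along it makes
      \<open>H1 b 0\<close> the squared norm of \<open>e\<close>, and \<open>e\<close> is nonzero
      because the Hessian is invertible and \<open>q b\<close> is not zero.\<close>
    define e where "e = (\<chi> i. - (\<Sum>j\<in>UNIV. q b $ j * cy.M i j (\<phi> y \<oplus>\<^sub>v \<psi> (xb b))))"
    have "\<phi> y \<oplus>\<^sub>v \<psi> (xb b) \<in> S U \<phi> W \<psi>"
      by (rule coordinate_point_in_S[OF z_in]) (use U V \<delta>1 in simp_all)
    have e: "e \<noteq> 0"
    proof
      assume "e = 0"
      then have "mixed_hessian (C U \<phi> W \<psi>) (\<phi> y \<oplus>\<^sub>v \<psi> (xb b)) *v q b = 0"
        by (simp add: e_def vec_eq_iff matrix_vector_mult_def cy.mixed_hessian_nth mult.commute)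
      then show False
        using cy.invertible_hessian[OF \<open>\<phi> y \<oplus>\<^sub>v \<psi> (xb b) \<in> S U \<phi> W \<psi>\<close>] False
        by (metis invertible_left_inverse matrix_left_invertible_ker)
    qed
    define L where "L = {l. \<phi> y + l *\<^sub>R e \<in> O'}"
    have L: "open L"
      using open_vimage[OF O', of "\<lambda>l. \<phi> y + l *\<^sub>R e"]
      by (simp add: L_def vimage_def continuous_intros)
    have "0 \<in> L" using \<open>\<phi> y \<in> O'\<close> by (simp add: L_def)
    with L obtain d2 where d2: "d2 > 0" "ball 0 d2 \<subseteq> L"
      unfolding open_contains_ball by blast
    define d where "d = min (\<delta>1 / 2) (d2 / 2)"
    have d: "d > 0" using \<delta>1 d2 by (simp add: d_def)
    have dt: "\<bar>t - b\<bar> < \<delta>1" if "t \<in> {b - d..b + d}" for t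
      using that d \<delta>1(1) by (auto simp: d_def abs_less_iff min_def split: if_splits)
    have dl: "l \<in> L" if "l \<in> {- d..d}" for l
      using subsetD[OF d2(2), of l] that d2(1) by (auto simp: d_def min_def split: if_splits)
    \<comment> \<open>The straight segment in direction \<open>e\<close> through
      \<open>\<phi> y\<close>, pulled back to the manifold.\<close>
    define yl where "yl l = inv_into U \<phi> (\<phi> y + l *\<^sub>R e)" for l
    have yl: "yl l \<in> U" "yl l \<in> V" "\<phi> (yl l) = \<phi> y + l *\<^sub>R e" if l: "l \<in> L" for l
    proof -
      obtain z where z: "z \<in> U" "z \<in> V" "\<phi> y + l *\<^sub>R e = \<phi> z"
        using l by (auto simp: L_def O'_def)
      then have "yl l = z"
        unfolding yl_def z(3) by (intro inv_into_f_f chart_inj_on[OF X U(1)])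
      then show "yl l \<in> U" "yl l \<in> V" "\<phi> (yl l) = \<phi> y + l *\<^sub>R e" using z by simp_all
    qed
    have yl0: "yl 0 = y"
      unfolding yl_def using inv_into_f_f[OF chart_inj_on[OF X U(1)] U(2)] by simp
    let ?u = "\<lambda>t l. (\<phi> y + l *\<^sub>R e) \<oplus>\<^sub>v \<psi> (xb t)"
    have in_S: "?u t l \<in> S U \<phi> W \<psi>" if "\<bar>t - b\<bar> < \<delta>1" "l \<in> L" for t l
      using coordinate_point_in_S[OF z_in[OF that(1) yl(1,2)[OF that(2)]], of \<phi>]
      unfolding yl(3)[OF that(2)] .
    define G1 where "G1 t l = deriv (\<kappa> x) t - deriv (\<kappa> (yl l)) t" for t l
    define G2 where "G2 t l = deriv (deriv (\<kappa> x)) t - deriv (deriv (\<kappa> (yl l))) t" for t l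
    let ?d = "\<lambda>F t l. \<Sum>i\<in>UNIV. e $ i * pd (Inl i) F (?u t l)"
    let ?F = "\<lambda>j. pd (Inr j) (C U \<phi> W \<psi>)"
    let ?FF = "\<lambda>j l. pd (Inr j) (pd (Inr l) (C U \<phi> W \<psi>))"
    define H1 where "H1 t l = - (\<Sum>j\<in>UNIV. q t $ j * ?d (?F j) t l)" for t l
    define H2 where "H2 t l = - ((\<Sum>j\<in>UNIV. r t $ j * ?d (?F j) t l)
        + (\<Sum>j\<in>UNIV. \<Sum>k\<in>UNIV. q t $ j * q t $ k * ?d (?FF j k) t l))" for t l
    have dF: "((\<lambda>l. F (?u t l)) has_real_derivative ?d F t l) (at l)"
      if tl: "\<bar>t - b\<bar> < \<delta>1" "l \<in> L" and F: "Ck_on (Suc (Suc 0)) (S U \<phi> W \<psi>) F" for F t l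
    proof -
      have "((\<lambda>l. \<phi> y + l *\<^sub>R e) has_vector_derivative e) (at l)"
        by (auto intro!: derivative_eq_intros)
      then have u: "(?u t has_vector_derivative e \<oplus>\<^sub>v 0) (at l)"
        by (intro has_vector_derivative_osum has_vector_derivative_const)
      show ?thesis
        using has_derivative_along_curve[where u = "?u t", OF cy.open_S in_S[OF tl] F u]
        by (simp add: sum_UNIV_Plus)
    qed
    have CkF: "Ck_on (Suc (Suc 0)) (S U \<phi> W \<psi>) (?F j)" for j
      by (rule Ck_on_Suc_imp[OF cy.Ck_pd_C])
    have G1: "(G1 t has_real_derivative H1 t l) (at l)" if tl: "\<bar>t - b\<bar> < \<delta>1" "l \<in> L" for t l
    proof (rule has_field_derivative_transform_within_open[OF _ L tl(2)])
      have "((\<lambda>l. deriv (\<kappa> x) t - right_first (C U \<phi> W \<psi>) (q t) (?u t l)) has_real_derivative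
          0 - (\<Sum>j\<in>UNIV. q t $ j * ?d (?F j) t l)) (at l)"
        unfolding right_first_def by (intro DERIV_diff DERIV_const DERIV_sum DERIV_cmult dF tl CkF)
      then show "((\<lambda>l. deriv (\<kappa> x) t - right_first (C U \<phi> W \<psi>) (q t) (?u t l)) has_real_derivative H1 t l) (at l)"
        by (simp add: H1_def)
      show "deriv (\<kappa> x) t - right_first (C U \<phi> W \<psi>) (q t) (?u t l) = G1 t l" if l: "l \<in> L" for l
        using time_derivatives(2)[OF U(1) _ z_in[OF tl(1) yl(1,2)[OF l]]] near[OF tl(1)]
        by (simp add: G1_def yl(3)[OF l])
    qed
    have G2: "(G2 t has_real_derivative H2 t l) (at l)" if tl: "\<bar>t - b\<bar> < \<delta>1" "l \<in> L" for t l
    proof (rule has_field_derivative_transform_within_open[OF _ L tl(2)])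
      have "((\<lambda>l. deriv (deriv (\<kappa> x)) t - right_second (C U \<phi> W \<psi>) (q t) (r t) (?u t l)) has_real_derivative
          0 - ((\<Sum>j\<in>UNIV. r t $ j * ?d (?F j) t l)
          + (\<Sum>j\<in>UNIV. \<Sum>k\<in>UNIV. q t $ j * q t $ k * ?d (?FF j k) t l))) (at l)"
        unfolding right_second_def
        by (intro DERIV_diff DERIV_add DERIV_const DERIV_sum DERIV_cmult dF tl CkF cy.Ck_pd2_C)
      then show "((\<lambda>l. deriv (deriv (\<kappa> x)) t - right_second (C U \<phi> W \<psi>) (q t) (r t) (?u t l))
          has_real_derivative H2 t l) (at l)"
        by (simp add: H2_def)
      show "deriv (deriv (\<kappa> x)) t - right_second (C U \<phi> W \<psi>) (q t) (r t) (?u t l) = G2 t l" if l: "l \<in> L" for l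
        using time_derivatives(4)[OF U(1) _ z_in[OF tl(1) yl(1,2)[OF l]]] near[OF tl(1)]
        by (simp add: G2_def yl(3)[OF l])
    qed
    let ?T = "{b - d..b + d}"
    let ?R = "?T \<times> {- d..d}"
    have T: "t \<in> {0<..<1} \<and> xb t \<in> W" if "t \<in> ?T" for t
      by (rule nearW[OF dt[OF that]])
    have cont_fst: "continuous_on ?R (\<lambda>p. F (fst p))" if "continuous_on ?T F" for F :: "real \<Rightarrow> 'z::topological_space"
      by (rule continuous_on_compose2[OF that continuous_on_fst[OF continuous_on_id]]) auto
    have "continuous_on ?R (\<lambda>p. ?u (fst p) (snd p))"
      by (intro continuous_on_osum continuous_intros cont_fst continuous_on_velocity(1) T)
    then have contF: "continuous_on ?R (\<lambda>p. F (?u (fst p) (snd p)))" if "continuous_on (S U \<phi> W \<psi>) F"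
      for F :: "_ \<Rightarrow> real"
      by (rule continuous_on_compose2[OF that]) (use in_S dt dl in auto)
    have contH1: "continuous_on ?R (\<lambda>p. H1 (fst p) (snd p))"
      unfolding H1_def
      by (intro continuous_intros contF cont_fst continuous_on_velocity(2) T
          Ck_on_imp_continuous[OF Ck_on_pd[OF CkF]])
    have contH2: "continuous_on ?R (\<lambda>p. H2 (fst p) (snd p))"
      unfolding H2_def
      by (intro continuous_intros contF cont_fst continuous_on_velocity(2,3) T
          Ck_on_imp_continuous[OF Ck_on_pd[OF CkF]] Ck_on_imp_continuous[OF Ck_on_pd[OF cy.Ck_pd2_C]])
    have "H1 b 0 = (\<Sum>i\<in>UNIV. e $ i * - (\<Sum>j\<in>UNIV. q b $ j * cy.M i j (\<phi> y \<oplus>\<^sub>v \<psi> (xb b))))"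
      unfolding H1_def sum_mult_swap[of "($) (q b)"] by (simp add: sum_negf cy.M_def)
    also have "\<dots> = (\<Sum>i\<in>UNIV. e $ i * e $ i)"
      by (simp add: e_def)
    also have "\<dots> > 0"
    proof -
      have "e \<bullet> e > 0" using e by simp
      then show ?thesis by (simp add: inner_vec_def)
    qed
    finally have H1_pos: "H1 b 0 > 0" .
    have G10: "G1 t 0 = f1 t" "G2 t 0 = f2 t" for t
      by (simp_all add: G1_def G2_def f1_def f2_def yl0)
    have "\<exists>d'>0. \<exists>k. \<forall>t. \<bar>t - b\<bar> < d' \<longrightarrow> G2 t 0 \<ge> - k * \<bar>G1 t 0\<bar>"
    proof (rule perturbed_second_derivative_bound[OF d contH1[folded case_prod_beta'] contH2[folded case_prod_beta']])
      show "(G1 t has_real_derivative H1 t l) (at l)" "(G2 t has_real_derivative H2 t l) (at l)"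
        if "t \<in> ?T" "l \<in> {- d..d}" for t l
        using G1 G2 dt dl that by blast+
      show "G1 b 0 = 0" using crit by (simp add: G10 f1_def)
      show "H1 b 0 > 0" by (rule H1_pos)
      show "isCont (\<lambda>t. G1 t 0) b"
        unfolding G10 by (rule DERIV_isCont[OF f12]) (use \<delta>1 in simp)
      \<comment> \<open>All the displaced points lie in \<open>V\<close>, so they are illuminated at
        every time near \<open>b\<close>, not only at \<open>b\<close> itself.\<close>
      show "G2 t l \<ge> 0" if tl: "t \<in> ?T" "l \<in> {- d..d}" and "G1 t l = 0" for t l
      proof -
        have "yl l \<in> illuminated X A Y B N c x (xb t)"
          using lit[of t "yl l"] dt[OF tl(1)] \<delta>1 yl(2)[OF dl[OF tl(2)]] by simp
        from illuminated_second_derivative_le[OF _ _ this] show ?thesis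
          using T[OF tl(1)] that(3) by (simp add: G1_def G2_def)
      qed
    qed
    then show ?thesis unfolding G10 .
  qed
  then show ?thesis unfolding f1_def f2_def .
qed

end

text \<open>All charts are chosen here, around \<open>x\<close>, \<open>y\<close> and
  \<open>xb b\<close>, and none occurs in the conclusions. Results at different times can therefore
  be combined although \<open>xb\<close> may leave any single chart.\<close>

lemma (in cost_setting) mountain_derivatives:
  assumes b: "b \<in> {0<..<1}" and \<delta>: "\<delta> > 0" and V: "openin X V" "y \<in> V"
    and lit: "\<And>t z. \<bar>t - b\<bar> < \<delta> \<Longrightarrow> z \<in> V \<Longrightarrow> t \<in> {0<..<1} \<and> z \<in> illuminated X A Y B N c x (xb t)"
  shows "(\<kappa> x has_real_derivative deriv (\<kappa> x) b) (at b)" "(\<kappa> y has_real_derivative deriv (\<kappa> y) b) (at b)"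
    "(deriv (\<kappa> x) has_real_derivative deriv (deriv (\<kappa> x)) b) (at b)"
    "(deriv (\<kappa> y) has_real_derivative deriv (deriv (\<kappa> y)) b) (at b)"
    "deriv (\<kappa> y) b = deriv (\<kappa> x) b \<Longrightarrow>
      \<exists>d>0. \<exists>k. \<forall>t. \<bar>t - b\<bar> < d \<longrightarrow> deriv (deriv (\<kappa> x)) t - deriv (deriv (\<kappa> y)) t
     \<ge> - k * \<bar>deriv (\<kappa> x) t - deriv (\<kappa> y) t\<bar>"
proof -
  obtain U\<^sub>0 \<phi>\<^sub>0 where U\<^sub>0: "(U\<^sub>0, \<phi>\<^sub>0) \<in> A" "x \<in> U\<^sub>0"
    by (rule smooth_manifold_cover[OF X x_in_topspace])
  have "y \<in> topspace X" using openin_subset[OF V(1)] V(2) by blast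
  then obtain U \<phi> where U: "(U, \<phi>) \<in> A" "y \<in> U"
    by (rule smooth_manifold_cover[OF X])
  have "xb b \<in> topspace Y"
    using continuous_map_x_xb(2)[OF b] N_subset by auto
  then obtain W \<psi> where W: "(W, \<psi>) \<in> B" "xb b \<in> W"
    by (rule smooth_manifold_cover[OF Y])
  obtain q r where qr: "\<forall>t\<in>{0<..<1}. xb t \<in> W \<longrightarrow>
     ((\<lambda>s. \<psi> (xb s)) has_vector_derivative q t) (at t) \<and> (q has_vector_derivative r t) (at t) \<and>
     (\<forall>i. (\<Sum>j\<in>UNIV. r t $ j * pd (Inl i) (pd (Inr j) (C U\<^sub>0 \<phi>\<^sub>0 W \<psi>)) (\<phi>\<^sub>0 x \<oplus>\<^sub>v \<psi> (xb t)))
       + (\<Sum>j\<in>UNIV. \<Sum>l\<in>UNIV. q t $ j * q t $ l *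
          pd (Inl i) (pd (Inr j) (pd (Inr l) (C U\<^sub>0 \<phi>\<^sub>0 W \<psi>))) (\<phi>\<^sub>0 x \<oplus>\<^sub>v \<psi> (xb t))) = 0)"
    using velocity_exists[OF U\<^sub>0 W(1)] by (elim exE)
  interpret moving_chart X A Y B c N x xb U\<^sub>0 \<phi>\<^sub>0 W \<psi> q r
  proof
    show "(U\<^sub>0, \<phi>\<^sub>0) \<in> A" "x \<in> U\<^sub>0" "(W, \<psi>) \<in> B" by fact+
    fix t :: real and i assume t: "t \<in> {0<..<1}" "xb t \<in> W"
    note * = qr[rule_format, OF t]
    show "((\<lambda>s. \<psi> (xb s)) has_vector_derivative q t) (at t)" by (rule *[THEN conjunct1])
    show "(q has_vector_derivative r t) (at t)" by (rule *[THEN conjunct2, THEN conjunct1])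
    show "(\<Sum>j\<in>UNIV. r t $ j * pd (Inl i) (pd (Inr j) (C U\<^sub>0 \<phi>\<^sub>0 W \<psi>)) (\<phi>\<^sub>0 x \<oplus>\<^sub>v \<psi> (xb t)))
       + (\<Sum>j\<in>UNIV. \<Sum>l\<in>UNIV. q t $ j * q t $ l *
          pd (Inl i) (pd (Inr j) (pd (Inr l) (C U\<^sub>0 \<phi>\<^sub>0 W \<psi>))) (\<phi>\<^sub>0 x \<oplus>\<^sub>v \<psi> (xb t))) = 0"
      by (rule *[THEN conjunct2, THEN conjunct2, THEN spec])
  qed
  have xN: "(x, xb b) \<in> N \<inter> (U\<^sub>0 \<times> W)"
    using continuous_map_x_xb(2)[OF b] x_in_U\<^sub>0 \<open>xb b \<in> W\<close> by simp
  have "y \<in> illuminated X A Y B N c x (xb b)" using lit[of b y] \<delta> V by simp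
  then have yN: "(y, xb b) \<in> N \<inter> (U \<times> W)"
    using U(2) \<open>xb b \<in> W\<close> by (simp add: illuminated_def slice_def)
  show "(\<kappa> x has_real_derivative deriv (\<kappa> x) b) (at b)" "(deriv (\<kappa> x) has_real_derivative deriv (deriv (\<kappa> x)) b) (at b)"
    by (rule time_derivatives[OF U\<^sub>0 b xN])+
  show "(\<kappa> y has_real_derivative deriv (\<kappa> y) b) (at b)" "(deriv (\<kappa> y) has_real_derivative deriv (deriv (\<kappa> y)) b) (at b)"
    by (rule time_derivatives[OF U(1) b yN])+
  show "\<exists>d>0. \<exists>k. \<forall>t. \<bar>t - b\<bar> < d \<longrightarrow> deriv (deriv (\<kappa> x)) t - deriv (deriv (\<kappa> y)) t
     \<ge> - k * \<bar>deriv (\<kappa> x) t - deriv (\<kappa> y) t\<bar>" if "deriv (\<kappa> y) b = deriv (\<kappa> x) b"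
    by (rule second_derivative_bound[OF b \<open>xb b \<in> W\<close> \<delta> V lit that])
qed

theorem theorem4p10:
  fixes X :: "'a::{metric_space, second_countable_topology} topology"
    and Y :: "'b::{metric_space, second_countable_topology} topology"
    and A :: "('a, 'n::finite) chart set"
    and B :: "('b, 'n) chart set"
    and c :: "'a \<times> 'b \<Rightarrow> ereal"
    and N :: "('a \<times> 'b) set"
    and x y :: 'a and xb :: "real \<Rightarrow> 'b" and t0 t1 :: real
    and \<Lambda> :: "(real \<times> 'a) set" and f :: "real \<Rightarrow> ereal"
  assumes "embedded_manifold X A"
    and "embedded_manifold Y B"
    and "\<forall>z\<in>closure (topspace X \<times> topspace Y). c z \<noteq> -\<infinity>"
    and "lsc_on (closure (topspace X \<times> topspace Y)) c"
    and "openin (prod_topology X Y) N"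
    and "weakly_regular A B N c"
    and "geodesic_on X A Y B N c {0<..<1} (\<lambda>t. (x, xb t))"
    and "0 \<le> t0" and "t0 < t1" and "t1 \<le> 1"
    and "y \<in> topspace X"
    and "\<Lambda> = {(t, z). t \<in> {0<..<1} \<and> z \<in> topspace X \<and> z \<in> illuminated X A Y B N c x (xb t)}"
    and "{t0<..<t1} \<times> {y} \<subseteq> (prod_topology (top_of_set {0<..<1}) X) interior_of \<Lambda>"
    and "f = (\<lambda>t. - c (y, xb t) + c (x, xb t))"
  shows "\<exists>L0 L1. ((\<lambda>\<epsilon>. f (t0 + \<epsilon>)) \<longlongrightarrow> L0) (at_right 0) \<and>
                 ((\<lambda>\<epsilon>. f (t1 - \<epsilon>)) \<longlongrightarrow> L1) (at_right 0) \<and>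
                 (\<forall>t\<in>{t0<..<t1}. f t \<le> max L0 L1)"
proof -
  interpret cost_setting X A Y B c N x xb
    using assms(1,2,5,6,7) by unfold_locales (simp_all add: embedded_manifold_def)
  have lit: "\<exists>\<delta> V. \<delta> > 0 \<and> openin X V \<and> y \<in> V \<and>
      (\<forall>t z. \<bar>t - b\<bar> < \<delta> \<longrightarrow> z \<in> V \<longrightarrow> t \<in> {0<..<1} \<and> z \<in> illuminated X A Y B N c x (xb t))"
    if b: "b \<in> {t0<..<t1}" for b
  proof -
    have "(b, y) \<in> (prod_topology (top_of_set {0<..<1}) X) interior_of \<Lambda>"
      using b assms(13) by blast
    then obtain O' where O': "openin (prod_topology (top_of_set {0<..<1}) X) O'" "(b, y) \<in> O'" "O' \<subseteq> \<Lambda>"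
      unfolding interior_of_def by blast
    \<comment> \<open>An interior point of \<Lambda> has a rectangle of times and points inside
      \<Lambda>, which makes one neighbourhood of \<open>y\<close> work for all times near
      \<open>b\<close>.\<close>
    obtain T V where TV: "openin (top_of_set {0<..<1}) T" "openin X V" "b \<in> T" "y \<in> V" "T \<times> V \<subseteq> O'"
      using O'(1)[unfolded openin_prod_topology_alt, rule_format, OF O'(2)] by (elim exE conjE)
    have "open T" using TV(1) by (rule openin_open_trans) simp
    then obtain \<delta> where \<delta>: "\<delta> > 0" "ball b \<delta> \<subseteq> T"
      using TV(3) unfolding open_contains_ball by blast
    have "t \<in> {0<..<1} \<and> z \<in> illuminated X A Y B N c x (xb t)" if "\<bar>t - b\<bar> < \<delta>" "z \<in> V" for t z
    proof -
      have "t \<in> T" using subsetD[OF \<delta>(2), of t] that by (simp add: dist_real_def abs_minus_commute)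
      then have "(t, z) \<in> \<Lambda>" using that(2) TV(5) O'(3) by blast
      then show ?thesis by (simp add: assms(12))
    qed
    then show ?thesis using \<delta>(1) TV(2,4) by blast
  qed
  have b01: "b \<in> {0<..<1}" if "b \<in> {t0<..<t1}" for b
    using that assms(8,10) by auto
  define g where "g t = \<kappa> x t - \<kappa> y t" for t
  define g1 where "g1 t = deriv (\<kappa> x) t - deriv (\<kappa> y) t" for t
  define g2 where "g2 t = deriv (deriv (\<kappa> x)) t - deriv (deriv (\<kappa> y)) t" for t
  have derivs: "(g has_real_derivative g1 b) (at b)" "(g1 has_real_derivative g2 b) (at b)"
    "g1 b = 0 \<Longrightarrow> \<exists>d>0. \<exists>k. \<forall>t. \<bar>t - b\<bar> < d \<longrightarrow> g2 t \<ge> - k * \<bar>g1 t\<bar>"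
    "(y, xb b) \<in> N"
    if b: "b \<in> {t0<..<t1}" for b
  proof -
    obtain \<delta> V where V: "\<delta> > 0" "openin X V" "y \<in> V"
      "\<forall>t z. \<bar>t - b\<bar> < \<delta> \<longrightarrow> z \<in> V \<longrightarrow> t \<in> {0<..<1} \<and> z \<in> illuminated X A Y B N c x (xb t)"
      using lit[OF b] by (elim exE conjE)
    note m = mountain_derivatives[OF b01[OF b] V(1-3) V(4)[rule_format]]
    show "(g has_real_derivative g1 b) (at b)" unfolding g_def g1_def
      by (intro DERIV_diff m(1,2))
    show "(g1 has_real_derivative g2 b) (at b)" unfolding g1_def g2_def
      by (intro DERIV_diff m(3,4))
    show "\<exists>d>0. \<exists>k. \<forall>t. \<bar>t - b\<bar> < d \<longrightarrow> g2 t \<ge> - k * \<bar>g1 t\<bar>" if "g1 b = 0"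
      unfolding g1_def g2_def by (rule m(5)) (use that in \<open>simp_all add: g1_def\<close>)
    show "(y, xb b) \<in> N"
      using V(4)[rule_format, of b y] V(1,3) by (simp add: illuminated_def slice_def)
  qed
  have f_eq: "f t = ereal (g t)" if t: "t \<in> {t0<..<t1}" for t
  proof -
    \<comment> \<open>Finiteness on \<open>N\<close> makes \<open>real_of_ereal\<close> lossless, so
      that the extended real sum in \<open>f\<close> is an ordinary difference.\<close>
    have "\<bar>c z\<bar> \<noteq> \<infinity>" if "z \<in> N" for z
      using assms(6)[unfolded weakly_regular_def cost_C4_on_def, THEN conjunct1, THEN conjunct1] that
      by (rule bspec)
    then have "c (x, xb t) = ereal (\<kappa> x t)" "c (y, xb t) = ereal (\<kappa> y t)"
      using continuous_map_x_xb(2)[OF b01[OF t]] derivs(4)[OF t] by (simp_all add: \<kappa>_def ereal_real)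
    then show ?thesis by (simp add: assms(14) g_def)
  qed
  have "g1 b > 0" if "t0 < a" "a \<le> b" "b < t1" "g1 a > 0" for a b
    using derivative_stays_positive[of t0 t1 g1 g2 a b] derivs(2,3) that by blast
  then obtain L0 L1 where L: "((\<lambda>\<epsilon>. ereal (g (t0 + \<epsilon>))) \<longlongrightarrow> L0) (at_right 0)"
     "((\<lambda>\<epsilon>. ereal (g (t1 - \<epsilon>))) \<longlongrightarrow> L1) (at_right 0)"
     "\<forall>t\<in>{t0<..<t1}. ereal (g t) \<le> max L0 L1"
    using maximum_principle_of_derivative_sign[OF assms(9) derivs(1)] by blast
  \<comment> \<open>\<open>f\<close> is identified with \<open>g\<close> only inside the open
    interval, which is enough for one-sided limits at its ends.\<close>
  have near: "\<forall>\<^sub>F \<epsilon> in at_right 0. \<epsilon> \<in> {0<..<t1 - t0}"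
    using assms(9) by (intro eventually_at_rightI[of 0 "t1 - t0"]) auto
  have "((\<lambda>\<epsilon>. f (t0 + \<epsilon>)) \<longlongrightarrow> L0) (at_right 0)"
    by (rule Lim_transform_eventually[OF L(1) eventually_mono[OF near]]) (simp add: f_eq)
  moreover have "((\<lambda>\<epsilon>. f (t1 - \<epsilon>)) \<longlongrightarrow> L1) (at_right 0)"
    by (rule Lim_transform_eventually[OF L(2) eventually_mono[OF near]]) (simp add: f_eq)
  ultimately show ?thesis using L(3) f_eq by metis
qed

end
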